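(* Let $N\ge 1$ be an integer and let $p\in\{1,\dots,[2\sqrt2N]\}$. There exist a constant $e^*=e^*_{N,p}\in\,]0,1[$, an affine function $\mathcal G:[0,e^*]\to\mathbb{R}^+$ and a smooth function $\xi=\mathcal H_{N,p}(e)$, $e\in[0,e^*[$, with $\mathcal H_{N,p}(0)=\xi_p$, such that for every $e\in[0,e^*[$ the function $Z^{N}_{e,p}(t)=z(t;\mathcal H_{N,p}(e),e)$ is an even $2N\pi$-periodic solution of $$\ddot z=-\frac{z}{(z^2+r(t,e)^2)^{3/2}},\qquad \dot z(0)=\dot z(N\pi)=0,$$ and $$|Z^{N}_{e,p}(t)|\le\mathcal G(e)\qquad\text{for all }t\in\mathbb{R},$$ where $\mathcal G(e)=\xi_p+\gamma e$ and $\gamma=\gamma_{N,p}$ is the explicit constant $$\gamma=M\mathcal R+\frac{3N\pi\sigma^*\mathcal R^2}{2(1-e^* )},$$ with $M,\mathcal R,\sigma^*$ the constants (depending on $N,p$) defined in the context.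
   Context: Sitnikov equation. For $e\in[0,1[$, $r(t,e)=\frac12(1-e\cos u)$, where $u=u(t,e)$ is defined by Kepler's equation $u-e\sin u=t$. For $\xi\in\mathbb{R}$, $e\in[0,1[$, $z(t;\xi,e)$ denotes the solution (defined for all $t\in\mathbb{R}$) of $\ddot z=-z/(z^2+r(t,e)^2)^{3/2}$ with $z(0)=\xi$, $\dot z(0)=0$. $[x]$ denotes the integer part of $x$. The numbers $\xi_p$. Let $\nu=[2\sqrt2N]$. For $e=0$ (so $r\equiv 1/2$) it is known that the set of $\xi>0$ with $\dot z(N\pi;\xi,0)=0$ is $\{\xi_1,\dots,\xi_\nu\}$ with $\xi_1>\xi_2>\dots>\xi_\nu$, and $\xi_p$ is labelled so that $\varphi_p(t)=z(t;\xi_p,0)$ has exactly $p$ zeros in $[0,N\pi]$. The constants. It is known that there is a positive number $\xi_*$ such that every even $2N\pi$-periodic solution $z(t)$ of the Sitnikov equation (for any $e\in[0,1[$) satisfies $|z(t)|<\xi_*$ for all $t$; fix such a $\xi_*$. The variational equation along $z(t;\xi,e)$ is $$\ddot y+a_{\xi,e}(t)y=0,\qquad a_{\xi,e}(t)=\frac{r(t,e)^2-2z^2}{(z^2+r(t,e)^2)^{5/2}},\quad z=z(t;\xi,e),\ t\in[0,N\pi],$$ with canonical solutions $\phi_1,\phi_2$ ($\phi_1(0)=\dot\phi_2(0)=1$, $\dot\phi_1(0)=\phi_2(0)=0$). For $e=0$ let $R_0(\xi)=\max\{\|\phi_i\|_\infty,\|\dot\phi_i\|_\infty:i=1,2\}$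 (sup norms on $[0,N\pi]$) and $r_0=\sup_{\xi\in[0,\xi_*]}R_0(\xi)$. For $e\in\,]0,1[$ put $$b_1(e)=\frac{9216(N\pi)^2e}{(1-e)^8},\quad b_2(e)=\frac{192N\pi e}{(1-e)^5},\quad R_m(e)^2=\frac{\sqrt{9b_2(e)^2+20b_1(e)}-3b_2(e)}{10\,b_1(e)},\ R_m(e)>0,$$ and $\widetilde Q_m(e)=-2R_m(e)^3\big(2b_1(e)R_m(e)^2+b_2(e)\big)$. Let $E^*\in\,]0,1[$ be the root of $\widetilde Q_m(e)=-r_0$, and set $$\mathcal R=R_m(E^* ),\qquad \sigma^*=\frac{16}{(1-E^* )^3},\qquad \Psi=\frac{12N\pi\sigma^*(1+3N\pi\sigma^*\mathcal R^2)\mathcal R^3}{(1-E^* )^2}.$$ Let $\dot\phi_1(N\pi,0)$ denote the value at $t=N\pi$ of $\dot\phi_1$ for $e=0$ and $\xi=\xi_p$ (it is nonzero), and put $$\hat E=\frac{|\dot\phi_1(N\pi,0)|}{2\Psi},\qquad E^{**}=\min\{E^*,\hat E\},\qquad M=\frac{12N\pi\,(1+2N\pi\sigma^*\mathcal R^2)}{(1-E^* )^4\big(|\dot\phi_1(N\pi,0)|-\Psi E^{**}\big)}.$$ *)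

theory Defs
  imports "HOL-Analysis.Analysis"
begin

definition kepler_u :: "real \<Rightarrow> real \<Rightarrow> real" where
  "kepler_u t e = (THE u. u - e * sin u = t)"

definition r :: "real \<Rightarrow> real \<Rightarrow> real" where
  "r t e = 1/2 * (1 - e * cos (kepler_u t e))"

(* The first conjunct states differentiability of z, so that deriv z is the velocity. *)
definition sitnikov_solution :: "real \<Rightarrow> (real \<Rightarrow> real) \<Rightarrow> bool" where
  "sitnikov_solution e z \<longleftrightarrow>
     (\<forall>t. (z has_real_derivative deriv z t) (at t) \<and>
          (deriv z has_real_derivative
             - z t / ((z t)\<^sup>2 + (r t e)\<^sup>2) powr (3/2)) (at t))"

definition sitnikov_z :: "real \<Rightarrow> real \<Rightarrow> real \<Rightarrow> real" where
  "sitnikov_z \<xi> e = (THE z. sitnikov_solution e z \<and> z 0 = \<xi> \<and> deriv z 0 = 0)"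

definition even_periodic :: "nat \<Rightarrow> (real \<Rightarrow> real) \<Rightarrow> bool" where
  "even_periodic N z \<longleftrightarrow>
     (\<forall>t. z (- t) = z t) \<and> (\<forall>t. z (t + 2 * real N * pi) = z t)"

(* The candidates are finitely many and the number of zeros separates them, so the label p
   determines the amplitude; the resulting numbering is decreasing in the amplitude. *)
definition xi :: "nat \<Rightarrow> nat \<Rightarrow> real" where
  "xi N p = (THE \<xi>. 0 < \<xi> \<and> deriv (sitnikov_z \<xi> 0) (real N * pi) = 0 \<and>
               card {t \<in> {0..real N * pi}. sitnikov_z \<xi> 0 t = 0} = p)"

definition a_coeff :: "real \<Rightarrow> real \<Rightarrow> real \<Rightarrow> real" where
  "a_coeff \<xi> e t = ((r t e)\<^sup>2 - 2 * (sitnikov_z \<xi> e t)\<^sup>2) /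
                   ((sitnikov_z \<xi> e t)\<^sup>2 + (r t e)\<^sup>2) powr (5/2)"

(* The linear equation is solved on the whole line, where its coefficient is defined; only
   the values on [0, N pi] are used.  This keeps deriv two-sided at the endpoints and makes
   the solution unique as a total function. *)
definition variational_solution :: "real \<Rightarrow> real \<Rightarrow> (real \<Rightarrow> real) \<Rightarrow> bool" where
  "variational_solution \<xi> e y \<longleftrightarrow>
     (\<forall>t. (y has_real_derivative deriv y t) (at t) \<and>
          (deriv y has_real_derivative - a_coeff \<xi> e t * y t) (at t))"

definition phi1 :: "real \<Rightarrow> real \<Rightarrow> real \<Rightarrow> real" where
  "phi1 \<xi> e = (THE y. variational_solution \<xi> e y \<and> y 0 = 1 \<and> deriv y 0 = 0)"

definition phi2 :: "real \<Rightarrow> real \<Rightarrow> real \<Rightarrow> real" where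
  "phi2 \<xi> e = (THE y. variational_solution \<xi> e y \<and> y 0 = 0 \<and> deriv y 0 = 1)"

definition sup_norm :: "nat \<Rightarrow> (real \<Rightarrow> real) \<Rightarrow> real" where
  "sup_norm N f = (SUP t\<in>{0..real N * pi}. \<bar>f t\<bar>)"

definition R0 :: "nat \<Rightarrow> real \<Rightarrow> real" where
  "R0 N \<xi> = Max {sup_norm N (phi1 \<xi> 0), sup_norm N (deriv (phi1 \<xi> 0)),
                 sup_norm N (phi2 \<xi> 0), sup_norm N (deriv (phi2 \<xi> 0))}"

(* Throughout, xs stands for the fixed a priori bound \<xi>\<^sub>* on even 2N\<pi>-periodic solutions. *)
definition r0 :: "nat \<Rightarrow> real \<Rightarrow> real" where
  "r0 N xs = (SUP \<xi>\<in>{0..xs}. R0 N \<xi>)"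

definition b1 :: "nat \<Rightarrow> real \<Rightarrow> real" where
  "b1 N e = 9216 * (real N * pi)\<^sup>2 * e / (1 - e) ^ 8"

definition b2 :: "nat \<Rightarrow> real \<Rightarrow> real" where
  "b2 N e = 192 * real N * pi * e / (1 - e) ^ 5"

definition R_m :: "nat \<Rightarrow> real \<Rightarrow> real" where
  "R_m N e = sqrt ((sqrt (9 * (b2 N e)\<^sup>2 + 20 * b1 N e) - 3 * b2 N e) / (10 * b1 N e))"

definition Q_m :: "nat \<Rightarrow> real \<Rightarrow> real" where
  "Q_m N e = - 2 * (R_m N e) ^ 3 * (2 * b1 N e * (R_m N e)\<^sup>2 + b2 N e)"

definition E_star :: "nat \<Rightarrow> real \<Rightarrow> real" where
  "E_star N xs = (THE e. 0 < e \<and> e < 1 \<and> Q_m N e = - r0 N xs)"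

definition R_cal :: "nat \<Rightarrow> real \<Rightarrow> real" where
  "R_cal N xs = R_m N (E_star N xs)"

definition sigma_star :: "nat \<Rightarrow> real \<Rightarrow> real" where
  "sigma_star N xs = 16 / (1 - E_star N xs) ^ 3"

definition Psi :: "nat \<Rightarrow> real \<Rightarrow> real" where
  "Psi N xs = 12 * real N * pi * sigma_star N xs *
      (1 + 3 * real N * pi * sigma_star N xs * (R_cal N xs)\<^sup>2) * (R_cal N xs) ^ 3 /
      (1 - E_star N xs)\<^sup>2"

definition dphi1_end :: "nat \<Rightarrow> nat \<Rightarrow> real" where
  "dphi1_end N p = deriv (phi1 (xi N p) 0) (real N * pi)"

definition E_hat :: "nat \<Rightarrow> nat \<Rightarrow> real \<Rightarrow> real" where
  "E_hat N p xs = \<bar>dphi1_end N p\<bar> / (2 * Psi N xs)"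

definition E_star_star :: "nat \<Rightarrow> nat \<Rightarrow> real \<Rightarrow> real" where
  "E_star_star N p xs = min (E_star N xs) (E_hat N p xs)"

definition M_const :: "nat \<Rightarrow> nat \<Rightarrow> real \<Rightarrow> real" where
  "M_const N p xs =
     12 * real N * pi * (1 + 2 * real N * pi * sigma_star N xs * (R_cal N xs)\<^sup>2) /
     ((1 - E_star N xs) ^ 4 * (\<bar>dphi1_end N p\<bar> - Psi N xs * E_star_star N p xs))"

(* es is the length e\<^sup>* of the eccentricity interval. *)
definition gamma_const :: "nat \<Rightarrow> nat \<Rightarrow> real \<Rightarrow> real \<Rightarrow> real" where
  "gamma_const N p xs es =
     M_const N p xs * R_cal N xs +
     3 * real N * pi * sigma_star N xs * (R_cal N xs)\<^sup>2 / (2 * (1 - es))"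

(* C-infinity on S: D k is the k-th derivative, one-sided at endpoints belonging to S. *)
definition smooth_on :: "real set \<Rightarrow> (real \<Rightarrow> real) \<Rightarrow> bool" where
  "smooth_on S f \<longleftrightarrow>
     (\<exists>D :: nat \<Rightarrow> real \<Rightarrow> real. (\<forall>x\<in>S. D 0 x = f x) \<and>
        (\<forall>k. \<forall>x\<in>S. (D k has_real_derivative D (Suc k) x) (at x within S)))"

end

theory Submission
  imports Defs "HOL-Complex_Analysis.Complex_Analysis"
begin

text \<open>
  The constant \<open>\<gamma>\<close> strictly exceeds the first-order growth rate of the branch at \<open>e = 0\<close>, so only
  a local continuation from the circular problem is needed and \<open>e\<^sup>*\<close> may be taken as small as desired.

  For \<open>e = 0\<close> the equation is autonomous. A Sturm comparison shows that the amplitude determines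
  the quarter period injectively, and, applied to the variational equation, that
  \<open>\<phi>\<^sub>1'(N\<pi>)\<close> does not vanish. Hence the linear problem \<open>y'' + a y = g\<close>, \<open>y'(0) = y'(N\<pi>) = 0\<close> has
  a bounded inverse, of norm at most \<open>K = 2 r\<^sub>0\<^sup>2 N\<pi> (r\<^sub>0/|\<phi>\<^sub>1'(N\<pi>)| + 1)\<close>.

  The Neumann solution \<open>\<phi>\<^sub>p + w\<close> is a fixed point of a contraction obtained from this inverse. Solving
  it for complex \<open>e\<close>, in a class of functions holomorphic in \<open>e\<close>, yields a branch whose amplitude is
  the real part of a holomorphic function and therefore smooth. As the force changes by at most
  \<open>12 e/(1 - e)\<^sup>3\<close> when \<open>r\<close> moves from \<open>1/2\<close> to \<open>r(t,e)\<close>, the fixed point equation gives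
  \<open>|w| \<le> (12 K + o(1)) e\<close>, and \<open>12 K < \<gamma>\<close> because \<open>r\<^sub>0 < R_cal\<close> and \<open>\<sigma>\<^sup>* > 16\<close>.
\<close>

section \<open>Second-order equations on the line\<close>

text \<open>The reference orbit stays fixed: w is the deviation from the circular orbit \<phi>_p, so
  only the fundamental solutions for e = 0 enter, and these are what r0 bounds. Evenness and
  periodicity come with the Neumann conditions, because r is even and 2\<pi>-periodic in t.

  The gap between 12 K and \<gamma> has to pay for two errors, the nonlinear remainder and the
  factor (1 - e)^(-3); this decides how small e must be. As e^* itself enters \<gamma>, the branch
  is built for the value of \<gamma> at e^* = 0, the smallest one.

  The complex detour takes the place of a smooth implicit function theorem. Its price is the branch
  point of the force at z^2 + r^2 = 0: the iteration has to stay where this sum has positive real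
  part.

  The nonperturbative input is the softening of the spring: force per displacement decreases as |z|
  grows. It makes the period depend on the amplitude to first order, and this dependence is what
  keeps \<phi>_1'(N\<pi>) away from 0.\<close>

definition ode2 :: "(real \<Rightarrow> real \<Rightarrow> real) \<Rightarrow> (real \<Rightarrow> real) \<Rightarrow> (real \<Rightarrow> real) \<Rightarrow> bool" where
  "ode2 F y v \<longleftrightarrow> (\<forall>t. (y has_real_derivative v t) (at t) \<and>
                       (v has_real_derivative F t (y t)) (at t))"

text \<open>The weight exp(-(1 + K) t) makes d^2 + v^2 nonincreasing: the term 2 d v costs at most 1
  and 2 v a at most K times that sum. Only |a| \<le> K |d| is asked, so a may be the difference of
  the forces along two solutions.\<close>

lemma gronwall2:
  fixes d v a :: "real \<Rightarrow> real"
  assumes "0 \<le> T" "0 \<le> K"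
    and d: "\<And>t. t \<in> {0..T} \<Longrightarrow> (d has_real_derivative v t) (at t within {0..T})"
    and v: "\<And>t. t \<in> {0..T} \<Longrightarrow> (v has_real_derivative a t) (at t within {0..T})"
    and a: "\<And>t. t \<in> {0..T} \<Longrightarrow> \<bar>a t\<bar> \<le> K * \<bar>d t\<bar>"
  shows "(d T)\<^sup>2 + (v T)\<^sup>2 \<le> ((d 0)\<^sup>2 + (v 0)\<^sup>2) * exp ((1 + K) * T)"
proof -
  define h where "h = (\<lambda>t. ((d t)\<^sup>2 + (v t)\<^sup>2) * exp (- (1 + K) * t))"
  have "h T \<le> h 0"
  proof (rule DERIV_nonpos_imp_decreasing_open[OF \<open>0 \<le> T\<close>])
    fix t assume t: "0 < t" "t < T"
    then have at: "at t within {0..T} = at t" by (intro at_within_Icc_at)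
    have [derivative_intros]: "(d has_real_derivative v t) (at t)" "(v has_real_derivative a t) (at t)"
      using d[of t] v[of t] t at by auto
    let ?D = "(2 * d t * v t + 2 * v t * a t - (1 + K) * ((d t)\<^sup>2 + (v t)\<^sup>2)) * exp (- (1 + K) * t)"
    have "(h has_real_derivative ?D) (at t)"
      unfolding h_def by (auto intro!: derivative_eq_intros simp: algebra_simps)
    moreover have "?D \<le> 0"
    proof -
      have 1: "2 * d t * v t \<le> (d t)\<^sup>2 + (v t)\<^sup>2"
        using sum_squares_bound[of "d t" "v t"] by simp
      have "2 * v t * a t \<le> 2 * \<bar>v t\<bar> * \<bar>a t\<bar>"
        by (metis abs_ge_self abs_mult abs_numeral)
      also have "\<dots> \<le> 2 * \<bar>v t\<bar> * (K * \<bar>d t\<bar>)"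
        using a[of t] t by (intro mult_left_mono) auto
      also have "\<dots> = K * (2 * \<bar>d t\<bar> * \<bar>v t\<bar>)" by simp
      also have "\<dots> \<le> K * ((d t)\<^sup>2 + (v t)\<^sup>2)"
        using sum_squares_bound[of "\<bar>d t\<bar>" "\<bar>v t\<bar>"] \<open>0 \<le> K\<close> by (intro mult_left_mono) auto
      finally have 2: "2 * v t * a t \<le> K * ((d t)\<^sup>2 + (v t)\<^sup>2)" .
      show ?thesis using 1 2 by (intro mult_nonpos_nonneg) (auto simp: algebra_simps)
    qed
    ultimately show "\<exists>y. (h has_real_derivative y) (at t) \<and> y \<le> 0" by blast
  next
    have "continuous_on {0..T} d" "continuous_on {0..T} v"
      using d v by (meson DERIV_continuous_on)+
    then show "continuous_on {0..T} h"
      unfolding h_def by (intro continuous_intros)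
  qed
  then have "((d T)\<^sup>2 + (v T)\<^sup>2) * exp (- (1 + K) * T) * exp ((1 + K) * T) 
      \<le> ((d 0)\<^sup>2 + (v 0)\<^sup>2) * exp ((1 + K) * T)"
    unfolding h_def by (intro mult_right_mono) auto
  moreover have "exp (- (1 + K) * T) * exp ((1 + K) * T) = 1"
    by (simp add: exp_add[symmetric] algebra_simps)
  ultimately show ?thesis by (simp only: mult.assoc mult_1_right)
qed

text \<open>Derivatives are taken within [0, T] because the solution produced by the Neumann problem
  lives on a compact interval; this lemma identifies it with the globally defined
  \<open>sitnikov_z\<close>.\<close>

lemma ode2_unique_within:
  fixes F :: "real \<Rightarrow> real \<Rightarrow> real"
  assumes "0 \<le> T"
    and lip: "\<And>t y z. \<bar>F t y - F t z\<bar> \<le> K * \<bar>y - z\<bar>"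
    and y1: "\<And>t. t \<in> {0..T} \<Longrightarrow> (y1 has_real_derivative v1 t) (at t within {0..T})"
      "\<And>t. t \<in> {0..T} \<Longrightarrow> (v1 has_real_derivative F t (y1 t)) (at t within {0..T})"
    and y2: "\<And>t. t \<in> {0..T} \<Longrightarrow> (y2 has_real_derivative v2 t) (at t within {0..T})"
      "\<And>t. t \<in> {0..T} \<Longrightarrow> (v2 has_real_derivative F t (y2 t)) (at t within {0..T})"
    and "y1 0 = y2 0" "v1 0 = v2 0"
  shows "y1 T = y2 T \<and> v1 T = v2 T"
proof -
  have K: "0 \<le> K" using lip[of 0 1 0] by (smt (verit) abs_ge_zero mult_cancel_left1)
  have "(y1 T - y2 T)\<^sup>2 + (v1 T - v2 T)\<^sup>2 \<le> ((y1 0 - y2 0)\<^sup>2 + (v1 0 - v2 0)\<^sup>2) * exp ((1 + K) * T)"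
  proof (rule gronwall2[OF \<open>0 \<le> T\<close> K])
    fix t assume "t \<in> {0..T}"
    then show "((\<lambda>t. y1 t - y2 t) has_real_derivative v1 t - v2 t) (at t within {0..T})"
      "((\<lambda>t. v1 t - v2 t) has_real_derivative F t (y1 t) - F t (y2 t)) (at t within {0..T})"
      using y1 y2 by (auto intro!: DERIV_diff)
  qed (use lip in auto)
  then show ?thesis using \<open>y1 0 = y2 0\<close> \<open>v1 0 = v2 0\<close>
    by (simp add: sum_power2_le_zero_iff)
qed

lemma ode2_unique:
  fixes F :: "real \<Rightarrow> real \<Rightarrow> real"
  assumes lip: "\<And>t y z. \<bar>F t y - F t z\<bar> \<le> K * \<bar>y - z\<bar>"
    and y1: "ode2 F y1 v1" and y2: "ode2 F y2 v2"
    and eq: "y1 t0 = y2 t0" "v1 t0 = v2 t0"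
  shows "y1 = y2 \<and> v1 = v2"
proof -
  have *: "y1 t = y2 t \<and> v1 t = v2 t" for t
  proof (cases "t0 \<le> t")
    case True
    have D: "((\<lambda>s. y (t0 + s)) has_real_derivative v (t0 + s)) (at s within A)"
      "((\<lambda>s. v (t0 + s)) has_real_derivative F (t0 + s) (y (t0 + s))) (at s within A)"
      if "ode2 F y v" for y v s A
    proof -
      have "((\<lambda>s. y (t0 + s)) has_real_derivative v (t0 + s) * 1) (at s within A)"
        by (rule DERIV_chain'[where g=y]) (use that in \<open>auto simp: ode2_def intro!: derivative_eq_intros\<close>)
      moreover have "((\<lambda>s. v (t0 + s)) has_real_derivative F (t0 + s) (y (t0 + s)) * 1) (at s within A)"
        by (rule DERIV_chain'[where g=v]) (use that in \<open>auto simp: ode2_def intro!: derivative_eq_intros\<close>)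
      ultimately show "((\<lambda>s. y (t0 + s)) has_real_derivative v (t0 + s)) (at s within A)"
        "((\<lambda>s. v (t0 + s)) has_real_derivative F (t0 + s) (y (t0 + s))) (at s within A)"
        by simp_all
    qed
    have "y1 (t0 + (t - t0)) = y2 (t0 + (t - t0)) \<and> v1 (t0 + (t - t0)) = v2 (t0 + (t - t0))"
      by (rule ode2_unique_within[where F="\<lambda>s. F (t0 + s)" and K=K])
        (use True lip eq in \<open>auto intro!: D y1 y2\<close>)
    then show ?thesis by simp
  next
    case False
    have D: "((\<lambda>s. y (t0 - s)) has_real_derivative - v (t0 - s)) (at s within A)"
      "((\<lambda>s. - v (t0 - s)) has_real_derivative F (t0 - s) (y (t0 - s))) (at s within A)"
      if "ode2 F y v" for y v s A
    proof -
      have "((\<lambda>s. y (t0 - s)) has_real_derivative v (t0 - s) * (-1)) (at s within A)"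
        by (rule DERIV_chain'[where g=y]) (use that in \<open>auto simp: ode2_def intro!: derivative_eq_intros\<close>)
      moreover have "((\<lambda>s. v (t0 - s)) has_real_derivative F (t0 - s) (y (t0 - s)) * (-1)) (at s within A)"
        by (rule DERIV_chain'[where g=v]) (use that in \<open>auto simp: ode2_def intro!: derivative_eq_intros\<close>)
      ultimately show "((\<lambda>s. y (t0 - s)) has_real_derivative - v (t0 - s)) (at s within A)"
        "((\<lambda>s. - v (t0 - s)) has_real_derivative F (t0 - s) (y (t0 - s))) (at s within A)"
        using DERIV_minus by fastforce+
    qed
    have "y1 (t0 - (t0 - t)) = y2 (t0 - (t0 - t)) \<and> - v1 (t0 - (t0 - t)) = - v2 (t0 - (t0 - t))"
      by (rule ode2_unique_within[where F="\<lambda>s. F (t0 - s)" and K=K])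
        (use False lip eq in \<open>auto intro!: D y1 y2\<close>)
    then show ?thesis by simp
  qed
  then show ?thesis by auto
qed

section \<open>Global existence by Picard iteration\<close>

lemma antiderivative_exists:
  fixes h :: "real \<Rightarrow> 'a::euclidean_space"
  assumes "continuous_on UNIV h"
  shows "\<exists>H. H 0 = c \<and> (\<forall>t. (H has_vector_derivative h t) (at t))"
proof -
  have "\<exists>H. \<forall>t::real. -\<infinity> < ereal t \<longrightarrow> ereal t < \<infinity> \<longrightarrow> (H has_vector_derivative h t) (at t)"
    by (rule einterval_antiderivative) (use assms in \<open>auto simp: continuous_on_eq_continuous_at\<close>)
  then obtain H where H: "\<And>t. (H has_vector_derivative h t) (at t)" by auto
  have "((\<lambda>t. H t - H 0 + c) has_vector_derivative h t) (at t)" for t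
    using H[of t] by (auto intro!: derivative_eq_intros)
  then show ?thesis by (intro exI[of _ "\<lambda>t. H t - H 0 + c"]) auto
qed

text \<open>Integrating the weight exp(l |t|) gains a factor 1/l. With l twice the Lipschitz
  constant each Picard step halves the weighted distance on an interval of any length, so no
  patching of local solutions arises.\<close>

lemma exp_weighted_bound:
  fixes g :: "real \<Rightarrow> 'a::euclidean_space"
  assumes g: "\<And>t. (g has_vector_derivative h t) (at t)" "g 0 = 0"
    and h: "\<And>t. \<bar>t\<bar> \<le> T \<Longrightarrow> norm (h t) \<le> c * exp (l * \<bar>t\<bar>)"
    and "l > 0" "c \<ge> 0" "\<bar>t\<bar> \<le> T"
  shows "norm (g t) \<le> c / l * exp (l * \<bar>t\<bar>)"
proof -
  have pos: "norm (g t) \<le> c / l * exp (l * t)"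
    if g: "\<And>t. (g has_vector_derivative h t) (at t)" "g 0 = 0"
      and h: "\<And>t. \<bar>t\<bar> \<le> T \<Longrightarrow> norm (h t) \<le> c * exp (l * \<bar>t\<bar>)" and "0 < t" "t \<le> T"
    for g h :: "real \<Rightarrow> 'a" and t
  proof -
    have "norm (g t - g 0) \<le> c / l * exp (l * t) - c / l * exp (l * 0)"
    proof (rule differentiable_bound_general[OF \<open>0 < t\<close>, where f'=h and \<phi>'="\<lambda>s. c * exp (l * s)"])
      show "continuous_on {0..t} g"
      proof (rule continuous_at_imp_continuous_on, rule ballI)
        fix s
        show "isCont g s" by (rule has_vector_derivative_continuous[OF g(1)])
      qed
      show "continuous_on {0..t} (\<lambda>a. c / l * exp (l * a))"
        by (intro continuous_intros)
      fix s assume s: "0 < s" "s < t"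
      show "(g has_vector_derivative h s) (at s)" by (rule g)
      have "((\<lambda>a. c / l * exp (l * a)) has_real_derivative c * exp (l * s)) (at s)"
        using \<open>l > 0\<close> by (auto intro!: derivative_eq_intros)
      then show "((\<lambda>a. c / l * exp (l * a)) has_vector_derivative c * exp (l * s)) (at s)"
        by (simp add: has_real_derivative_iff_has_vector_derivative)
      show "norm (h s) \<le> c * exp (l * s)" using h[of s] s \<open>t \<le> T\<close> by auto
    qed
    also have "\<dots> \<le> c / l * exp (l * t)" using \<open>c \<ge> 0\<close> \<open>l > 0\<close> by simp
    finally show ?thesis using g(2) by simp
  qed
  consider "t = 0" | "t > 0" | "t < 0" by linarith
  then show ?thesis
  proof cases
    case 1
    then show ?thesis using g(2) assms by simp
  next
    case 2
    then show ?thesis using pos[OF g h, of t] \<open>\<bar>t\<bar> \<le> T\<close> by auto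
  next
    case 3
    have d: "((\<lambda>s. g (- s)) has_vector_derivative - h (- s)) (at s)" for s
    proof -
      have "(uminus has_vector_derivative -1) (at s)"
        by (auto intro!: derivative_eq_intros simp: has_real_derivative_iff_has_vector_derivative[symmetric])
      from vector_diff_chain_at[OF this g(1)[of "- s"]] show ?thesis by (simp add: o_def)
    qed
    have "norm (- h (- s)) \<le> c * exp (l * \<bar>s\<bar>)" if "\<bar>s\<bar> \<le> T" for s
      using h[of "- s"] that by auto
    from pos[of "\<lambda>s. g (- s)" "\<lambda>s. - h (- s)", OF d _ this, of "- t"]
    have "norm (g (- (- t))) \<le> c / l * exp (l * (- t))"
      using g(2) 3 \<open>\<bar>t\<bar> \<le> T\<close> by simp
    then show ?thesis using 3 by simp
  qed
qed

text \<open>Common convergence argument for the Picard iteration and for the holomorphic fixed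
  point: the telescoping series is dominated by a geometric one, whose tail is the error
  bound.\<close>

lemma geometric_increments:
  fixes x :: "nat \<Rightarrow> 'a::banach"
  assumes step: "\<And>n. norm (x (Suc n) - x n) \<le> C * (1/2) ^ n"
  shows "x \<longlonglongrightarrow> lim x" and "norm (x n - lim x) \<le> 2 * C * (1/2) ^ n"
proof -
  have "summable (\<lambda>n. C * (1/2::real) ^ n)" by (intro summable_mult summable_geometric) auto
  then have sd: "summable (\<lambda>n. x (Suc n) - x n)"
    by (rule summable_comparison_test[rotated]) (use step in auto)
  have tele: "(\<Sum>k<n. x (Suc k) - x k) = x n - x 0" for n
    using sum_lessThan_telescope[of x n] .
  have "(\<lambda>n. (x n - x 0) + x 0) \<longlonglongrightarrow> (\<Sum>k. x (Suc k) - x k) + x 0"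
    using summable_LIMSEQ[OF sd] unfolding tele by (intro tendsto_intros)
  then have S: "x \<longlonglongrightarrow> (\<Sum>k. x (Suc k) - x k) + x 0" by simp
  show L: "x \<longlonglongrightarrow> lim x" unfolding limI[OF S] by (rule S)
  have C: "0 \<le> C" using order_trans[OF norm_ge_zero step[of 0]] by simp
  have diff: "norm (x (n + m) - x n) \<le> 2 * C * (1/2) ^ n * (1 - (1/2) ^ m)" for m
  proof (induction m)
    case (Suc m)
    have "norm (x (n + Suc m) - x n) \<le> norm (x (Suc (n + m)) - x (n + m)) + norm (x (n + m) - x n)"
      using norm_triangle_ineq[of "x (Suc (n + m)) - x (n + m)" "x (n + m) - x n"] by simp
    also have "\<dots> \<le> C * (1/2) ^ (n + m) + 2 * C * (1/2) ^ n * (1 - (1/2) ^ m)"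
      using step Suc.IH by (rule add_mono)
    also have "\<dots> = 2 * C * (1/2) ^ n * (1 - (1/2) ^ Suc m)" by (simp add: power_add algebra_simps)
    finally show ?case .
  qed simp
  have "norm (lim x - x n) \<le> 2 * C * (1/2) ^ n"
  proof (rule Lim_bounded)
    show "(\<lambda>m. norm (x (n + m) - x n)) \<longlonglongrightarrow> norm (lim x - x n)"
      using LIMSEQ_ignore_initial_segment[OF L, of n] by (intro tendsto_intros) (simp add: add.commute)
    show "\<forall>m\<ge>0. norm (x (n + m) - x n) \<le> 2 * C * (1/2) ^ n"
    proof (intro allI impI)
      fix m
      have "2 * C * (1/2) ^ n * (1 - (1/2) ^ m) \<le> 2 * C * (1/2) ^ n * 1"
        using C by (intro mult_left_mono) auto
      then show "norm (x (n + m) - x n) \<le> 2 * C * (1/2) ^ n" using diff[of m] by simp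
    qed
  qed
  then show "norm (x n - lim x) \<le> 2 * C * (1/2) ^ n" by (simp add: norm_minus_commute)
qed

text \<open>K is a global constant, so the iterates converge uniformly on every bounded interval.
  Their derivatives X t (xs n t) then converge uniformly too, which allows the limit to be
  differentiated.\<close>

lemma picard_global:
  fixes X :: "real \<Rightarrow> 'a::euclidean_space \<Rightarrow> 'a"
  assumes cont: "continuous_on UNIV (\<lambda>(t, x). X t x)"
    and lip: "\<And>t x y. norm (X t x - X t y) \<le> K * norm (x - y)" and "K > 0"
  shows "\<exists>x. x 0 = x0 \<and> (\<forall>t. (x has_vector_derivative X t (x t)) (at t))"
proof -
  have contX: "continuous_on UNIV (\<lambda>t. X t (x t))" if "continuous_on UNIV x" for x
    using continuous_on_compose2[OF cont, of UNIV "\<lambda>t. (t, x t)"]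
      continuous_on_Pair[OF continuous_on_id that] by simp
  \<comment> \<open>The Picard operator as a choice of antiderivative with value x0 at 0; it covers
    both signs of t without oriented integrals.\<close>
  define P where "P x = (SOME H. H 0 = x0 \<and> (\<forall>t. (H has_vector_derivative X t (x t)) (at t)))" for x
  have P: "P x 0 = x0 \<and> (\<forall>t. (P x has_vector_derivative X t (x t)) (at t))"
    if "continuous_on UNIV x" for x
    unfolding P_def by (rule someI_ex[OF antiderivative_exists[OF contX[OF that]]])
  define xs where "xs n = (P ^^ n) (\<lambda>_. x0)" for n
  have xs_Suc: "xs (Suc n) = P (xs n)" for n by (simp add: xs_def)
  have contP: "continuous_on UNIV (P x)" if "continuous_on UNIV x" for x
  proof (rule continuous_at_imp_continuous_on, rule ballI)
    fix t
    show "isCont (P x) t" by (rule has_vector_derivative_continuous[OF P[OF that, THEN conjunct2, rule_format]])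
  qed
  have xc: "continuous_on UNIV (xs n)" for n
    by (induction n) (auto simp: xs_Suc contP, simp add: xs_def)
  have x0: "xs n 0 = x0" for n
    by (cases n) (auto simp: xs_Suc P xc, simp add: xs_def)
  have xd: "(xs (Suc n) has_vector_derivative X t (xs n t)) (at t)" for n t
    using P[OF xc] by (simp add: xs_Suc)
  have step: "\<exists>C\<ge>0. \<forall>n. \<forall>t. \<bar>t\<bar> \<le> T \<longrightarrow> norm (xs (Suc n) t - xs n t) \<le> C * (1/2) ^ n" for T
  proof -
    have cpt: "compact ((\<lambda>t. xs (Suc 0) t - xs 0 t) ` {-T..T})"
      by (intro compact_continuous_image continuous_intros continuous_on_subset[OF xc]) auto
    have "\<exists>C. \<forall>t\<in>{-T..T}. norm (xs (Suc 0) t - xs 0 t) \<le> C"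
      using compact_imp_bounded[OF cpt] unfolding bounded_iff by simp
    then obtain C where C: "\<And>t. t \<in> {-T..T} \<Longrightarrow> norm (xs (Suc 0) t - xs 0 t) \<le> C" by blast
    \<comment> \<open>For T < 0 the interval is empty and C may be negative; the maximum repairs
      this.\<close>
    define C' where "C' = max C 0"
    have W: "\<bar>t\<bar> \<le> T \<Longrightarrow> norm (xs (Suc n) t - xs n t) \<le> C' * (1/2) ^ n * exp (2 * K * \<bar>t\<bar>)" for n t
    proof (induction n arbitrary: t)
      case 0
      have "norm (xs (Suc 0) t - xs 0 t) \<le> C'" using C[of t] 0 unfolding C'_def by (smt (verit) atLeastAtMost_iff)
      also have "\<dots> \<le> C' * exp (2 * K * \<bar>t\<bar>)" using \<open>K > 0\<close> by (simp add: C'_def mult_le_cancel_left1)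
      finally show ?case by simp
    next
      case (Suc n)
      have "norm (xs (Suc (Suc n)) t - xs (Suc n) t) \<le> (K * (C' * (1/2) ^ n)) / (2 * K) * exp (2 * K * \<bar>t\<bar>)"
      proof (rule exp_weighted_bound[where h="\<lambda>t. X t (xs (Suc n) t) - X t (xs n t)" and T=T])
        show "((\<lambda>a. xs (Suc (Suc n)) a - xs (Suc n) a) has_vector_derivative
            X t (xs (Suc n) t) - X t (xs n t)) (at t)" for t
          by (intro has_vector_derivative_diff xd)
        fix s :: real assume "\<bar>s\<bar> \<le> T"
        have "norm (X s (xs (Suc n) s) - X s (xs n s)) \<le> K * norm (xs (Suc n) s - xs n s)" by (rule lip)
        also have "\<dots> \<le> K * (C' * (1/2) ^ n * exp (2 * K * \<bar>s\<bar>))"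
          using Suc.IH[OF \<open>\<bar>s\<bar> \<le> T\<close>] \<open>K > 0\<close> by (intro mult_left_mono) auto
        finally show "norm (X s (xs (Suc n) s) - X s (xs n s)) \<le> K * (C' * (1/2) ^ n) * exp (2 * K * \<bar>s\<bar>)"
          by (simp add: mult.assoc)
      qed (use Suc.prems \<open>K > 0\<close> x0 in \<open>auto simp: C'_def\<close>)
      then show ?case using \<open>K > 0\<close> by simp
    qed
    show ?thesis
    proof (intro exI[of _ "C' * exp (2 * K * \<bar>T\<bar>)"] conjI allI impI)
      fix n and t :: real assume t: "\<bar>t\<bar> \<le> T"
      have "norm (xs (Suc n) t - xs n t) \<le> C' * (1/2) ^ n * exp (2 * K * \<bar>t\<bar>)" by (rule W[OF t])
      also have "\<dots> \<le> C' * (1/2) ^ n * exp (2 * K * \<bar>T\<bar>)"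
        using t \<open>K > 0\<close> by (intro mult_left_mono) (auto simp: C'_def)
      finally show "norm (xs (Suc n) t - xs n t) \<le> C' * exp (2 * K * \<bar>T\<bar>) * (1/2) ^ n" by (simp add: mult_ac)
    qed (auto simp: C'_def)
  qed
  define x where "x t = lim (\<lambda>n. xs n t)" for t
  have conv: "\<exists>C\<ge>0. \<forall>t. \<bar>t\<bar> \<le> T \<longrightarrow> (\<lambda>n. xs n t) \<longlonglongrightarrow> x t \<and> (\<forall>n. norm (xs n t - x t) \<le> C * (1/2) ^ n)" for T
  proof -
    from step[of T] obtain C where "C \<ge> 0"
      and C: "\<And>n t. \<bar>t\<bar> \<le> T \<Longrightarrow> norm (xs (Suc n) t - xs n t) \<le> C * (1/2) ^ n" by blast
    have "(\<lambda>n. xs n t) \<longlonglongrightarrow> x t \<and> (\<forall>n. norm (xs n t - x t) \<le> (2 * C) * (1/2) ^ n)" if t: "\<bar>t\<bar> \<le> T" for t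
      using geometric_increments[of "\<lambda>n. xs n t", OF C[OF t]] by (simp add: x_def)
    then show ?thesis using \<open>C \<ge> 0\<close> by (intro exI[of _ "2 * C"]) auto
  qed
  have L: "(\<lambda>n. xs n t) \<longlonglongrightarrow> x t" for t using conv[of "\<bar>t\<bar>"] by auto
  have "x 0 = x0" using L[of 0] x0 by (simp add: LIMSEQ_const_iff)
  moreover have "(x has_vector_derivative X t (x t)) (at t)" for t
  proof -
    define T where "T = \<bar>t\<bar> + 1"
    from conv[of T] obtain C where C: "C \<ge> 0" "\<And>n s. \<bar>s\<bar> \<le> T \<Longrightarrow> norm (xs n s - x s) \<le> C * (1/2) ^ n"
      by blast
    have "\<exists>g. \<forall>s\<in>{-T<..<T}. (\<lambda>n. xs (Suc n) s) \<longlonglongrightarrow> g s \<and>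
        (g has_derivative (\<lambda>h. h *\<^sub>R X s (x s))) (at s within {-T<..<T})"
    proof (rule has_derivative_sequence[where ?x0.0=0 and l=x0 and f'="\<lambda>n s h. h *\<^sub>R X s (xs n s)"])
      show "(xs (Suc n) has_derivative (\<lambda>h. h *\<^sub>R X s (xs n s))) (at s within {-T<..<T})" for n s
        using xd[of n s] has_vector_derivative_at_within unfolding has_vector_derivative_def by blast
      show "0 \<in> {-T<..<T}" by (auto simp: T_def)
      show "(\<lambda>n. xs (Suc n) 0) \<longlonglongrightarrow> x0" using x0 by simp
      fix e :: real assume "e > 0"
      have "(\<lambda>n. K * (C * (1/2) ^ n)) \<longlonglongrightarrow> K * (C * 0)"
        by (intro tendsto_intros LIMSEQ_power_zero) auto
      then have "\<forall>\<^sub>F n in sequentially. K * (C * (1/2) ^ n) < e"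
        using \<open>e > 0\<close> by (intro order_tendstoD) auto
      then show "\<forall>\<^sub>F n in sequentially. \<forall>s\<in>{-T<..<T}. \<forall>h. norm (h *\<^sub>R X s (xs n s) - h *\<^sub>R X s (x s)) \<le> e * norm h"
      proof eventually_elim
        case (elim n)
        show ?case
        proof (intro ballI allI)
          fix s h :: real assume "s \<in> {-T<..<T}"
          have "norm (X s (xs n s) - X s (x s)) \<le> K * norm (xs n s - x s)" by (rule lip)
          also have "\<dots> \<le> K * (C * (1/2) ^ n)"
            using C(2)[of s n] \<open>s \<in> _\<close> \<open>K > 0\<close> by (intro mult_left_mono) auto
          also have "\<dots> \<le> e" using elim by simp
          finally have "\<bar>h\<bar> * norm (X s (xs n s) - X s (x s)) \<le> \<bar>h\<bar> * e" by (intro mult_left_mono) auto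
          then show "norm (h *\<^sub>R X s (xs n s) - h *\<^sub>R X s (x s)) \<le> e * norm h"
            by (simp add: scaleR_diff_right[symmetric] mult.commute)
        qed
      qed
    qed (rule convex_real_interval)
    then obtain g where g: "\<And>s. s \<in> {-T<..<T} \<Longrightarrow> (\<lambda>n. xs (Suc n) s) \<longlonglongrightarrow> g s"
      "\<And>s. s \<in> {-T<..<T} \<Longrightarrow> (g has_derivative (\<lambda>h. h *\<^sub>R X s (x s))) (at s within {-T<..<T})" by blast
    have gx: "g s = x s" if "s \<in> {-T<..<T}" for s
      by (rule LIMSEQ_unique[OF g(1)[OF that] LIMSEQ_Suc[OF L[of s]]])
    have t: "t \<in> {-T<..<T}" by (auto simp: T_def)
    have "(g has_derivative (\<lambda>h. h *\<^sub>R X t (x t))) (at t)"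
      using g(2)[OF t] unfolding at_within_open[OF t open_greaterThanLessThan] .
    then have "(x has_derivative (\<lambda>h. h *\<^sub>R X t (x t))) (at t)"
      by (rule has_derivative_transform_within_open[OF _ open_greaterThanLessThan t gx])
    then show ?thesis by (simp add: has_vector_derivative_def)
  qed
  ultimately show ?thesis by blast
qed

lemma ode2_exists:
  fixes F :: "real \<Rightarrow> real \<Rightarrow> real"
  assumes cont: "continuous_on UNIV (\<lambda>(t, y). F t y)"
    and lip: "\<And>t y z. \<bar>F t y - F t z\<bar> \<le> K * \<bar>y - z\<bar>"
  shows "\<exists>y v. ode2 F y v \<and> y 0 = y0 \<and> v 0 = v0"
proof -
  have K: "0 \<le> K" using lip[of 0 1 0] by (smt (verit) abs_ge_zero mult_cancel_left1)
  define X where "X = (\<lambda>t (x :: real \<times> real). (snd x, F t (fst x)))"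
  have "\<exists>x. x 0 = (y0, v0) \<and> (\<forall>t. (x has_vector_derivative X t (x t)) (at t))"
  proof (rule picard_global[where K="1 + K"])
    show "continuous_on UNIV (\<lambda>(t, x). X t x)"
      unfolding X_def case_prod_beta
      by (intro continuous_intros continuous_on_compose2[OF cont[unfolded case_prod_beta], of UNIV "\<lambda>p. (fst p, fst (snd p))", simplified])
    fix t and x y :: "real \<times> real"
    have "norm (X t x - X t y) \<le> norm (snd x - snd y) + norm (F t (fst x) - F t (fst y))"
      unfolding X_def by (simp add: norm_Pair sqrt_sum_squares_le_sum_abs)
    also have "\<dots> \<le> norm (snd (x - y)) + K * norm (fst (x - y))"
      using lip[of t "fst x" "fst y"] by simp
    also have "\<dots> \<le> norm (x - y) + K * norm (x - y)"
      using norm_snd_le[of "snd (x - y)" "fst (x - y)"] norm_fst_le[of "fst (x - y)" "snd (x - y)"] K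
      by (intro add_mono mult_left_mono) (auto simp del: fst_diff snd_diff)
    finally show "norm (X t x - X t y) \<le> (1 + K) * norm (x - y)" by (simp add: algebra_simps)
  qed (use K in auto)
  then obtain x where x: "x 0 = (y0, v0)" "\<And>t. (x has_vector_derivative X t (x t)) (at t)" by blast
  have "ode2 F (\<lambda>t. fst (x t)) (\<lambda>t. snd (x t))"
    unfolding ode2_def
  proof (intro allI conjI)
    fix t
    have "((\<lambda>t. fst (x t)) has_vector_derivative fst (X t (x t))) (at t)"
      by (rule bounded_linear.has_vector_derivative[OF bounded_linear_fst x(2)])
    then show "((\<lambda>t. fst (x t)) has_real_derivative snd (x t)) (at t)"
      by (simp add: X_def has_real_derivative_iff_has_vector_derivative)
    have "((\<lambda>t. snd (x t)) has_vector_derivative snd (X t (x t))) (at t)"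
      by (rule bounded_linear.has_vector_derivative[OF bounded_linear_snd x(2)])
    then show "((\<lambda>t. snd (x t)) has_real_derivative F t (fst (x t))) (at t)"
      by (simp add: X_def has_real_derivative_iff_has_vector_derivative)
  qed
  then show ?thesis using x(1) by (intro exI[of _ "\<lambda>t. fst (x t)"] exI[of _ "\<lambda>t. snd (x t)"]) auto
qed

section \<open>Kepler equation, force and variational equation\<close>

lemma abs_sin_diff_le: "\<bar>sin a - sin b\<bar> \<le> \<bar>a - b\<bar>" for a b :: real
proof -
  have "\<bar>sin a - sin b\<bar> = 2 * \<bar>sin ((a - b) / 2)\<bar> * \<bar>cos ((a + b) / 2)\<bar>"
    by (simp add: sin_diff_sin abs_mult)
  also have "\<dots> \<le> 2 * \<bar>(a - b) / 2\<bar> * 1"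
    by (intro mult_mono abs_sin_x_le_abs_x) auto
  finally show ?thesis by simp
qed

text \<open>The reverse Lipschitz bound has two uses: injectivity of Kepler's equation for e < 1,
  and continuity of its inverse \<open>kepler_u\<close> with constant 1/(1 - e).\<close>

lemma kepler_lipschitz:
  fixes e u w :: real
  assumes "0 \<le> e"
  shows "(1 - e) * \<bar>u - w\<bar> \<le> \<bar>(u - e * sin u) - (w - e * sin w)\<bar>"
proof -
  have "\<bar>e * sin u - e * sin w\<bar> \<le> e * \<bar>u - w\<bar>"
    using mult_left_mono[OF abs_sin_diff_le[of u w] assms] assms
    by (simp add: abs_mult right_diff_distrib[symmetric])
  then show ?thesis by (simp add: algebra_simps)
qed

lemma kepler_ex1:
  fixes e t :: real
  assumes "0 \<le> e" "e < 1"
  shows "\<exists>!u. u - e * sin u = t"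
proof (rule ex_ex1I)
  have b: "\<bar>e * sin x\<bar> \<le> 1" for x
    using mult_mono[of "\<bar>e\<bar>" 1 "\<bar>sin x\<bar>" 1] assms by (simp add: abs_mult)
  have "\<exists>u\<ge>t - 1. u \<le> t + 1 \<and> u - e * sin u = t"
  proof (rule IVT')
    show "t - 1 - e * sin (t - 1) \<le> t" "t \<le> t + 1 - e * sin (t + 1)"
      using b[of "t - 1"] b[of "t + 1"] by auto
  qed (auto intro!: continuous_intros)
  then show "\<exists>u. u - e * sin u = t" by blast
  fix u w assume "u - e * sin u = t" "w - e * sin w = t"
  then have "(1 - e) * \<bar>u - w\<bar> \<le> 0" using kepler_lipschitz[OF \<open>0 \<le> e\<close>, of u w] by simp
  then show "u = w" using assms by (simp add: mult_le_0_iff)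
qed

lemma kepler_u_eq:
  assumes "0 \<le> e" "e < 1" "u - e * sin u = t"
  shows "kepler_u t e = u"
  unfolding kepler_u_def by (rule the1_equality[OF kepler_ex1[OF assms(1,2)] assms(3)])

lemma kepler_u:
  assumes "0 \<le> e" "e < 1"
  shows "kepler_u t e - e * sin (kepler_u t e) = t"
  unfolding kepler_u_def by (rule theI'[OF kepler_ex1[OF assms, of t]])

lemma continuous_on_kepler_u:
  assumes "0 \<le> e" "e < 1"
  shows "continuous_on A (\<lambda>t. kepler_u t e)"
proof (rule lipschitz_on_continuous_on)
  show "(1 / (1 - e))-lipschitz_on A (\<lambda>t. kepler_u t e)"
  proof (rule lipschitz_onI)
    fix s t
    show "dist (kepler_u s e) (kepler_u t e) \<le> 1 / (1 - e) * dist s t"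
      using kepler_lipschitz[OF assms(1), of "kepler_u s e" "kepler_u t e"] assms
      unfolding kepler_u[OF assms] dist_real_def by (simp add: field_simps)
  qed (use assms in auto)
qed

lemma r_continuous:
  assumes "0 \<le> e" "e < 1"
  shows "continuous_on A (\<lambda>t. r t e)"
  unfolding r_def by (intro continuous_intros continuous_on_kepler_u assms)

lemma r_minus:
  assumes "0 \<le> e" "e < 1"
  shows "r (- t) e = r t e"
proof -
  have "kepler_u (- t) e = - kepler_u t e"
    using kepler_u[OF assms, of t] by (intro kepler_u_eq assms) auto
  then show ?thesis by (simp add: r_def)
qed

lemma r_periodic:
  assumes "0 \<le> e" "e < 1"
  shows "r (t + 2 * real n * pi) e = r t e"
proof -
  have S: "sin (x + 2 * real n * pi) = sin x" and C: "cos (x + 2 * real n * pi) = cos x" for x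
    using sin_int_2pin[of "int n"] cos_int_2pin[of "int n"]
    by (simp_all add: sin_add cos_add mult.commute mult.left_commute)
  have "kepler_u (t + 2 * real n * pi) e = kepler_u t e + 2 * real n * pi"
    using kepler_u[OF assms, of t] by (intro kepler_u_eq assms) (simp add: S)
  then show ?thesis by (simp add: r_def C)
qed

lemma r_deviation:
  assumes "0 \<le> e"
  shows "\<bar>r t e - 1/2\<bar> \<le> e / 2"
proof -
  have "\<bar>e * cos (kepler_u t e)\<bar> \<le> e * 1"
    unfolding abs_mult using assms by (intro mult_mono) auto
  then show ?thesis by (simp add: r_def abs_le_iff diff_divide_distrib) linarith?
qed

lemma r_lower:
  assumes "0 \<le> e"
  shows "(1 - e) / 2 \<le> r t e"
  using abs_le_D2[OF r_deviation[OF assms, of t]] by (simp add: diff_divide_distrib)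

lemma r_0 [simp]: "r t 0 = 1/2" by (simp add: r_def)

section \<open>The force as a function of position and radius, with its partial derivatives\<close>

definition sit_force :: "real \<Rightarrow> real \<Rightarrow> real" where
  "sit_force z \<rho> = - z / ((z\<^sup>2 + \<rho>\<^sup>2) powr (3/2))"

definition sit_dz :: "real \<Rightarrow> real \<Rightarrow> real" where
  "sit_dz z \<rho> = - (\<rho>\<^sup>2 - 2 * z\<^sup>2) / ((z\<^sup>2 + \<rho>\<^sup>2) powr (5/2))"

definition sit_dr :: "real \<Rightarrow> real \<Rightarrow> real" where
  "sit_dr z \<rho> = 3 * z * \<rho> / ((z\<^sup>2 + \<rho>\<^sup>2) powr (5/2))"

lemma powr_3_2: "0 \<le> (x::real) \<Longrightarrow> x powr (3/2) = x * sqrt x"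
  using powr_add[of x 1 "1/2"] by (cases "x = 0") (auto simp: powr_half_sqrt)

lemma powr_5_2: "0 \<le> (x::real) \<Longrightarrow> x powr (5/2) = x\<^sup>2 * sqrt x"
  using powr_add[of x 2 "1/2"] by (cases "x = 0") (auto simp: powr_half_sqrt powr_numeral)

lemma sit_force_dz:
  assumes "0 < \<rho>"
  shows "((\<lambda>z. sit_force z \<rho>) has_real_derivative sit_dz z \<rho>) (at z within A)"
proof -
  define q S where "q = z\<^sup>2 + \<rho>\<^sup>2" and "S = sqrt q"
  have q: "0 < q" unfolding q_def using assms by (simp add: add_nonneg_pos)
  then have S: "0 < S" by (simp add: S_def)
  have e: "(z\<^sup>2 + \<rho>\<^sup>2) powr (3/2) = q * S" "(z\<^sup>2 + \<rho>\<^sup>2) powr (1/2) = S"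
    "(z\<^sup>2 + \<rho>\<^sup>2) powr (5/2) = q\<^sup>2 * S"
    unfolding S_def q_def[symmetric] using powr_3_2[of q] powr_5_2[of q] q by (auto simp: powr_half_sqrt)
  have "((\<lambda>z. (z\<^sup>2 + \<rho>\<^sup>2) powr (3/2)) has_real_derivative 3/2 * S * (2 * z)) (at z within A)"
    using q e(2) unfolding q_def by (auto intro!: derivative_eq_intros)
  note den = this
  have num: "((\<lambda>z. - z) has_real_derivative -1) (at z within A)"
    by (auto intro!: derivative_eq_intros)
  have "(z\<^sup>2 + \<rho>\<^sup>2) powr (3/2) \<noteq> 0" using e(1) q S by simp
  from DERIV_divide[OF num den this]
  have "((\<lambda>z. sit_force z \<rho>) has_real_derivative (- 1 * (q * S) - (- z) * (3/2 * S * (2 * z))) / ((q * S) * (q * S))) (at z within A)"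
    unfolding sit_force_def e(1) .
  moreover have "(- 1 * (q * S) - (- z) * (3/2 * S * (2 * z))) / ((q * S) * (q * S)) = - (q - 3 * z\<^sup>2) / (q\<^sup>2 * S)"
    using q S by (simp add: field_simps power2_eq_square)
  moreover have "- (q - 3 * z\<^sup>2) / (q\<^sup>2 * S) = sit_dz z \<rho>"
    unfolding sit_dz_def e by (simp add: q_def)
  ultimately show ?thesis by simp
qed

lemma sit_force_dr:
  assumes "0 < \<rho>"
  shows "((\<lambda>\<rho>. sit_force z \<rho>) has_real_derivative sit_dr z \<rho>) (at \<rho> within A)"
proof -
  define q S where "q = z\<^sup>2 + \<rho>\<^sup>2" and "S = sqrt q"
  have q: "0 < q" unfolding q_def using assms by (simp add: add_nonneg_pos)
  then have S: "0 < S" by (simp add: S_def)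
  have e: "(z\<^sup>2 + \<rho>\<^sup>2) powr (3/2) = q * S" "(z\<^sup>2 + \<rho>\<^sup>2) powr (1/2) = S"
    "(z\<^sup>2 + \<rho>\<^sup>2) powr (5/2) = q\<^sup>2 * S"
    unfolding S_def q_def[symmetric] using powr_3_2[of q] powr_5_2[of q] q by (auto simp: powr_half_sqrt)
  have "((\<lambda>\<rho>. (z\<^sup>2 + \<rho>\<^sup>2) powr (3/2)) has_real_derivative 3/2 * S * (2 * \<rho>)) (at \<rho> within A)"
    using q e(2) unfolding q_def by (auto intro!: derivative_eq_intros)
  note den = this
  have num: "((\<lambda>\<rho>. - z) has_real_derivative 0) (at \<rho> within A)"
    by (auto intro!: derivative_eq_intros)
  have "(z\<^sup>2 + \<rho>\<^sup>2) powr (3/2) \<noteq> 0" using e(1) q S by simp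
  from DERIV_divide[OF num den this]
  have "((\<lambda>\<rho>. sit_force z \<rho>) has_real_derivative (0 * (q * S) - (- z) * (3/2 * S * (2 * \<rho>))) / ((q * S) * (q * S))) (at \<rho> within A)"
    unfolding sit_force_def e(1) .
  moreover have "(0 * (q * S) - (- z) * (3/2 * S * (2 * \<rho>))) / ((q * S) * (q * S)) = 3 * z * \<rho> / (q\<^sup>2 * S)"
    using q S by (simp add: field_simps power2_eq_square)
  moreover have "3 * z * \<rho> / (q\<^sup>2 * S) = sit_dr z \<rho>"
    unfolding sit_dr_def e by (simp add: q_def)
  ultimately show ?thesis by simp
qed

text \<open>The numerator is at most twice q = z^2 + \<rho>^2, which leaves 2 q^(-3/2), and q \<ge>
  c^2. For c = 1/2 this is the constant 16 of the circular problem.\<close>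

lemma sit_dz_bound:
  assumes "0 < c" "c \<le> \<rho>"
  shows "\<bar>sit_dz z \<rho>\<bar> \<le> 2 / c ^ 3"
proof -
  define q where "q = z\<^sup>2 + \<rho>\<^sup>2"
  have q: "c\<^sup>2 \<le> q" unfolding q_def using assms by (simp add: add_increasing power_mono)
  have "0 < c\<^sup>2" using assms by simp
  then have pos: "0 < q" using q by linarith
  have sq: "c \<le> sqrt q" using q assms by (intro real_le_rsqrt)
  have "\<bar>\<rho>\<^sup>2 - 2 * z\<^sup>2\<bar> \<le> 2 * q" unfolding q_def by (simp add: abs_le_iff)
  then have "\<bar>sit_dz z \<rho>\<bar> \<le> 2 * q / (q\<^sup>2 * sqrt q)"
    unfolding sit_dz_def q_def[symmetric] powr_5_2[OF less_imp_le[OF pos]]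
    using pos by (simp add: abs_mult divide_right_mono)
  also have "\<dots> = 2 / (q * sqrt q)" using pos by (simp add: power2_eq_square)
  also have "\<dots> \<le> 2 / (c\<^sup>2 * c)"
    using q sq assms pos by (intro divide_left_mono mult_mono mult_pos_pos) auto
  finally show ?thesis by (simp add: power3_eq_cube power2_eq_square)
qed

lemma sit_force_lipschitz:
  assumes "0 < c" "c \<le> \<rho>"
  shows "\<bar>sit_force y \<rho> - sit_force z \<rho>\<bar> \<le> 2 / c ^ 3 * \<bar>y - z\<bar>"
proof -
  have "norm (sit_force y \<rho> - sit_force z \<rho>) \<le> 2 / c ^ 3 * norm (y - z)"
    by (rule field_differentiable_bound[where S=UNIV and f'="\<lambda>z. sit_dz z \<rho>"])
      (use assms in \<open>auto intro!: sit_force_dz sit_dz_bound\<close>)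
  then show ?thesis by simp
qed

text \<open>Here |z \<rho>| \<le> q leaves 3 q^(-3/2). With c = (1 - e)/2 and |r - 1/2| \<le> e/2
  the product 3 (2/(1 - e))^3 e/2 is the 12 e/(1 - e)^3 by which the force changes.\<close>

lemma sit_dr_bound:
  assumes "0 < c" "c \<le> \<rho>"
  shows "\<bar>sit_dr z \<rho>\<bar> \<le> 3 / c ^ 3"
proof -
  define q where "q = z\<^sup>2 + \<rho>\<^sup>2"
  have q: "c\<^sup>2 \<le> q" unfolding q_def using assms by (simp add: add_increasing power_mono)
  have "0 < c\<^sup>2" using assms by simp
  then have pos: "0 < q" using q by linarith
  have sq: "c \<le> sqrt q" using q assms by (intro real_le_rsqrt)
  have "2 * \<bar>z * \<rho>\<bar> \<le> q" unfolding q_def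
    using sum_squares_bound[of "\<bar>z\<bar>" "\<bar>\<rho>\<bar>"] by (simp add: abs_mult)
  then have "\<bar>z * \<rho>\<bar> \<le> q" by linarith
  then have "\<bar>sit_dr z \<rho>\<bar> \<le> 3 * q / (q\<^sup>2 * sqrt q)"
    unfolding sit_dr_def q_def[symmetric] powr_5_2[OF less_imp_le[OF pos]]
    using pos by (simp add: abs_mult divide_right_mono)
  also have "\<dots> = 3 / (q * sqrt q)" using pos by (simp add: power2_eq_square)
  also have "\<dots> \<le> 3 / (c\<^sup>2 * c)"
    using q sq assms pos by (intro divide_left_mono mult_mono mult_pos_pos) auto
  finally show ?thesis by (simp add: power3_eq_cube power2_eq_square)
qed

lemma sit_force_lipschitz_r:
  assumes "0 < c" "c \<le> \<rho>" "c \<le> \<rho>'"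
  shows "\<bar>sit_force z \<rho> - sit_force z \<rho>'\<bar> \<le> 3 / c ^ 3 * \<bar>\<rho> - \<rho>'\<bar>"
proof -
  have "norm (sit_force z \<rho> - sit_force z \<rho>') \<le> 3 / c ^ 3 * norm (\<rho> - \<rho>')"
    by (rule field_differentiable_bound[where S="{c..}" and f'="\<lambda>\<rho>. sit_dr z \<rho>"])
      (use assms in \<open>auto intro!: sit_force_dr sit_dr_bound\<close>)
  then show ?thesis by simp
qed

section \<open>Well-posedness of the Sitnikov equation\<close>

lemma sitnikov_solution_iff:
  "sitnikov_solution e z \<longleftrightarrow> (\<exists>v. ode2 (\<lambda>t y. sit_force y (r t e)) z v)"
proof
  assume "sitnikov_solution e z"
  then show "\<exists>v. ode2 (\<lambda>t y. sit_force y (r t e)) z v"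
    unfolding sitnikov_solution_def ode2_def sit_force_def by blast
next
  assume "\<exists>v. ode2 (\<lambda>t y. sit_force y (r t e)) z v"
  then obtain v where v: "ode2 (\<lambda>t y. sit_force y (r t e)) z v" by blast
  then have "deriv z = v" unfolding ode2_def by (auto intro: DERIV_imp_deriv)
  then show "sitnikov_solution e z"
    using v unfolding sitnikov_solution_def ode2_def sit_force_def by simp
qed

lemma ode2_deriv: "ode2 F y v \<Longrightarrow> deriv y = v"
  unfolding ode2_def by (auto intro: DERIV_imp_deriv)

text \<open>The constant equals 16/(1 - e)^3, so at e = \<open>E_star N xs\<close> it is
  \<open>sigma_star N xs\<close>. It does not depend on t or on the position, which gives existence
  and uniqueness on the whole line.\<close>

lemma sit_ode_lipschitz:
  assumes "0 \<le> e" "e < 1"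
  shows "\<bar>sit_force y (r t e) - sit_force z (r t e)\<bar> \<le> 2 / ((1 - e) / 2) ^ 3 * \<bar>y - z\<bar>"
  by (rule sit_force_lipschitz) (use assms r_lower in auto)

lemma r_pos:
  assumes "0 \<le> e" "e < 1"
  shows "0 < r t e"
  using r_lower[OF assms(1), of t] assms by (auto simp: field_simps)

lemma sit_ode_continuous:
  assumes "0 \<le> e" "e < 1"
  shows "continuous_on UNIV (\<lambda>(t, y). sit_force y (r t e))"
proof -
  have "0 < z\<^sup>2 + (r t e)\<^sup>2" for z t using r_pos[OF assms, of t] by (simp add: add_nonneg_pos)
  then have "z\<^sup>2 + (r t e)\<^sup>2 \<noteq> 0" for z t by (metis less_irrefl)
  moreover have "continuous_on UNIV (\<lambda>x::real \<times> real. r (fst x) e)"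
    by (rule continuous_on_compose2[OF r_continuous[OF assms, of UNIV]]) (auto intro!: continuous_intros)
  ultimately show ?thesis
    unfolding sit_force_def case_prod_beta
    by (auto intro!: continuous_intros)
qed

lemma sit_ode_unique:
  assumes "0 \<le> e" "e < 1"
    and "ode2 (\<lambda>t y. sit_force y (r t e)) y1 v1" "ode2 (\<lambda>t y. sit_force y (r t e)) y2 v2"
    and "y1 t0 = y2 t0" "v1 t0 = v2 t0"
  shows "y1 = y2 \<and> v1 = v2"
  by (rule ode2_unique[OF sit_ode_lipschitz[OF assms(1,2)] assms(3-6)])

text \<open>Global existence and uniqueness make the definite description denote; from here on
  \<open>sitnikov_z\<close> is handled through these three facts.\<close>

lemma sitnikov_z_props:
  assumes "0 \<le> e" "e < 1"
  shows "ode2 (\<lambda>t y. sit_force y (r t e)) (sitnikov_z \<xi> e) (deriv (sitnikov_z \<xi> e))"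
    and "sitnikov_z \<xi> e 0 = \<xi>" and "deriv (sitnikov_z \<xi> e) 0 = 0"
proof -
  obtain y v where y: "ode2 (\<lambda>t y. sit_force y (r t e)) y v" "y 0 = \<xi>" "v 0 = 0"
    using ode2_exists[OF sit_ode_continuous[OF assms] sit_ode_lipschitz[OF assms]] by blast
  have "sitnikov_z \<xi> e = y" unfolding sitnikov_z_def
  proof (rule the_equality)
    show "sitnikov_solution e y \<and> y 0 = \<xi> \<and> deriv y 0 = 0"
      using y ode2_deriv by (auto simp: sitnikov_solution_iff)
    fix z assume z: "sitnikov_solution e z \<and> z 0 = \<xi> \<and> deriv z 0 = 0"
    then obtain w where "ode2 (\<lambda>t y. sit_force y (r t e)) z w" by (auto simp: sitnikov_solution_iff)
    then show "z = y" using sit_ode_unique[OF assms _ y(1), of z w 0] y(2,3) z ode2_deriv by force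
  qed
  then show "ode2 (\<lambda>t y. sit_force y (r t e)) (sitnikov_z \<xi> e) (deriv (sitnikov_z \<xi> e))"
    "sitnikov_z \<xi> e 0 = \<xi>" "deriv (sitnikov_z \<xi> e) 0 = 0"
    using y ode2_deriv[OF y(1)] by auto
qed

section \<open>The variational equation along circular orbits\<close>

lemma a_coeff_eq: "a_coeff \<xi> e t = - sit_dz (sitnikov_z \<xi> e t) (r t e)"
  by (simp add: a_coeff_def sit_dz_def minus_divide_left)

lemma ode2_continuous:
  assumes "ode2 F y v" 
  shows "continuous_on A y" "continuous_on A v"
proof -
  have D: "(y has_real_derivative v t) (at t within A)"
    "(v has_real_derivative F t (y t)) (at t within A)" for t
    using assms unfolding ode2_def by (auto intro: has_field_derivative_at_within)
  show "continuous_on A y" by (rule DERIV_continuous_on[OF D(1)])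
  show "continuous_on A v" by (rule DERIV_continuous_on[OF D(2)])
qed

lemma a_coeff_0_bound: "\<bar>a_coeff \<xi> 0 t\<bar> \<le> 16"
proof -
  have "\<bar>sit_dz (sitnikov_z \<xi> 0 t) (1/2)\<bar> \<le> 2 / (1/2) ^ 3" by (rule sit_dz_bound) auto
  then show ?thesis unfolding a_coeff_eq by (simp add: power_divide)
qed

lemma a_coeff_0_continuous: "continuous_on A (a_coeff \<xi> 0)"
proof -
  have c: "continuous_on A (sitnikov_z \<xi> 0)"
    by (rule ode2_continuous[OF sitnikov_z_props(1)]) auto
  have "0 < (sitnikov_z \<xi> 0 t)\<^sup>2 + (1/2)\<^sup>2" for t by (simp add: add_nonneg_pos)
  then have "(sitnikov_z \<xi> 0 t)\<^sup>2 + (1/2)\<^sup>2 \<noteq> 0" for t by (metis less_irrefl)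
  then show ?thesis unfolding a_coeff_def by (auto intro!: continuous_intros c)
qed

lemma var_ode_lipschitz: "\<bar>- a_coeff \<xi> 0 t * y - - a_coeff \<xi> 0 t * z\<bar> \<le> 16 * \<bar>y - z\<bar>"
proof -
  have "\<bar>- a_coeff \<xi> 0 t * y - - a_coeff \<xi> 0 t * z\<bar> = \<bar>a_coeff \<xi> 0 t\<bar> * \<bar>y - z\<bar>"
    unfolding abs_mult[symmetric] by (simp add: right_diff_distrib abs_minus_commute)
  also have "\<dots> \<le> 16 * \<bar>y - z\<bar>" by (intro mult_right_mono a_coeff_0_bound) auto
  finally show ?thesis .
qed

lemma var_ode_exists: "\<exists>y v. ode2 (\<lambda>t y. - a_coeff \<xi> 0 t * y) y v \<and> y 0 = y0 \<and> v 0 = v0"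
proof (rule ode2_exists[OF _ var_ode_lipschitz])
  have "continuous_on UNIV (\<lambda>x::real \<times> real. a_coeff \<xi> 0 (fst x))"
    by (rule continuous_on_compose2[OF a_coeff_0_continuous[of UNIV]]) (auto intro!: continuous_intros)
  then show "continuous_on UNIV (\<lambda>(t, y). - a_coeff \<xi> 0 t * y)"
    unfolding case_prod_beta by (intro continuous_intros)
qed

lemma var_ode_unique:
  assumes "ode2 (\<lambda>t y. - a_coeff \<xi> 0 t * y) y1 v1" "ode2 (\<lambda>t y. - a_coeff \<xi> 0 t * y) y2 v2"
    and "y1 t0 = y2 t0" "v1 t0 = v2 t0"
  shows "y1 = y2 \<and> v1 = v2"
  by (rule ode2_unique[OF var_ode_lipschitz assms])

lemma variational_solution_iff:
  "variational_solution \<xi> e y \<longleftrightarrow> (\<exists>v. ode2 (\<lambda>t y. - a_coeff \<xi> e t * y) y v)"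
proof
  assume "variational_solution \<xi> e y"
  then show "\<exists>v. ode2 (\<lambda>t y. - a_coeff \<xi> e t * y) y v"
    unfolding variational_solution_def ode2_def by blast
next
  assume "\<exists>v. ode2 (\<lambda>t y. - a_coeff \<xi> e t * y) y v"
  then obtain v where v: "ode2 (\<lambda>t y. - a_coeff \<xi> e t * y) y v" by blast
  then show "variational_solution \<xi> e y"
    using ode2_deriv[OF v] unfolding variational_solution_def ode2_def by simp
qed

lemma var_the:
  fixes \<xi> a b :: real
  shows "variational_solution \<xi> 0 (THE y. variational_solution \<xi> 0 y \<and> y 0 = a \<and> deriv y 0 = b) \<and>
    (THE y. variational_solution \<xi> 0 y \<and> y 0 = a \<and> deriv y 0 = b) 0 = a \<and>
    deriv (THE y. variational_solution \<xi> 0 y \<and> y 0 = a \<and> deriv y 0 = b) 0 = b"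
proof (rule theI'[where P="\<lambda>y. variational_solution \<xi> 0 y \<and> y 0 = a \<and> deriv y 0 = b"])
  obtain y v where y: "ode2 (\<lambda>t y. - a_coeff \<xi> 0 t * y) y v" "y 0 = a" "v 0 = b"
    using var_ode_exists by blast
  show "\<exists>!y. variational_solution \<xi> 0 y \<and> y 0 = a \<and> deriv y 0 = b"
  proof (rule ex1I)
    show "variational_solution \<xi> 0 y \<and> y 0 = a \<and> deriv y 0 = b"
      using y ode2_deriv[OF y(1)] by (auto simp: variational_solution_iff)
    fix z assume z: "variational_solution \<xi> 0 z \<and> z 0 = a \<and> deriv z 0 = b"
    then obtain w where w: "ode2 (\<lambda>t y. - a_coeff \<xi> 0 t * y) z w" by (auto simp: variational_solution_iff)
    show "z = y" using var_ode_unique[OF w y(1), of 0] y(2,3) z ode2_deriv[OF w] by auto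
  qed
qed

lemma phi1_props:
  "ode2 (\<lambda>t y. - a_coeff \<xi> 0 t * y) (phi1 \<xi> 0) (deriv (phi1 \<xi> 0))"
  "phi1 \<xi> 0 0 = 1" "deriv (phi1 \<xi> 0) 0 = 0"
proof -
  have P: "variational_solution \<xi> 0 (phi1 \<xi> 0) \<and> phi1 \<xi> 0 0 = 1 \<and> deriv (phi1 \<xi> 0) 0 = 0"
    using var_the[of \<xi> 1 0] unfolding phi1_def by simp
  then show "phi1 \<xi> 0 0 = 1" "deriv (phi1 \<xi> 0) 0 = 0" by auto
  show "ode2 (\<lambda>t y. - a_coeff \<xi> 0 t * y) (phi1 \<xi> 0) (deriv (phi1 \<xi> 0))"
    using P ode2_deriv by (metis variational_solution_iff)
qed

lemma phi2_props:
  "ode2 (\<lambda>t y. - a_coeff \<xi> 0 t * y) (phi2 \<xi> 0) (deriv (phi2 \<xi> 0))"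
  "phi2 \<xi> 0 0 = 0" "deriv (phi2 \<xi> 0) 0 = 1"
proof -
  have P: "variational_solution \<xi> 0 (phi2 \<xi> 0) \<and> phi2 \<xi> 0 0 = 0 \<and> deriv (phi2 \<xi> 0) 0 = 1"
    using var_the[of \<xi> 0 1] unfolding phi2_def by simp
  then show "phi2 \<xi> 0 0 = 0" "deriv (phi2 \<xi> 0) 0 = 1" by auto
  show "ode2 (\<lambda>t y. - a_coeff \<xi> 0 t * y) (phi2 \<xi> 0) (deriv (phi2 \<xi> 0))"
    using P ode2_deriv by (metis variational_solution_iff)
qed

text \<open>Gronwall with rate 17 = 1 + 16. The bound is uniform in the amplitude, which is what
  gives \<open>sup_norm\<close> and \<open>r0\<close> their meaning: a real supremum is an upper
  bound only for a set that is bounded above.\<close>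

lemma phi_bounds:
  assumes "y \<in> {phi1 \<xi> 0, phi2 \<xi> 0}" "0 \<le> t" "t \<le> T"
  shows "(y t)\<^sup>2 + (deriv y t)\<^sup>2 \<le> exp (17 * T)"
proof -
  have o: "ode2 (\<lambda>t y. - a_coeff \<xi> 0 t * y) y (deriv y)" and i: "(y 0)\<^sup>2 + (deriv y 0)\<^sup>2 = 1"
    using assms phi1_props phi2_props by auto
  have "(y t)\<^sup>2 + (deriv y t)\<^sup>2 \<le> ((y 0)\<^sup>2 + (deriv y 0)\<^sup>2) * exp ((1 + 16) * t)"
  proof (rule gronwall2[OF \<open>0 \<le> t\<close>])
    fix s
    show "(y has_real_derivative deriv y s) (at s within {0..t})"
      "(deriv y has_real_derivative - a_coeff \<xi> 0 s * y s) (at s within {0..t})"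
      using o unfolding ode2_def by (auto intro: has_field_derivative_at_within)
    show "\<bar>- a_coeff \<xi> 0 s * y s\<bar> \<le> 16 * \<bar>y s\<bar>"
      using var_ode_lipschitz[of \<xi> s "y s" 0] by simp
  qed auto
  also have "\<dots> \<le> exp (17 * T)" using assms i by simp
  finally show ?thesis .
qed

lemma sup_norm_phi_le:
  assumes "f \<in> {phi1 \<xi> 0, deriv (phi1 \<xi> 0), phi2 \<xi> 0, deriv (phi2 \<xi> 0)}"
  shows "t \<in> {0..real N * pi} \<Longrightarrow> \<bar>f t\<bar> \<le> sup_norm N f"
    and "sup_norm N f \<le> sqrt (exp (17 * (real N * pi)))"
proof -
  have b: "\<bar>f t\<bar> \<le> sqrt (exp (17 * (real N * pi)))" if "t \<in> {0..real N * pi}" for t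
  proof (rule real_le_rsqrt)
    from assms obtain y where y: "y \<in> {phi1 \<xi> 0, phi2 \<xi> 0}" "f = y \<or> f = deriv y" by auto
    have "(f t)\<^sup>2 \<le> (y t)\<^sup>2 + (deriv y t)\<^sup>2" using y(2) by auto
    also have "\<dots> \<le> exp (17 * (real N * pi))"
      by (rule phi_bounds[OF y(1)]) (use that in auto)
    finally show "\<bar>f t\<bar>\<^sup>2 \<le> exp (17 * (real N * pi))" by simp
  qed
  show "\<bar>f t\<bar> \<le> sup_norm N f" if "t \<in> {0..real N * pi}"
    unfolding sup_norm_def using that by (intro cSUP_upper bdd_aboveI2[OF b]) auto
  show "sup_norm N f \<le> sqrt (exp (17 * (real N * pi)))"
    unfolding sup_norm_def using b by (intro cSUP_least) auto
qed

lemma phi_le_r0: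
  assumes "f \<in> {phi1 \<xi> 0, deriv (phi1 \<xi> 0), phi2 \<xi> 0, deriv (phi2 \<xi> 0)}"
    and "t \<in> {0..real N * pi}" "\<xi> \<in> {0..xs}"
  shows "\<bar>f t\<bar> \<le> r0 N xs"
proof -
  have "\<bar>f t\<bar> \<le> sup_norm N f" by (rule sup_norm_phi_le(1)[OF assms(1,2)])
  also have "\<dots> \<le> R0 N \<xi>" unfolding R0_def using assms(1) by (intro Max_ge) auto
  also have "\<dots> \<le> r0 N xs" unfolding r0_def
  proof (rule cSUP_upper[OF assms(3)])
    have "R0 N \<xi> \<le> sqrt (exp (17 * (real N * pi)))" for \<xi>
      unfolding R0_def by (subst Max_le_iff) (auto intro!: sup_norm_phi_le(2))
    then show "bdd_above (R0 N ` {0..xs})" by (rule bdd_aboveI2)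
  qed
  finally show ?thesis .
qed

lemma r0_ge_1:
  assumes "0 < xs"
  shows "1 \<le> r0 N xs"
  using phi_le_r0[of "phi1 0 0" 0 0 N xs] assms by (simp add: phi1_props)

section \<open>The circular problem\<close>

lemma ode2_reflect:
  assumes "ode2 F y v" "\<And>t y. F (c - t) y = F t y"
  shows "ode2 F (\<lambda>t. y (c - t)) (\<lambda>t. - v (c - t))"
  unfolding ode2_def
proof (intro allI conjI)
  fix t
  have "((\<lambda>s. y (c - s)) has_real_derivative v (c - t) * (-1)) (at t)"
    by (rule DERIV_chain'[where g=y]) (use assms(1) in \<open>auto simp: ode2_def intro!: derivative_eq_intros\<close>)
  then show "((\<lambda>s. y (c - s)) has_real_derivative - v (c - t)) (at t)" by simp
  have "((\<lambda>s. v (c - s)) has_real_derivative F (c - t) (y (c - t)) * (-1)) (at t)"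
    by (rule DERIV_chain'[where g=v]) (use assms(1) in \<open>auto simp: ode2_def intro!: derivative_eq_intros\<close>)
  from DERIV_minus[OF this] show "((\<lambda>s. - v (c - s)) has_real_derivative F t (y (c - t))) (at t)"
    by (simp add: assms(2))
qed

lemma ode2_shift:
  assumes "ode2 F y v" "\<And>t y. F (t + c) y = F t y"
  shows "ode2 F (\<lambda>t. y (t + c)) (\<lambda>t. v (t + c))"
  unfolding ode2_def
proof (intro allI conjI)
  fix t
  have "((\<lambda>s. y (s + c)) has_real_derivative v (t + c) * 1) (at t)"
    by (rule DERIV_chain'[where g=y]) (use assms(1) in \<open>auto simp: ode2_def intro!: derivative_eq_intros\<close>)
  then show "((\<lambda>s. y (s + c)) has_real_derivative v (t + c)) (at t)" by simp
  have "((\<lambda>s. v (s + c)) has_real_derivative F (t + c) (y (t + c)) * 1) (at t)"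
    by (rule DERIV_chain'[where g=v]) (use assms(1) in \<open>auto simp: ode2_def intro!: derivative_eq_intros\<close>)
  then show "((\<lambda>s. v (s + c)) has_real_derivative F t (y (t + c))) (at t)"
    by (simp add: assms(2))
qed

lemma ode2_uminus:
  assumes "ode2 F y v" "\<And>t y. F t (- y) = - F t y"
  shows "ode2 F (\<lambda>t. - y t) (\<lambda>t. - v t)"
  using assms unfolding ode2_def by (auto intro!: DERIV_minus)

lemma ode2_linear_comb:
  assumes "ode2 (\<lambda>t y. - a t * y) y1 v1" "ode2 (\<lambda>t y. - a t * y) y2 v2"
  shows "ode2 (\<lambda>t y. - a t * y) (\<lambda>t. c1 * y1 t + c2 * y2 t) (\<lambda>t. c1 * v1 t + c2 * v2 t)"
  unfolding ode2_def
proof (intro allI conjI)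
  fix t
  note [derivative_intros] = assms[unfolded ode2_def, rule_format, THEN conjunct1]
    assms[unfolded ode2_def, rule_format, THEN conjunct2]
  show "((\<lambda>t. c1 * y1 t + c2 * y2 t) has_real_derivative c1 * v1 t + c2 * v2 t) (at t)"
    by (auto intro!: derivative_eq_intros)
  show "((\<lambda>t. c1 * v1 t + c2 * v2 t) has_real_derivative - a t * (c1 * y1 t + c2 * y2 t)) (at t)"
    by (auto intro!: derivative_eq_intros simp: algebra_simps)
qed

lemma sit_force_uminus: "sit_force (- y) \<rho> = - sit_force y \<rho>"
  by (simp add: sit_force_def)

text \<open>As r is even and 2\<pi>-periodic, reflections of time about 0 and about N\<pi> preserve
  the equation. Zero velocity on an axis makes the solution invariant under that reflection, and the
  two reflections compose to the shift by 2N\<pi>.\<close>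

lemma sit_even_periodic:
  assumes e: "0 \<le> e" "e < 1"
    and z: "ode2 (\<lambda>t y. sit_force y (r t e)) z v" and "v 0 = 0" "v (real N * pi) = 0"
  shows "even_periodic N z"
proof -
  define L where "L = real N * pi"
  have "ode2 (\<lambda>t y. sit_force y (r t e)) (\<lambda>t. z (0 - t)) (\<lambda>t. - v (0 - t))"
    by (rule ode2_reflect[OF z]) (simp add: r_minus[OF e])
  from sit_ode_unique[OF e this z, of 0] have even: "(\<lambda>t. z (0 - t)) = z"
    using \<open>v 0 = 0\<close> by simp
  have "ode2 (\<lambda>t y. sit_force y (r t e)) (\<lambda>t. z (2 * L - t)) (\<lambda>t. - v (2 * L - t))"
  proof (rule ode2_reflect[OF z])
    fix t y
    have "r (2 * L - t) e = r (- t) e" using r_periodic[OF e, of "- t" N] by (simp add: L_def algebra_simps)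
    then show "sit_force y (r (2 * L - t) e) = sit_force y (r t e)" by (simp add: r_minus[OF e])
  qed
  from sit_ode_unique[OF e this z, of L] have refl: "(\<lambda>t. z (2 * L - t)) = z"
    using \<open>v (real N * pi) = 0\<close> by (simp add: L_def[symmetric])
  have "z (t + 2 * real N * pi) = z t" for t
    using fun_cong[OF refl, of "- t"] fun_cong[OF even, of t] by (simp add: L_def algebra_simps)
  then show ?thesis unfolding even_periodic_def using fun_cong[OF even] by simp
qed

text \<open>The Wronskian y1 v2 - y2 v1 has derivative (q1 - q2) y1 y2 > 0 and starts at 0.
  Positivity is asked only in the open interval, so zeros at T are allowed. Three uses follow: an
  orbit against its variational solution, two orbits of different amplitude, and a small orbit
  against a cosine.\<close>

lemma sturm_wronskian:
  assumes "ode2 (\<lambda>t y. - q1 t * y) y1 v1" "ode2 (\<lambda>t y. - q2 t * y) y2 v2"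
    and "0 < T" "y1 0 * v2 0 = y2 0 * v1 0"
    and pos: "\<And>t. 0 < t \<Longrightarrow> t < T \<Longrightarrow> 0 < y1 t \<and> 0 < y2 t \<and> q2 t < q1 t"
  shows "y2 T * v1 T < y1 T * v2 T"
proof -
  define W where "W = (\<lambda>t. y1 t * v2 t - y2 t * v1 t)"
  have dW: "(W has_real_derivative (q1 t - q2 t) * (y1 t * y2 t)) (at t)" for t
  proof -
    note [derivative_intros] = assms(1,2)[unfolded ode2_def, rule_format, THEN conjunct1]
      assms(1,2)[unfolded ode2_def, rule_format, THEN conjunct2]
    show ?thesis unfolding W_def by (auto intro!: derivative_eq_intros simp: algebra_simps)
  qed
  have "W 0 < W T"
  proof (rule DERIV_pos_imp_increasing_open[OF \<open>0 < T\<close>])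
    fix t assume "0 < t" "t < T"
    from pos[OF this] have "0 < (q1 t - q2 t) * (y1 t * y2 t)" by simp
    then show "\<exists>y. (W has_real_derivative y) (at t) \<and> 0 < y" using dW by blast
  next
    show "continuous_on {0..T} W"
      by (rule DERIV_continuous_on[OF has_field_derivative_at_within[OF dW]])
  qed
  then show ?thesis using assms(4) by (simp add: W_def)
qed

lemma first_zero:
  fixes h :: "real \<Rightarrow> real"
  assumes "continuous_on {0..T} h" "0 \<le> T" "h T \<le> 0" "0 < h 0"
  obtains s where "0 < s" "s \<le> T" "h s = 0" "\<And>t. 0 \<le> t \<Longrightarrow> t < s \<Longrightarrow> 0 < h t"
proof -
  define S where "S = {0..T} \<inter> h -` {..0}"
  have "closed S" unfolding S_def
    by (rule continuous_closed_preimage[OF assms(1)]) auto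
  then have "compact ({0..T} \<inter> S)" by (rule compact_Int_closed[OF compact_Icc])
  then have "compact S" by (simp add: S_def Int_absorb1 inf_assoc[symmetric])
  moreover have "S \<noteq> {}" using assms by (auto simp: S_def)
  ultimately have "\<exists>s\<in>S. \<forall>t\<in>S. s \<le> t" by (rule compact_attains_inf)
  then obtain s where s: "s \<in> S" "\<And>t. t \<in> S \<Longrightarrow> s \<le> t" by auto
  have s0: "0 < s" using s(1) assms(4) by (cases "s = 0") (auto simp: S_def)
  have pos: "0 < h t" if "0 \<le> t" "t < s" for t
    using s(2)[of t] s(1) that by (force simp: S_def)
  have "\<exists>x\<ge>0. x \<le> s \<and> h x = 0"
    by (rule IVT2') (use s(1) s0 assms(4) in \<open>auto simp: S_def intro!: continuous_on_subset[OF assms(1)]\<close>)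
  then obtain x where x: "0 \<le> x" "x \<le> s" "h x = 0" by auto
  then have "h s = 0" using pos[of x] by (cases "x = s") auto
  then show ?thesis using that s0 s(1) pos by (auto simp: S_def)
qed

lemma deriv_nonpos_at_first_zero:
  fixes h :: "real \<Rightarrow> real"
  assumes "(h has_real_derivative d) (at s)" "0 < s" "h s = 0" "\<And>t. 0 \<le> t \<Longrightarrow> t < s \<Longrightarrow> 0 < h t"
  shows "d \<le> 0"
proof (rule ccontr)
  assume "\<not> d \<le> 0"
  then obtain \<epsilon> where \<epsilon>: "\<epsilon> > 0" "\<And>h'. h' > 0 \<Longrightarrow> h' < \<epsilon> \<Longrightarrow> h (s - h') < h s"
    using DERIV_pos_inc_left[OF assms(1)] by auto
  define h' where "h' = min (\<epsilon> / 2) s"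
  have "h (s - h') < 0" using \<epsilon>(2)[of h'] \<epsilon>(1) assms(2,3) by (auto simp: h'_def)
  moreover have "0 < h (s - h')" using assms(2,4) \<epsilon>(1) by (auto simp: h'_def)
  ultimately show False by simp
qed

text \<open>The circular equation becomes z'' = - stiff z * z, a linear equation whose coefficient
  depends on the orbit; this is the form in which Sturm comparison applies.\<close>

definition stiff :: "real \<Rightarrow> real" where
  "stiff y = 1 / ((y\<^sup>2 + (1/2)\<^sup>2) powr (3/2))"

lemma sit_force_stiff: "sit_force y (1/2) = - stiff y * y"
  by (simp add: sit_force_def stiff_def)

lemma stiff_pos: "0 < stiff y"
proof -
  have "0 < y\<^sup>2 + (1/2)\<^sup>2" by (simp add: add_nonneg_pos)
  then show ?thesis by (simp add: stiff_def)
qed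

lemma stiff_mono:
  assumes "\<bar>x\<bar> < \<bar>y\<bar>" shows "stiff y < stiff x"
proof -
  have "x\<^sup>2 < y\<^sup>2" using assms by (metis abs_ge_zero power2_abs power_strict_mono zero_less_numeral)
  moreover have "0 < x\<^sup>2 + (1/2)\<^sup>2" by (simp add: add_nonneg_pos)
  ultimately have "(x\<^sup>2 + (1/2)\<^sup>2) powr (3/2) < (y\<^sup>2 + (1/2)\<^sup>2) powr (3/2)" "0 < (x\<^sup>2 + (1/2)\<^sup>2) powr (3/2)"
    by (auto intro!: powr_less_mono2)
  then show ?thesis unfolding stiff_def by (intro divide_strict_left_mono mult_pos_pos) auto
qed

text \<open>The square root 2 sqrt 2 of this value is the frequency of small oscillations, which is
  why 2 sqrt 2 N limits the number p of zeros.\<close>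

lemma stiff_0: "stiff 0 = 8"
  by (simp add: stiff_def powr_3_2 power_divide real_sqrt_divide)

lemma continuous_on_stiff: "continuous_on A stiff"
proof -
  have "0 < y\<^sup>2 + (1/2)\<^sup>2" for y :: real by (simp add: add_nonneg_pos)
  then have "y\<^sup>2 + (1/2)\<^sup>2 \<noteq> 0" for y :: real by (metis less_irrefl)
  then show ?thesis unfolding stiff_def by (auto intro!: continuous_intros)
qed

text \<open>The spring softens: the left side is (q - 3 y^2)/q^(5/2), the stiffness is q/q^(5/2). As
  the left side is the variational coefficient, an orbit and its variational equation are strictly
  comparable.\<close>

lemma sit_dz_lt_stiff:
  assumes "y \<noteq> 0" shows "- sit_dz y (1/2) < stiff y"
proof -
  define q where "q = y\<^sup>2 + (1/2)\<^sup>2"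
  have q: "0 < q" unfolding q_def by (simp add: add_nonneg_pos)
  have "stiff y = q / (q\<^sup>2 * sqrt q)"
    unfolding stiff_def q_def[symmetric] powr_3_2[OF less_imp_le[OF q]] using q by (simp add: power2_eq_square)
  moreover have "- sit_dz y (1/2) = (q - 3 * y\<^sup>2) / (q\<^sup>2 * sqrt q)"
    unfolding sit_dz_def q_def[symmetric] powr_5_2[OF less_imp_le[OF q]] minus_divide_left[symmetric] minus_minus
    by (simp add: q_def)
  moreover have "q - 3 * y\<^sup>2 < q" using assms by simp
  ultimately show ?thesis using q by (simp add: divide_strict_right_mono)
qed

lemma circ_ode:
  "ode2 (\<lambda>t y. sit_force y (1/2)) (sitnikov_z \<xi> 0) (deriv (sitnikov_z \<xi> 0))"
  "ode2 (\<lambda>t y. - stiff (sitnikov_z \<xi> 0 t) * y) (sitnikov_z \<xi> 0) (deriv (sitnikov_z \<xi> 0))"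
  using sitnikov_z_props(1)[of 0 \<xi>] by (auto simp: ode2_def sit_force_stiff)

lemma circ_0: "sitnikov_z \<xi> 0 0 = \<xi>" "deriv (sitnikov_z \<xi> 0) 0 = 0"
  using sitnikov_z_props(2,3)[of 0 \<xi>] by auto

lemma circ_unique:
  assumes "ode2 (\<lambda>t y. sit_force y (1/2)) y1 v1" "ode2 (\<lambda>t y. sit_force y (1/2)) y2 v2"
    and "y1 t0 = y2 t0" "v1 t0 = v2 t0"
  shows "y1 = y2 \<and> v1 = v2"
  using sit_ode_unique[of 0 y1 v1 y2 v2 t0] assms by simp

lemma circ_velocity_neg:
  assumes "0 < T" "\<And>t. 0 \<le> t \<Longrightarrow> t < T \<Longrightarrow> 0 < sitnikov_z \<xi> 0 t"
  shows "deriv (sitnikov_z \<xi> 0) T < 0"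
proof -
  have "deriv (sitnikov_z \<xi> 0) T < deriv (sitnikov_z \<xi> 0) 0"
  proof (rule DERIV_neg_imp_decreasing_open[OF \<open>0 < T\<close>])
    fix t assume "0 < t" "t < T"
    then have "- stiff (sitnikov_z \<xi> 0 t) * sitnikov_z \<xi> 0 t < 0"
      using assms(2)[of t] stiff_pos by simp
    then show "\<exists>y. (deriv (sitnikov_z \<xi> 0) has_real_derivative y) (at t) \<and> y < 0"
      using circ_ode(2)[of \<xi>] unfolding ode2_def by blast
  qed (rule ode2_continuous[OF circ_ode(1)])
  then show ?thesis by (simp add: circ_0)
qed

lemma circ_less:
  assumes "0 < T" "\<And>t. 0 \<le> t \<Longrightarrow> t < T \<Longrightarrow> 0 < sitnikov_z \<xi> 0 t"
  shows "sitnikov_z \<xi> 0 T < \<xi>"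
proof -
  have "sitnikov_z \<xi> 0 T < sitnikov_z \<xi> 0 0"
  proof (rule DERIV_neg_imp_decreasing_open[OF \<open>0 < T\<close>])
    fix t assume t: "0 < t" "t < T"
    then have "deriv (sitnikov_z \<xi> 0) t < 0" using assms(2) by (intro circ_velocity_neg) auto
    then show "\<exists>y. (sitnikov_z \<xi> 0 has_real_derivative y) (at t) \<and> y < 0"
      using circ_ode(2)[of \<xi>] unfolding ode2_def by blast
  qed (rule ode2_continuous[OF circ_ode(1)])
  then show ?thesis by (simp add: circ_0)
qed

text \<open>\<open>\<tau>\<close> is a quarter of the period; all zeros follow from the symmetries about \<open>0\<close> and \<open>\<tau>\<close>.\<close>

locale quarter =
  fixes \<xi> \<tau> :: real
  assumes xi_pos: "0 < \<xi>" and tau_pos: "0 < \<tau>"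
    and zero: "sitnikov_z \<xi> 0 \<tau> = 0"
    and pos: "\<And>t. 0 \<le> t \<Longrightarrow> t < \<tau> \<Longrightarrow> 0 < sitnikov_z \<xi> 0 t"
begin

abbreviation "z \<equiv> sitnikov_z \<xi> 0"
abbreviation "v \<equiv> deriv (sitnikov_z \<xi> 0)"

lemma z_reflect: "z (2 * \<tau> - t) = - z t" and v_reflect: "v (2 * \<tau> - t) = v t"
proof -
  have "ode2 (\<lambda>t y. sit_force y (1/2)) (\<lambda>t. - z (2 * \<tau> - t)) (\<lambda>t. - (- v (2 * \<tau> - t)))"
    by (intro ode2_uminus ode2_reflect circ_ode) (auto simp: sit_force_uminus)
  from circ_unique[OF this circ_ode(1), of \<tau>] zero
  have "(\<lambda>t. - z (2 * \<tau> - t)) = z" "(\<lambda>t. - (- v (2 * \<tau> - t))) = v" by auto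
  from fun_cong[OF this(1), of t] fun_cong[OF this(2), of t]
  show "z (2 * \<tau> - t) = - z t" "v (2 * \<tau> - t) = v t" by simp_all
qed

lemma z_minus: "z (- t) = z t" and v_minus: "v (- t) = - v t"
proof -
  have "ode2 (\<lambda>t y. sit_force y (1/2)) (\<lambda>t. z (0 - t)) (\<lambda>t. - v (0 - t))"
    by (intro ode2_reflect circ_ode) auto
  from circ_unique[OF this circ_ode(1), of 0]
  have "(\<lambda>t. z (0 - t)) = z" "(\<lambda>t. - v (0 - t)) = v" by (auto simp: circ_0)
  from fun_cong[OF this(1), of t] fun_cong[OF this(2), of t]
  show "z (- t) = z t" "v (- t) = - v t" by simp_all
qed

lemma z_shift: "z (t + 2 * \<tau>) = - z t" and v_shift: "v (t + 2 * \<tau>) = - v t"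
  using z_reflect[of "- t"] v_reflect[of "- t"] z_minus[of t] v_minus[of t] by (simp_all add: add.commute)

lemma z_shift_n: "z (t + 2 * \<tau> * real n) = (-1) ^ n * z t"
  and v_shift_n: "v (t + 2 * \<tau> * real n) = (-1) ^ n * v t"
proof (induction n)
  case (Suc n)
  { case 1 show ?case using z_shift[of "t + 2 * \<tau> * real n"] Suc by (simp add: algebra_simps) }
  { case 2 show ?case using v_shift[of "t + 2 * \<tau> * real n"] Suc by (simp add: algebra_simps) }
qed auto

lemma v_neg: "0 < t \<Longrightarrow> t < 2 * \<tau> \<Longrightarrow> v t < 0"
proof -
  have *: "v t < 0" if "0 < t" "t \<le> \<tau>" for t
    using that pos by (intro circ_velocity_neg) auto
  assume "0 < t" "t < 2 * \<tau>"
  then show "v t < 0" using *[of t] *[of "2 * \<tau> - t"] v_reflect[of t] by (cases "t \<le> \<tau>") auto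
qed

lemma z_zero_base: "0 \<le> t \<Longrightarrow> t < 2 * \<tau> \<Longrightarrow> z t = 0 \<longleftrightarrow> t = \<tau>"
  using pos[of t] pos[of "2 * \<tau> - t"] z_reflect[of t] zero by (cases t \<tau> rule: linorder_cases) auto

lemma v_zero_base: "0 \<le> t \<Longrightarrow> t < 2 * \<tau> \<Longrightarrow> v t = 0 \<longleftrightarrow> t = 0"
  using v_neg[of t] circ_0(2)[of \<xi>] by (cases "t = 0") auto

lemma decompose:
  assumes "0 \<le> t"
  obtains s n where "t = s + 2 * \<tau> * real n" "0 \<le> s" "s < 2 * \<tau>"
proof -
  define n where "n = nat \<lfloor>t / (2 * \<tau>)\<rfloor>"
  have "real n \<le> t / (2 * \<tau>)" "t / (2 * \<tau>) < real n + 1"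
    using assms tau_pos by (auto simp: n_def of_nat_nat)
  then have "2 * \<tau> * real n \<le> t" "t < 2 * \<tau> * real n + 2 * \<tau>"
    using tau_pos by (auto simp: field_simps)
  then show ?thesis using that[of "t - 2 * \<tau> * real n" n] by simp
qed

lemma z_zero_iff:
  assumes "0 \<le> t" shows "z t = 0 \<longleftrightarrow> (\<exists>n. t = \<tau> + 2 * \<tau> * real n)"
proof
  assume "z t = 0"
  then show "\<exists>n. t = \<tau> + 2 * \<tau> * real n"
    using decompose[OF assms] z_shift_n z_zero_base by (metis mult_eq_0_iff power_eq_0_iff zero_neq_neg_one)
qed (use z_shift_n[of \<tau>] zero in auto)

lemma v_zero_iff:
  assumes "0 \<le> t" shows "v t = 0 \<longleftrightarrow> (\<exists>n. t = 2 * \<tau> * real n)"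
proof
  assume "v t = 0"
  obtain s n where "t = s + 2 * \<tau> * real n" "0 \<le> s" "s < 2 * \<tau>" by (rule decompose[OF assms])
  then show "\<exists>n. t = 2 * \<tau> * real n"
    using v_shift_n[of s n] v_zero_base[of s] \<open>v t = 0\<close> by auto
qed (use v_shift_n[of 0] circ_0(2) in auto)

lemma card_zeros: "card {t \<in> {0..2 * \<tau> * real n}. z t = 0} = n"
proof -
  have "{t \<in> {0..2 * \<tau> * real n}. z t = 0} = (\<lambda>m. \<tau> + 2 * \<tau> * real m) ` {..<n}"
  proof (intro set_eqI iffI)
    fix t assume t: "t \<in> {t \<in> {0..2 * \<tau> * real n}. z t = 0}"
    then obtain m where m: "t = \<tau> + 2 * \<tau> * real m" using z_zero_iff by auto
    have "\<tau> * (1 + 2 * real m) \<le> \<tau> * (2 * real n)" using t m by (simp add: algebra_simps)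
    then have "1 + 2 * real m \<le> 2 * real n" using tau_pos by simp
    then have "m < n" by linarith
    then show "t \<in> (\<lambda>m. \<tau> + 2 * \<tau> * real m) ` {..<n}" using m by auto
  next
    fix t assume "t \<in> (\<lambda>m. \<tau> + 2 * \<tau> * real m) ` {..<n}"
    then obtain m where m: "m < n" "t = \<tau> + 2 * \<tau> * real m" by auto
    have "1 + 2 * real m \<le> 2 * real n" using m(1) by linarith
    then have "\<tau> * (1 + 2 * real m) \<le> \<tau> * (2 * real n)" using tau_pos by simp
    moreover have "0 \<le> t" using m tau_pos by simp
    ultimately show "t \<in> {t \<in> {0..2 * \<tau> * real n}. z t = 0}"
      using m z_zero_iff[of t] by (auto simp: algebra_simps)
  qed
  moreover have "inj_on (\<lambda>m. \<tau> + 2 * \<tau> * real m) {..<n}" using tau_pos by (auto simp: inj_on_def)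
  ultimately show ?thesis by (simp add: card_image)
qed

abbreviation "a \<equiv> a_coeff \<xi> 0"
abbreviation "f1 \<equiv> phi1 \<xi> 0"
abbreviation "f2 \<equiv> phi2 \<xi> 0"

lemma a_eq: "a t = - sit_dz (z t) (1/2)" by (simp add: a_coeff_eq)

lemma sit_dz_uminus: "sit_dz (- y) \<rho> = sit_dz y \<rho>" by (simp add: sit_dz_def)

text \<open>The orbit and f1 both start with velocity 0, and the variational coefficient is below
  the stiffness while z > 0. Hence z f1' - f1 z' grows from 0 and is positive at a first zero of f1;
  but there z \<ge> 0 and f1' \<le> 0.\<close>

lemma phi1_pos: "0 \<le> t \<Longrightarrow> t \<le> \<tau> \<Longrightarrow> 0 < f1 t"
proof (rule ccontr)
  assume t: "0 \<le> t" "t \<le> \<tau>" "\<not> 0 < f1 t"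
  have "continuous_on {0..t} f1" by (rule ode2_continuous[OF phi1_props(1)])
  then obtain s where s: "0 < s" "s \<le> t" "f1 s = 0" "\<And>u. 0 \<le> u \<Longrightarrow> u < s \<Longrightarrow> 0 < f1 u"
    using first_zero[of t f1] t phi1_props(2) by (metis not_less zero_less_one)
  have d: "deriv f1 s \<le> 0"
    by (rule deriv_nonpos_at_first_zero[of f1, OF _ s(1,3,4)]) (use phi1_props(1) in \<open>auto simp: ode2_def\<close>)
  have "f1 s * v s < z s * deriv f1 s"
  proof (rule sturm_wronskian[OF circ_ode(2) phi1_props(1) s(1)])
    show "z 0 * deriv f1 0 = f1 0 * v 0" by (simp add: phi1_props circ_0)
    fix u assume u: "0 < u" "u < s"
    then have "0 < z u" using pos s t by auto
    then show "0 < z u \<and> 0 < f1 u \<and> a u < stiff (z u)"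
      using s(4)[of u] u sit_dz_lt_stiff[of "z u"] by (auto simp: a_eq)
  qed
  moreover have "0 \<le> z s" using pos[of s] zero s t by (cases "s = \<tau>") auto
  ultimately show False using mult_nonneg_nonpos[of "z s" "deriv f1 s"] d s(3) by simp
qed

text \<open>The circular equation is autonomous, so the velocity of the orbit solves the variational
  equation. Dividing it by z''(0) = - stiff \<xi> * \<xi> gives the initial data of f2.\<close>

lemma phi2_eq: "f2 = (\<lambda>t. - v t / (stiff \<xi> * \<xi>))" "deriv f2 = (\<lambda>t. stiff (z t) * z t / (stiff \<xi> * \<xi>))"
proof -
  define c where "c = stiff \<xi> * \<xi>"
  have c: "c > 0" unfolding c_def using xi_pos stiff_pos by simp
  have "ode2 (\<lambda>t y. - a t * y) (\<lambda>t. - v t / c) (\<lambda>t. stiff (z t) * z t / c)"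
    unfolding ode2_def
  proof (intro allI conjI)
    fix t
    have v: "(v has_real_derivative - stiff (z t) * z t) (at t)" and zz: "(z has_real_derivative v t) (at t)"
      using circ_ode(2)[of \<xi>] by (auto simp: ode2_def)
    show "((\<lambda>t. - v t / c) has_real_derivative stiff (z t) * z t / c) (at t)"
      using v c by (auto intro!: derivative_eq_intros)
    have "((\<lambda>t. sit_force (z t) (1/2)) has_real_derivative sit_dz (z t) (1/2) * v t) (at t)"
      by (rule DERIV_chain'[OF zz sit_force_dz]) simp
    then have "((\<lambda>t. - sit_force (z t) (1/2) / c) has_real_derivative - (sit_dz (z t) (1/2) * v t) / c) (at t)"
      by (intro DERIV_cdivide DERIV_minus)
    then show "((\<lambda>t. stiff (z t) * z t / c) has_real_derivative - a t * (- v t / c)) (at t)"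
      by (simp add: sit_force_stiff a_eq)
  qed
  from var_ode_unique[OF phi2_props(1) this, of 0] 
  show "f2 = (\<lambda>t. - v t / (stiff \<xi> * \<xi>))" "deriv f2 = (\<lambda>t. stiff (z t) * z t / (stiff \<xi> * \<xi>))"
    using xi_pos stiff_pos[of \<xi>] by (auto simp: phi2_props circ_0 c_def)
qed

lemma phi2_shift: "f2 (t + 2 * \<tau>) = - f2 t" "deriv f2 (t + 2 * \<tau>) = - deriv f2 t"
  using fun_cong[OF phi2_eq(1)] fun_cong[OF phi2_eq(2)] by (simp_all add: z_shift v_shift stiff_def)

end

lemma wronskian_const:
  assumes "ode2 (\<lambda>t y. - a t * y) y1 v1" "ode2 (\<lambda>t y. - a t * y) y2 v2"
  shows "y1 t * v2 t - v1 t * y2 t = y1 0 * v2 0 - v1 0 * y2 0"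
proof -
  have "((\<lambda>t. y1 t * v2 t - v1 t * y2 t) has_real_derivative 0) (at t)" for t
  proof -
    note [derivative_intros] = assms(1,2)[unfolded ode2_def, rule_format, THEN conjunct1]
      assms(1,2)[unfolded ode2_def, rule_format, THEN conjunct2]
    show ?thesis by (auto intro!: derivative_eq_intros simp: algebra_simps)
  qed
  then show ?thesis using DERIV_isconst_all by blast
qed

context quarter
begin

lemma a_shift: "a (t + 2 * \<tau>) = a t" and a_reflect: "a (2 * \<tau> - t) = a t"
  by (simp_all add: a_eq z_shift z_reflect sit_dz_uminus)

text \<open>At 2\<tau> the function f2 vanishes and its derivative is -1, so the Wronskian relation
  determines f1.\<close>

lemma phi1_half_period: "f1 (2 * \<tau>) = -1"
proof -
  have "f1 (2 * \<tau>) * deriv f2 (2 * \<tau>) - deriv f1 (2 * \<tau>) * f2 (2 * \<tau>) = 1"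
    using wronskian_const[OF phi1_props(1) phi2_props(1), of \<xi> "2 * \<tau>"] by (simp add: phi1_props phi2_props)
  then show ?thesis using phi2_shift[of 0] by (simp add: phi2_props)
qed

abbreviation "b \<equiv> deriv f1 (2 * \<tau>)"

text \<open>\<open>b\<close> measures the derivative of the period with respect to the amplitude: if it vanished, the
  reflection about \<open>\<tau>\<close> would force \<open>f1 \<tau> = 0\<close>, against the Sturm comparison in \<open>phi1_pos\<close>.\<close>

lemma b_neq_0: "b \<noteq> 0"
proof
  assume b: "b = 0"
  have "ode2 (\<lambda>t y. - a t * y) (\<lambda>t. f1 (2 * \<tau> - t)) (\<lambda>t. - deriv f1 (2 * \<tau> - t))"
    by (intro ode2_reflect phi1_props) (simp add: a_reflect)
  moreover have "ode2 (\<lambda>t y. - a t * y) (\<lambda>t. - f1 t) (\<lambda>t. - deriv f1 t)"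
    by (intro ode2_uminus phi1_props) simp
  ultimately have "(\<lambda>t. f1 (2 * \<tau> - t)) = (\<lambda>t. - f1 t)"
    using var_ode_unique[of \<xi> _ _ _ _ 0] b phi1_half_period by (simp add: phi1_props)
  from fun_cong[OF this, of \<tau>] have "f1 \<tau> = 0" by simp
  then show False using phi1_pos[of \<tau>] tau_pos by simp
qed

lemma phi1_shift: "f1 (t + 2 * \<tau>) = - f1 t + b * f2 t" "deriv f1 (t + 2 * \<tau>) = - deriv f1 t + b * deriv f2 t"
proof -
  have "ode2 (\<lambda>t y. - a t * y) (\<lambda>t. f1 (t + 2 * \<tau>)) (\<lambda>t. deriv f1 (t + 2 * \<tau>))"
    by (intro ode2_shift phi1_props) (simp add: a_shift)
  from var_ode_unique[OF this ode2_linear_comb[OF phi1_props(1) phi2_props(1), where ?c1.0="-1" and ?c2.0=b], of 0]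
  have "(\<lambda>t. f1 (t + 2 * \<tau>)) = (\<lambda>t. - 1 * f1 t + b * f2 t) \<and>
      (\<lambda>t. deriv f1 (t + 2 * \<tau>)) = (\<lambda>t. - 1 * deriv f1 t + b * deriv f2 t)"
    by (simp add: phi1_props phi2_props phi1_half_period)
  then show "f1 (t + 2 * \<tau>) = - f1 t + b * f2 t" "deriv f1 (t + 2 * \<tau>) = - deriv f1 t + b * deriv f2 t"
    by (auto simp: fun_eq_iff)
qed

text \<open>The shift by 2\<tau> sends f1 to - f1 + b f2 and f2 to - f2, which is minus a shear. The
  off-diagonal entry of its n-th power is n b up to sign, so at t = 0 the derivative is a nonzero
  multiple of b for every n \<ge> 1.\<close>

lemma deriv_phi1_shift_n:
  "deriv f1 (t + 2 * \<tau> * real n) = (-1) ^ n * (deriv f1 t - real n * b * deriv f2 t)"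
proof (induction n arbitrary: t)
  case (Suc n)
  have "deriv f1 (t + 2 * \<tau> * real (Suc n)) = deriv f1 ((t + 2 * \<tau>) + 2 * \<tau> * real n)"
    by (simp add: algebra_simps)
  also have "\<dots> = (-1) ^ n * (deriv f1 (t + 2 * \<tau>) - real n * b * deriv f2 (t + 2 * \<tau>))" by (rule Suc)
  also have "\<dots> = (-1) ^ Suc n * (deriv f1 t - real (Suc n) * b * deriv f2 t)"
    unfolding phi1_shift phi2_shift by (simp add: algebra_simps)
  finally show ?case .
qed simp

lemma deriv_phi1_neq_0: "n \<ge> 1 \<Longrightarrow> deriv f1 (2 * \<tau> * real n) \<noteq> 0"
  using deriv_phi1_shift_n[of 0 n] b_neq_0 by (simp add: phi1_props phi2_props)

end

text \<open>While the larger orbit stays above, its stiffness is smaller, so the Wronskian of the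
  two orbits is strictly positive at their first meeting. There the larger orbit comes down at least
  as fast, which gives the opposite sign. The common zero at s forces such a meeting.\<close>

lemma quarter_unique:
  assumes "quarter \<xi>1 s" "quarter \<xi>2 s"
  shows "\<xi>1 = \<xi>2"
proof -
  have aux: False if A: "quarter \<xi>1 s" and B: "quarter \<xi>2 s" and "\<xi>1 < \<xi>2" for \<xi>1 \<xi>2
  proof -
    interpret A: quarter \<xi>1 s by (rule A)
    interpret B: quarter \<xi>2 s by (rule B)
    define h where "h = (\<lambda>t. B.z t - A.z t)"
    have "continuous_on {0..s} h" unfolding h_def
      by (intro continuous_intros ode2_continuous(1)[OF circ_ode(1)])
    then obtain t where t: "0 < t" "t \<le> s" "h t = 0" "\<And>u. 0 \<le> u \<Longrightarrow> u < t \<Longrightarrow> 0 < h u"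
      using first_zero[of s h] A.tau_pos A.zero B.zero \<open>\<xi>1 < \<xi>2\<close>
      by (metis circ_0(1) diff_gt_0_iff_gt diff_self h_def less_eq_real_def)
    have "(h has_real_derivative B.v t - A.v t) (at t)"
      unfolding h_def using circ_ode(1) by (auto simp: ode2_def intro!: DERIV_diff)
    from deriv_nonpos_at_first_zero[OF this t(1,3,4)] have d: "B.v t \<le> A.v t" by simp
    have "B.z t * A.v t < A.z t * B.v t"
    proof (rule sturm_wronskian[OF circ_ode(2) circ_ode(2) t(1)])
      fix u assume u: "0 < u" "u < t"
      then have "0 < A.z u" "A.z u < B.z u" using A.pos t by (auto simp: h_def)
      then show "0 < A.z u \<and> 0 < B.z u \<and> stiff (B.z u) < stiff (A.z u)"
        by (auto intro!: stiff_mono)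
    qed (simp add: circ_0)
    moreover have "B.z t = A.z t" using t(3) by (simp add: h_def)
    moreover have "0 \<le> A.z t" using A.pos[of t] A.zero t by (cases "t = s") auto
    ultimately show False using mult_left_mono[OF d, of "A.z t"] by simp
  qed
  show ?thesis using aux[OF assms] aux[OF assms(2,1)] by (cases \<xi>1 \<xi>2 rule: linorder_cases) auto
qed

section \<open>Existence of an orbit with prescribed quarter period\<close>

lemma circ_dependence:
  assumes "0 \<le> t" "t \<le> s"
  shows "\<bar>sitnikov_z \<xi>1 0 t - sitnikov_z \<xi>2 0 t\<bar> \<le> exp (9 * s) * \<bar>\<xi>1 - \<xi>2\<bar>"
proof -
  let ?d = "\<lambda>t. sitnikov_z \<xi>1 0 t - sitnikov_z \<xi>2 0 t"
  let ?v = "\<lambda>t. deriv (sitnikov_z \<xi>1 0) t - deriv (sitnikov_z \<xi>2 0) t"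
  have "(?d t)\<^sup>2 + (?v t)\<^sup>2 \<le> ((?d 0)\<^sup>2 + (?v 0)\<^sup>2) * exp ((1 + 16) * t)"
  proof (rule gronwall2[OF \<open>0 \<le> t\<close>])
    fix u
    show "(?d has_real_derivative ?v u) (at u within {0..t})"
      using circ_ode(1) unfolding ode2_def by (intro DERIV_diff) (auto intro: has_field_derivative_at_within)
    show "(?v has_real_derivative sit_force (sitnikov_z \<xi>1 0 u) (1/2) - sit_force (sitnikov_z \<xi>2 0 u) (1/2)) (at u within {0..t})"
      using circ_ode(1) unfolding ode2_def by (intro DERIV_diff) (auto intro: has_field_derivative_at_within)
    show "\<bar>sit_force (sitnikov_z \<xi>1 0 u) (1/2) - sit_force (sitnikov_z \<xi>2 0 u) (1/2)\<bar> \<le> 16 * \<bar>?d u\<bar>"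
      using sit_force_lipschitz[of "1/2" "1/2" "sitnikov_z \<xi>1 0 u" "sitnikov_z \<xi>2 0 u"] by (simp add: power_divide)
  qed auto
  also have "\<dots> = (\<xi>1 - \<xi>2)\<^sup>2 * exp (17 * t)" by (simp add: circ_0)
  \<comment> \<open>17 is rounded up to 18 so that the exponential is the square of exp(9
    s).\<close>
  also have "\<dots> \<le> (\<xi>1 - \<xi>2)\<^sup>2 * exp (18 * s)" using assms by (intro mult_left_mono) auto
  also have "\<dots> = (exp (9 * s) * \<bar>\<xi>1 - \<xi>2\<bar>)\<^sup>2"
    by (simp add: power_mult_distrib exp_double[symmetric])
  finally have "(?d t)\<^sup>2 \<le> (exp (9 * s) * \<bar>\<xi>1 - \<xi>2\<bar>)\<^sup>2"
    by (smt (verit) zero_le_power2)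
  then show ?thesis by (rule abs_le_square_iff[THEN iffD2, THEN order_trans]) simp
qed

lemma sit_force_half_bound: "\<bar>sit_force y (1/2)\<bar> \<le> 4"
proof -
  define q where "q = y\<^sup>2 + (1/2)\<^sup>2"
  have q: "1/4 \<le> q" unfolding q_def by (simp add: power2_eq_square)
  have s: "\<bar>y\<bar> \<le> sqrt q" unfolding q_def by (intro real_le_rsqrt) simp
  have "\<bar>sit_force y (1/2)\<bar> = \<bar>y\<bar> / (q * sqrt q)"
    unfolding sit_force_def q_def[symmetric] using q powr_3_2[of q] by (simp add: abs_mult)
  also have "\<dots> \<le> sqrt q / (q * sqrt q)" using s q by (intro divide_right_mono) auto
  also have "\<dots> = 1 / q" using q by simp
  also have "\<dots> \<le> 4" using q by (simp add: field_simps)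
  finally show ?thesis .
qed

text \<open>The force is bounded by 4, so an orbit released at rest falls no faster than a parabola;
  a large amplitude therefore stays positive on any given interval.\<close>

lemma circ_lower:
  fixes \<xi> t :: real
  assumes "0 \<le> t" shows "\<xi> - 2 * t\<^sup>2 \<le> sitnikov_z \<xi> 0 t"
proof -
  let ?z = "sitnikov_z \<xi> 0" and ?v = "deriv (sitnikov_z \<xi> 0)"
  have v: "- 4 * t \<le> ?v t" if "0 \<le> t" for t
  proof -
    have "?v 0 + 4 * 0 \<le> ?v t + 4 * t"
    proof (rule DERIV_nonneg_imp_nondecreasing[OF that])
      fix u :: real
      have "((\<lambda>t. ?v t + 4 * t) has_real_derivative sit_force (?z u) (1/2) + 4) (at u)"
        using circ_ode(1)[of \<xi>] unfolding ode2_def by (auto intro!: derivative_eq_intros)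
      then show "\<exists>y. ((\<lambda>t. ?v t + 4 * t) has_real_derivative y) (at u) \<and> 0 \<le> y"
        using sit_force_half_bound[of "?z u"] by (intro exI conjI) auto
    qed
    then show ?thesis by (simp add: circ_0)
  qed
  have "?z 0 + 2 * 0\<^sup>2 \<le> ?z t + 2 * t\<^sup>2"
  proof (rule DERIV_nonneg_imp_nondecreasing[OF assms])
    fix u :: real assume "0 \<le> u"
    have "((\<lambda>t. ?z t + 2 * t\<^sup>2) has_real_derivative ?v u + 4 * u) (at u)"
      using circ_ode(1)[of \<xi>] unfolding ode2_def by (auto intro!: derivative_eq_intros)
    then show "\<exists>y. ((\<lambda>t. ?z t + 2 * t\<^sup>2) has_real_derivative y) (at u) \<and> 0 \<le> y"
      using v[OF \<open>0 \<le> u\<close>] by (intro exI conjI) auto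
  qed
  then show ?thesis by (simp add: circ_0)
qed

text \<open>The amplitude is the infimum of the set A of amplitudes whose orbit stays positive on
  [0, s]. A contains large amplitudes and keeps away from 0, because small orbits vanish before s
  when 2 sqrt 2 s > \<pi>/2. Continuous dependence keeps the infimum out of A and its orbit
  nonnegative. So this orbit reaches 0 in [0, s], with negative velocity, which is possible only at
  s.\<close>

lemma quarter_exists:
  assumes "pi / 2 < 2 * sqrt 2 * s"
  shows "\<exists>\<xi>. quarter \<xi> s"
proof -
  let ?Z = "\<lambda>\<xi>. sitnikov_z \<xi> 0"
  have s: "0 < s" using assms pi_gt_zero by (smt (verit) mult_nonneg_nonpos mult_nonneg_nonneg real_sqrt_ge_zero zero_less_divide_iff)
  define A where "A = {\<xi>. 0 < \<xi> \<and> (\<forall>t\<in>{0..s}. 0 < ?Z \<xi> t)}"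
  define C where "C = exp (9 * s)"
  have C: "0 < C" by (simp add: C_def)
  have dep: "\<bar>?Z x t - ?Z y t\<bar> \<le> C * \<bar>x - y\<bar>" if "t \<in> {0..s}" for x y t
    unfolding C_def by (rule circ_dependence) (use that in auto)
  obtain \<delta> where \<delta>: "0 < \<delta>" "\<And>\<xi>. \<xi> \<in> A \<Longrightarrow> \<delta> \<le> \<xi>"
  proof -
    \<comment> \<open>Halfway between \<pi>/(2 s) and 2 sqrt 2: the cosine of frequency w vanishes
      before s, while w^2 < 8 = stiff 0 is still below the stiffness at small amplitudes.\<close>
    define w where "w = (pi / (2 * s) + 2 * sqrt 2) / 2"
    have w: "pi / (2 * s) < w" "w < 2 * sqrt 2" "0 < w"
      using assms s by (auto simp: w_def field_simps add_pos_pos)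
    have "w\<^sup>2 < (2 * sqrt 2)\<^sup>2" using w by (intro power_strict_mono) auto
    then have w8: "w\<^sup>2 < stiff 0" by (simp add: stiff_0 power_mult_distrib)
    have "isCont stiff 0" using continuous_on_stiff[of UNIV] by (simp add: continuous_on_eq_continuous_at)
    then have "\<forall>\<^sub>F x in at 0. w\<^sup>2 < stiff x" using w8 by (intro order_tendstoD) (auto simp: isCont_def)
    then obtain d where d: "0 < d" "\<And>x. x \<noteq> 0 \<Longrightarrow> \<bar>x\<bar> < d \<Longrightarrow> w\<^sup>2 < stiff x"
      unfolding eventually_at by (auto simp: dist_real_def)
    show ?thesis
    proof (rule that[OF d(1)], rule ccontr)
      fix \<xi> assume \<xi>: "\<xi> \<in> A" "\<not> d \<le> \<xi>"
      define T where "T = pi / (2 * w)"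
      have T: "0 < T" "T < s" "w * T = pi / 2" using w s by (auto simp: T_def field_simps)
      have "cos (w * T) * deriv (?Z \<xi>) T < ?Z \<xi> T * (- w * sin (w * T))"
      proof (rule sturm_wronskian[OF circ_ode(2) _ T(1), where ?q2.0="\<lambda>_. w\<^sup>2"])
        show "ode2 (\<lambda>t y. - w\<^sup>2 * y) (\<lambda>t. cos (w * t)) (\<lambda>t. - w * sin (w * t))"
          unfolding ode2_def by (auto intro!: derivative_eq_intros simp: power2_eq_square)
        fix t assume t: "0 < t" "t < T"
        have pos: "0 < ?Z \<xi> u" if "0 \<le> u" "u \<le> t" for u using \<xi> that t T by (auto simp: A_def)
        have "?Z \<xi> t < \<xi>" using pos by (intro circ_less t) auto
        then have "0 < ?Z \<xi> t" "w\<^sup>2 < stiff (?Z \<xi> t)"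
          using pos[of t] d(2)[of "?Z \<xi> t"] \<xi> t by auto
        moreover have "w * t < w * T" "0 < w * t" using t w by auto
        then have "0 < cos (w * t)" unfolding T(3) by (intro cos_gt_zero) auto
        ultimately show "0 < ?Z \<xi> t \<and> 0 < cos (w * t) \<and> w\<^sup>2 < stiff (?Z \<xi> t)" by simp
      qed (simp add: circ_0)
      then have "?Z \<xi> T * w < 0" unfolding T(3) by simp
      moreover have "0 < ?Z \<xi> T" using \<xi> T by (auto simp: A_def)
      ultimately show False using w by (simp add: mult_less_0_iff)
    qed
  qed
  have "2 * s\<^sup>2 + 1 \<in> A" unfolding A_def
  proof (intro CollectI conjI ballI)
    show "0 < 2 * s\<^sup>2 + 1" by (simp add: add_nonneg_pos)
    fix t assume "t \<in> {0..s}"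
    then have "t\<^sup>2 \<le> s\<^sup>2" by (intro power_mono) auto
    moreover have "2 * s\<^sup>2 + 1 - 2 * t\<^sup>2 \<le> ?Z (2 * s\<^sup>2 + 1) t"
      using \<open>t \<in> {0..s}\<close> by (intro circ_lower) auto
    ultimately show "0 < ?Z (2 * s\<^sup>2 + 1) t" by linarith
  qed
  then have ne: "A \<noteq> {}" by auto
  have bdd: "bdd_below A" using \<delta>(2) by (rule bdd_belowI)
  define \<xi> where "\<xi> = Inf A"
  have xd: "\<delta> \<le> \<xi>" unfolding \<xi>_def using ne \<delta>(2) by (rule cInf_greatest)
  have cz: "continuous_on {0..s} (?Z \<xi>)" by (rule ode2_continuous(1)[OF circ_ode(1)])
  have notin: "\<xi> \<notin> A"
  proof
    assume "\<xi> \<in> A"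
    obtain t0 where t0: "t0 \<in> {0..s}" "\<And>t. t \<in> {0..s} \<Longrightarrow> ?Z \<xi> t0 \<le> ?Z \<xi> t"
      using continuous_attains_inf[OF compact_Icc _ cz] s by auto
    define m where "m = ?Z \<xi> t0"
    have m: "0 < m" using \<open>\<xi> \<in> A\<close> t0 by (auto simp: A_def m_def)
    \<comment> \<open>Lowering the amplitude by \<eta> moves the orbit by at most C \<eta> < m on
      [0, s], so it stays positive and \<xi> would not be a lower bound of A.\<close>
    define \<eta> where "\<eta> = min (m / (2 * C)) (\<xi> / 2)"
    have eta: "0 < \<eta>" "\<eta> < \<xi>" using m C \<delta>(1) xd by (auto simp: \<eta>_def)
    have "\<eta> \<le> m / (2 * C)" by (simp add: \<eta>_def)
    then have "C * \<eta> \<le> m / 2" using C by (simp add: field_simps)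
    then have Cm: "C * \<eta> < m" using m by simp
    have "\<xi> - \<eta> \<in> A" unfolding A_def
    proof (intro CollectI conjI ballI)
      show "0 < \<xi> - \<eta>" using eta by simp
      fix t assume t: "t \<in> {0..s}"
      then show "0 < ?Z (\<xi> - \<eta>) t"
        using dep[OF t, of \<xi> "\<xi> - \<eta>"] t0(2)[OF t] Cm eta by (simp add: m_def abs_le_iff)
    qed
    then have "\<xi> \<le> \<xi> - \<eta>" unfolding \<xi>_def by (intro cInf_lower bdd)
    then show False using eta by simp
  qed
  have nonneg: "0 \<le> ?Z \<xi> t" if t: "t \<in> {0..s}" for t
  proof (rule ccontr)
    assume neg: "\<not> 0 \<le> ?Z \<xi> t"
    then have "\<xi> < \<xi> + (- ?Z \<xi> t) / C" using C by (simp add: divide_neg_pos)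
    then obtain x where x: "x \<in> A" "x < \<xi> + (- ?Z \<xi> t) / C"
      unfolding \<xi>_def using ne bdd by (meson cInf_lessD)
    have "\<xi> \<le> x" unfolding \<xi>_def by (intro cInf_lower x bdd)
    then have "C * \<bar>x - \<xi>\<bar> < - ?Z \<xi> t" using x(2) C by (simp add: field_simps)
    moreover have "0 < ?Z x t" using x(1) t by (auto simp: A_def)
    ultimately show False using dep[OF t, of x \<xi>] by simp
  qed
  obtain t1 where t1: "t1 \<in> {0..s}" "?Z \<xi> t1 \<le> 0"
    using notin xd \<delta>(1) by (force simp: A_def)
  obtain u where u: "0 < u" "u \<le> t1" "?Z \<xi> u = 0" "\<And>t. 0 \<le> t \<Longrightarrow> t < u \<Longrightarrow> 0 < ?Z \<xi> t"
  proof (rule first_zero[of t1 "?Z \<xi>"])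
    show "continuous_on {0..t1} (?Z \<xi>)" by (rule ode2_continuous(1)[OF circ_ode(1)])
  qed (use t1 xd \<delta>(1) circ_0 that in auto)
  have "deriv (?Z \<xi>) u < 0" by (rule circ_velocity_neg[OF u(1,4)])
  then obtain d where d: "0 < d" "\<And>h. 0 < h \<Longrightarrow> h < d \<Longrightarrow> ?Z \<xi> (u + h) < ?Z \<xi> u"
    using DERIV_neg_dec_right[of "?Z \<xi>" "deriv (?Z \<xi>) u" u] circ_ode(1)[of \<xi>] by (auto simp: ode2_def)
  have "u = s"
  proof (rule ccontr)
    assume "u \<noteq> s"
    then have "u < s" using u(2) t1(1) by auto
    define h where "h = min (d / 2) (s - u)"
    have "?Z \<xi> (u + h) < 0" using d(2)[of h] d(1) \<open>u < s\<close> u(3) by (auto simp: h_def)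
    moreover have "u + h \<in> {0..s}" using d(1) \<open>u < s\<close> u(1) by (auto simp: h_def)
    ultimately show False using nonneg by force
  qed
  then have "quarter \<xi> s" using u xd \<delta>(1) by unfold_locales auto
  then show ?thesis by blast
qed

text \<open>Infinite descent: both numbers are even and can be halved. It shows p \<noteq> 2 sqrt 2
  N, turning the weak inequality from the floor into the strict one that
  \<open>quarter_exists\<close> requires.\<close>

lemma no_square_double_square:
  fixes a b :: nat
  assumes "a * a = 2 * (b * b)" shows "b = 0"
  using assms
proof (induction a arbitrary: b rule: less_induct)
  case (less a)
  have "even (a * a)" unfolding less.prems by simp
  then obtain c where c: "a = 2 * c" by (auto elim: evenE)
  with less.prems have b: "b * b = 2 * (c * c)" by simp
  then have "even (b * b)" by simp
  then obtain d where d: "b = 2 * d" by (auto elim: evenE)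
  with b have e: "c * c = 2 * (d * d)" by simp
  show ?case
  proof (cases "a = 0")
    case False
    then have "c < a" using c by simp
    then show ?thesis using less.IH[OF _ e] d by simp
  qed (use less.prems in simp)
qed

text \<open>An orbit at rest at N\<pi> with p zeros up to there has N\<pi> = 2 \<tau> p, so its
  quarter period must be N\<pi>/(2 p). Existence and uniqueness of the orbit with that quarter
  period make the description \<open>xi\<close> denote.\<close>

lemma xi_quarter:
  assumes "1 \<le> N" "p \<in> {1..nat \<lfloor>2 * sqrt 2 * real N\<rfloor>}"
  shows "quarter (xi N p) (real N * pi / (2 * real p))"
proof -
  define s where "s = real N * pi / (2 * real p)"
  have p: "1 \<le> p" "p \<le> nat \<lfloor>2 * sqrt 2 * real N\<rfloor>" using assms by auto
  have "real p \<le> 2 * sqrt 2 * real N" using p by (simp add: le_nat_iff le_floor_iff)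
  moreover have "real p \<noteq> 2 * sqrt 2 * real N"
  proof
    assume "real p = 2 * sqrt 2 * real N"
    then have "(real p)\<^sup>2 = (2 * sqrt 2 * real N)\<^sup>2" by simp
    then have "real (p * p) = real (2 * ((2 * N) * (2 * N)))" by (simp add: power2_eq_square)
    then have "p * p = 2 * ((2 * N) * (2 * N))" by (rule of_nat_eq_iff[THEN iffD1])
    then show False using no_square_double_square assms(1) by fastforce
  qed
  ultimately have "real p < 2 * sqrt 2 * real N" by simp
  then have "pi * real p < pi * (2 * sqrt 2 * real N)" by simp
  then have "pi / 2 < 2 * sqrt 2 * s" using p(1) by (simp add: s_def field_simps)
  then obtain \<xi> where q: "quarter \<xi> s" using quarter_exists by blast
  have Np: "real N * pi = 2 * s * real p" using p(1) by (simp add: s_def)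
  interpret quarter \<xi> s by (rule q)
  have "xi N p = \<xi>" unfolding xi_def
  proof (rule the_equality)
    show "0 < \<xi> \<and> v (real N * pi) = 0 \<and> card {t \<in> {0..real N * pi}. z t = 0} = p"
      using xi_pos card_zeros[of p] v_zero_iff[of "real N * pi"] tau_pos unfolding Np by auto
    fix x assume x: "0 < x \<and> deriv (sitnikov_z x 0) (real N * pi) = 0 \<and>
      card {t \<in> {0..real N * pi}. sitnikov_z x 0 t = 0} = p"
    \<comment> \<open>p \<ge> 1 gives the rival amplitude x a zero, hence a first one u, which is
      its quarter period.\<close>
    then have "{t \<in> {0..real N * pi}. sitnikov_z x 0 t = 0} \<noteq> {}" using p(1) by (metis card.empty not_one_le_zero)
    then obtain t1 where t1: "0 \<le> t1" "sitnikov_z x 0 t1 = 0" by auto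
    obtain u where u: "0 < u" "u \<le> t1" "sitnikov_z x 0 u = 0" "\<And>t. 0 \<le> t \<Longrightarrow> t < u \<Longrightarrow> 0 < sitnikov_z x 0 t"
    proof (rule first_zero[of t1 "sitnikov_z x 0"])
      show "continuous_on {0..t1} (sitnikov_z x 0)" by (rule ode2_continuous(1)[OF circ_ode(1)])
    qed (use t1 x circ_0 that in auto)
    interpret X: quarter x u using u x by unfold_locales auto
    obtain n where n: "real N * pi = 2 * u * real n" using X.v_zero_iff[of "real N * pi"] x by auto
    have "n = p" using X.card_zeros[of n] x by (simp add: n)
    then have "u = s" using n Np p(1) by simp
    then show "x = \<xi>" using quarter_unique[OF X.quarter_axioms] q by simp
  qed
  then show ?thesis using q by (simp add: s_def)
qed

lemma xi_props:
  assumes "1 \<le> N" "p \<in> {1..nat \<lfloor>2 * sqrt 2 * real N\<rfloor>}"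
  shows "0 < xi N p" "deriv (sitnikov_z (xi N p) 0) (real N * pi) = 0"
    "even_periodic N (sitnikov_z (xi N p) 0)" "dphi1_end N p \<noteq> 0"
proof -
  interpret quarter "xi N p" "real N * pi / (2 * real p)" by (rule xi_quarter[OF assms])
  have p: "1 \<le> p" using assms by auto
  then have Np: "2 * (real N * pi / (2 * real p)) * real p = real N * pi" by simp
  show "0 < xi N p" by (rule xi_pos)
  show v: "deriv (sitnikov_z (xi N p) 0) (real N * pi) = 0"
    using v_zero_iff[of "real N * pi"] Np by (metis mult_nonneg_nonneg of_nat_0_le_iff pi_ge_zero)
  show "even_periodic N (sitnikov_z (xi N p) 0)"
    by (rule sit_even_periodic[OF _ _ sitnikov_z_props(1) _ v]) (auto simp: circ_0)
  show "dphi1_end N p \<noteq> 0"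
    unfolding dphi1_end_def using deriv_phi1_neq_0[OF p] unfolding Np .
qed

section \<open>The explicit constants\<close>

lemma b1_pos: "1 \<le> N \<Longrightarrow> 0 < e \<Longrightarrow> e < 1 \<Longrightarrow> 0 < b1 N e"
  unfolding b1_def by (intro divide_pos_pos mult_pos_pos zero_less_power) auto

lemma b2_pos: "1 \<le> N \<Longrightarrow> 0 < e \<Longrightarrow> e < 1 \<Longrightarrow> 0 < b2 N e"
  unfolding b2_def by (intro divide_pos_pos mult_pos_pos zero_less_power) auto

lemma b1_strict_mono:
  assumes "1 \<le> N" "0 < e" "e < e'" "e' < 1" shows "b1 N e < b1 N e'"
  unfolding b1_def
proof (rule frac_less)
  show "(1 - e') ^ 8 \<le> (1 - e) ^ 8" using assms by (intro power_mono) auto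
qed (use assms in auto)

lemma b2_strict_mono:
  assumes "1 \<le> N" "0 < e" "e < e'" "e' < 1" shows "b2 N e < b2 N e'"
  unfolding b2_def
proof (rule frac_less)
  show "(1 - e') ^ 5 \<le> (1 - e) ^ 5" using assms by (intro power_mono) auto
qed (use assms in auto)

text \<open>The square of \<open>R_m\<close> is the positive root of 5 b1 s^2 + 3 b2 s = 1, the
  equation at which the derivative of b1 x^5 + b2 x^3 - x vanishes.\<close>

lemma R_m_critical:
  assumes "1 \<le> N" "0 < e" "e < 1"
  shows "0 < R_m N e" "5 * b1 N e * R_m N e ^ 4 + 3 * b2 N e * (R_m N e)\<^sup>2 = 1"
proof -
  define c d S where "c = b1 N e" and "d = b2 N e" and "S = sqrt (9 * d\<^sup>2 + 20 * c)"
  have c: "0 < c" and d: "0 < d" using b1_pos b2_pos assms by (auto simp: c_def d_def)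
  have S2: "S\<^sup>2 = 9 * d\<^sup>2 + 20 * c" unfolding S_def using c by simp
  have S: "3 * d < S" unfolding S_def using c by (intro real_less_rsqrt) (simp add: power_mult_distrib)
  have R: "R_m N e = sqrt ((S - 3 * d) / (10 * c))" by (simp add: R_m_def S_def c_def d_def)
  have q: "0 < (S - 3 * d) / (10 * c)" using S c by simp
  then show "0 < R_m N e" by (simp add: R)
  have R2: "(R_m N e)\<^sup>2 = (S - 3 * d) / (10 * c)" unfolding R using q by simp
  have R4: "R_m N e ^ 4 = ((S - 3 * d) / (10 * c))\<^sup>2"
    unfolding R2[symmetric] by simp
  have "5 * c * ((S - 3 * d) / (10 * c))\<^sup>2 + 3 * d * ((S - 3 * d) / (10 * c)) = (S\<^sup>2 - 9 * d\<^sup>2) / (20 * c)"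
    using c by (simp add: field_simps power2_eq_square)
  also have "\<dots> = 1" using c by (simp add: S2)
  finally show "5 * b1 N e * R_m N e ^ 4 + 3 * b2 N e * (R_m N e)\<^sup>2 = 1"
    unfolding R4 R2 c_def d_def .
qed

text \<open>The formulas for \<open>R_m\<close> and \<open>Q_m\<close> come from minimising \<open>b\<^sub>1 x\<^sup>5 + b\<^sub>2 x\<^sup>3 - x\<close> over
  \<open>x \<ge> 0\<close>; this is why \<open>Q_m\<close> is increasing in \<open>e\<close> and \<open>R_cal > r0\<close>.\<close>

lemma Q_m_eq:
  assumes "1 \<le> N" "0 < e" "e < 1"
  shows "Q_m N e = b1 N e * R_m N e ^ 5 + b2 N e * R_m N e ^ 3 - R_m N e"
proof -
  have "R_m N e = R_m N e * (5 * b1 N e * R_m N e ^ 4 + 3 * b2 N e * (R_m N e)\<^sup>2)"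
    using R_m_critical(2)[OF assms] by simp
  also have "\<dots> = 5 * b1 N e * R_m N e ^ 5 + 3 * b2 N e * R_m N e ^ 3"
    by (simp add: algebra_simps eval_nat_numeral)
  finally show ?thesis unfolding Q_m_def by (simp add: algebra_simps eval_nat_numeral)
qed

text \<open>By the critical equation, x - R may be replaced by (x - R)(5 b1 R^4 + 3 b2 R^2). The
  difference of the two values then becomes (x - R)^2 times a polynomial with positive
  coefficients.\<close>

lemma Q_m_le:
  assumes "1 \<le> N" "0 < e" "e < 1" "0 \<le> x"
  shows "Q_m N e \<le> b1 N e * x ^ 5 + b2 N e * x ^ 3 - x"
proof -
  define c d R where "c = b1 N e" and "d = b2 N e" and "R = R_m N e"
  have c: "0 < c" and d: "0 < d" using b1_pos b2_pos assms by (auto simp: c_def d_def)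
  have R: "0 < R" "5 * c * R ^ 4 + 3 * d * R\<^sup>2 = 1"
    using R_m_critical[OF assms(1-3)] by (auto simp: R_def c_def d_def)
  have "(c * x ^ 5 + d * x ^ 3 - x) - (c * R ^ 5 + d * R ^ 3 - R)
      = (c * x ^ 5 + d * x ^ 3) - (c * R ^ 5 + d * R ^ 3) - (x - R) * (5 * c * R ^ 4 + 3 * d * R\<^sup>2)"
    by (simp add: R(2))
  also have "\<dots> = (x - R)\<^sup>2 * (c * (x ^ 3 + 2 * R * x\<^sup>2 + 3 * R\<^sup>2 * x + 4 * R ^ 3) + d * (x + 2 * R))"
    by (simp add: algebra_simps eval_nat_numeral)
  also have "0 \<le> \<dots>" using c d R(1) assms(4) by (intro mult_nonneg_nonneg add_nonneg_nonneg) auto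
  finally show ?thesis unfolding Q_m_eq[OF assms(1-3)] c_def d_def R_def by simp
qed

text \<open>Test the polynomial of e at the minimiser belonging to e': its coefficients are smaller,
  so its minimum lies below.\<close>

lemma Q_m_strict_mono:
  assumes "1 \<le> N" "0 < e" "e < e'" "e' < 1"
  shows "Q_m N e < Q_m N e'"
proof -
  have e: "e < 1" "0 < e'" using assms by auto
  have R: "0 < R_m N e'" using R_m_critical[of N e'] assms by auto
  have "Q_m N e \<le> b1 N e * R_m N e' ^ 5 + b2 N e * R_m N e' ^ 3 - R_m N e'"
    using R assms by (intro Q_m_le) auto
  also have "\<dots> < b1 N e' * R_m N e' ^ 5 + b2 N e' * R_m N e' ^ 3 - R_m N e'"
    using R b1_strict_mono[OF assms] b2_strict_mono[OF assms]
    by (intro diff_strict_right_mono add_strict_mono mult_strict_right_mono) auto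
  also have "\<dots> = Q_m N e'" using assms e by (intro Q_m_eq[symmetric]) auto
  finally show ?thesis .
qed

lemma Q_m_bounds:
  assumes "1 \<le> N" "0 < e" "e < 1"
  shows "- R_m N e < Q_m N e"
proof -
  have "0 < b1 N e * R_m N e ^ 5 + b2 N e * R_m N e ^ 3"
    using R_m_critical(1)[OF assms] b1_pos[OF assms] b2_pos[OF assms] by (simp add: add_pos_pos)
  then show ?thesis unfolding Q_m_eq[OF assms] by simp
qed

text \<open>Intermediate values between a small e0 and 1/2. At 1/2 one has b1 \<ge> 1, so R_m < 1
  and Q_m > -1 \<ge> - \<rho>. Near 0 the polynomial tested at x = 2 \<rho> is close to - 2 \<rho>,
  which pushes its minimum below - \<rho>.\<close>

lemma E_star_exists:
  assumes N: "1 \<le> N" and "1 \<le> \<rho>"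
  shows "\<exists>e. 0 < e \<and> e < 1 \<and> Q_m N e = - \<rho>"
proof -
  have hi: "- \<rho> \<le> Q_m N (1/2)"
  proof -
    define R where "R = R_m N (1/2)"
    have R: "0 < R" "5 * b1 N (1/2) * R ^ 4 + 3 * b2 N (1/2) * R\<^sup>2 = 1"
      using R_m_critical[OF N, of "1/2"] by (auto simp: R_def)
    have "1 * 1 \<le> real N * pi" using N pi_gt3 by (intro mult_mono) auto
    then have "1 \<le> (real N * pi)\<^sup>2" by simp
    then have "1 \<le> b1 N (1/2)" by (simp add: b1_def power_divide)
    then have "1 * R ^ 4 \<le> b1 N (1/2) * R ^ 4" by (intro mult_right_mono) auto
    moreover have "0 < b2 N (1/2) * R\<^sup>2" "0 < R ^ 4" using b2_pos[OF N, of "1/2"] R(1) by auto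
    ultimately have "R ^ 4 < 1" using R(2) by linarith
    then have "R < 1" using R(1) by (meson not_less one_le_power)
    then show ?thesis using Q_m_bounds[OF N, of "1/2"] \<open>1 \<le> \<rho>\<close> by (simp add: R_def)
  qed
  \<comment> \<open>e0 has to be positive: at e = 0 division by zero makes \<open>R_m\<close> and
    \<open>Q_m\<close> equal to 0, so \<open>Q_m\<close> is discontinuous there.\<close>
  obtain e0 where e0: "0 < e0" "e0 < 1/2" "Q_m N e0 \<le> - \<rho>"
  proof -
    let ?f = "\<lambda>e. b1 N e * (2 * \<rho>) ^ 5 + b2 N e * (2 * \<rho>) ^ 3 - 2 * \<rho>"
    have "isCont ?f 0" unfolding b1_def b2_def by (intro continuous_intros) auto
    then have "(?f \<longlongrightarrow> ?f 0) (at_right 0)" unfolding isCont_def by (rule filterlim_at_split[THEN iffD1, THEN conjunct2])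
    moreover have "?f 0 < - \<rho>" using \<open>1 \<le> \<rho>\<close> by (simp add: b1_def b2_def)
    ultimately have "\<forall>\<^sub>F e in at_right 0. ?f e < - \<rho>" by (rule order_tendstoD(2))
    moreover have "\<forall>\<^sub>F e in at_right (0::real). e \<in> {0<..<1/2}" by (rule eventually_at_right_real) simp
    ultimately have "\<forall>\<^sub>F e in at_right 0. ?f e < - \<rho> \<and> e \<in> {0<..<1/2}" by (rule eventually_conj)
    then obtain e where e: "?f e < - \<rho>" "e \<in> {0<..<1/2}"
      using eventually_happens[of _ "at_right (0::real)"] trivial_limit_at_right_real by blast
    show ?thesis using Q_m_le[OF N, of e "2 * \<rho>"] e \<open>1 \<le> \<rho>\<close> by (intro that[of e]) auto
  qed
  have "continuous_on {e0..1/2} (Q_m N)"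
  proof -
    have "b1 N e \<noteq> 0" if "e \<in> {e0..1/2}" for e using b1_pos[OF N, of e] that e0 by auto
    moreover have "continuous_on {e0..1/2} (b1 N)" "continuous_on {e0..1/2} (b2 N)"
      unfolding b1_def b2_def by (auto intro!: continuous_intros)
    ultimately show ?thesis unfolding Q_m_def R_m_def by (intro continuous_intros) auto
  qed
  then have "\<exists>e\<ge>e0. e \<le> 1/2 \<and> Q_m N e = - \<rho>"
    using e0 hi by (intro IVT') auto
  then obtain e where "e0 \<le> e" "e \<le> 1/2" "Q_m N e = - \<rho>" by blast
  then show ?thesis using e0 by (intro exI[of _ e]) auto
qed

lemma E_star_props:
  assumes "1 \<le> N" "0 < xs"
  shows "0 < E_star N xs" "E_star N xs < 1" "Q_m N (E_star N xs) = - r0 N xs"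
proof -
  have "\<exists>!e. 0 < e \<and> e < 1 \<and> Q_m N e = - r0 N xs"
  proof (rule ex_ex1I)
    show "\<exists>e. 0 < e \<and> e < 1 \<and> Q_m N e = - r0 N xs"
      by (rule E_star_exists[OF assms(1) r0_ge_1[OF assms(2)]])
    fix e e' assume "0 < e \<and> e < 1 \<and> Q_m N e = - r0 N xs" "0 < e' \<and> e' < 1 \<and> Q_m N e' = - r0 N xs"
    then show "e = e'" using Q_m_strict_mono[OF assms(1), of e e'] Q_m_strict_mono[OF assms(1), of e' e]
      by (cases e e' rule: linorder_cases) auto
  qed
  from theI'[OF this] show "0 < E_star N xs" "E_star N xs < 1" "Q_m N (E_star N xs) = - r0 N xs"
    unfolding E_star_def by auto
qed

lemma r0_less_R_cal:
  assumes "1 \<le> N" "0 < xs"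
  shows "r0 N xs < R_cal N xs"
  using Q_m_bounds[OF assms(1) E_star_props(1,2)[OF assms]] E_star_props(3)[OF assms]
  by (simp add: R_cal_def)

text \<open>The interval length es is found only after the rate is fixed, yet the rate depends on
  es. It is smallest at es = 0, so a branch built for that value serves every es.\<close>

lemma gamma_const_mono:
  assumes "1 \<le> N" "0 < xs" "0 \<le> es" "es < 1"
  shows "gamma_const N p xs 0 \<le> gamma_const N p xs es"
proof -
  have "0 \<le> 3 * real N * pi * sigma_star N xs * (R_cal N xs)\<^sup>2"
    using E_star_props[OF assms(1,2)] by (simp add: sigma_star_def)
  then show ?thesis unfolding gamma_const_def
    by (intro add_left_mono divide_left_mono mult_pos_pos) (use assms in auto)
qed

text \<open>The left side is 12 times the bound for the Neumann inverse, compared term by term. The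
  part 24 \<rho>^3 L/\<beta> is at most M R because L \<sigma> R^2 \<ge> \<rho>^2, the denominator
  of M is at most \<beta>, and \<rho> < R. The part 24 \<rho>^2 L is strictly below 3 L \<sigma>
  R^2/2 because \<sigma> \<ge> 16.\<close>

lemma gamma_const_lower:
  assumes N: "1 \<le> N" and xs: "0 < xs" and nz: "dphi1_end N p \<noteq> 0"
  defines "L \<equiv> real N * pi" and "\<beta> \<equiv> \<bar>dphi1_end N p\<bar>" and "\<rho> \<equiv> r0 N xs"
  shows "12 * (2 * \<rho>\<^sup>2 * L * (\<rho> / \<beta> + 1)) < gamma_const N p xs 0"
proof -
  define E R \<sigma> \<Psi> where "E = E_star N xs" and "R = R_cal N xs" and "\<sigma> = sigma_star N xs" and "\<Psi> = Psi N xs"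
  have E: "0 < E" "E < 1" using E_star_props[OF N xs] by (auto simp: E_def)
  have \<rho>: "1 \<le> \<rho>" "\<rho> < R" using r0_ge_1[OF xs] r0_less_R_cal[OF N xs] by (auto simp: \<rho>_def R_def)
  have L: "1 \<le> L" unfolding L_def using mult_mono[of 1 "real N" 1 pi] N pi_gt3 by auto
  have \<beta>: "0 < \<beta>" using nz by (simp add: \<beta>_def)
  have p3: "0 < (1 - E) ^ 3" "(1 - E) ^ 3 \<le> 1" "0 < (1 - E) ^ 4" "(1 - E) ^ 4 \<le> 1"
    using E by (auto intro!: power_le_one)
  have \<sigma>: "16 \<le> \<sigma>" unfolding \<sigma>_def sigma_star_def E_def[symmetric] using p3 by (simp add: le_divide_eq)
  have \<Psi>: "0 < \<Psi>" unfolding \<Psi>_def Psi_def E_def[symmetric] R_def[symmetric] \<sigma>_def[symmetric]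
    using E \<sigma> \<rho> N by (intro divide_pos_pos mult_pos_pos zero_less_power add_pos_nonneg) auto
  define D where "D = \<beta> - \<Psi> * E_star_star N p xs"
  have "0 \<le> E_star_star N p xs" using E \<Psi> \<beta>
    by (auto simp: E_star_star_def E_hat_def E_def \<Psi>_def \<beta>_def)
  then have D1: "D \<le> \<beta>" using \<Psi> by (simp add: D_def)
  \<comment> \<open>The factor 2 in \<open>E_hat\<close> keeps the denominator of M at least
    \<beta>/2, hence positive.\<close>
  have "\<Psi> * E_star_star N p xs \<le> \<Psi> * (\<beta> / (2 * \<Psi>))"
    using \<Psi> by (intro mult_left_mono) (auto simp: E_star_star_def E_hat_def \<Psi>_def \<beta>_def)
  also have "\<dots> = \<beta> / 2" using \<Psi> by simp
  finally have D2: "0 < D" using \<beta> by (simp add: D_def)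
  have M: "M_const N p xs = 12 * L * (1 + 2 * L * \<sigma> * R\<^sup>2) / ((1 - E) ^ 4 * D)"
    by (simp add: M_const_def L_def \<sigma>_def R_def E_def D_def \<beta>_def \<Psi>_def mult.assoc)
  have "12 * L * (2 * \<rho>\<^sup>2) / \<beta> \<le> 12 * L * (1 + 2 * L * \<sigma> * R\<^sup>2) / ((1 - E) ^ 4 * D)"
  proof (rule frac_le)
    have "\<rho>\<^sup>2 \<le> R\<^sup>2" using \<rho> by (intro power_mono) auto
    moreover have "1 * 1 \<le> L * \<sigma>" using L \<sigma> by (intro mult_mono) auto
    ultimately have "1 * \<rho>\<^sup>2 \<le> (L * \<sigma>) * R\<^sup>2" by (intro mult_mono) auto
    then show "12 * L * (2 * \<rho>\<^sup>2) \<le> 12 * L * (1 + 2 * L * \<sigma> * R\<^sup>2)"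
      using L by (intro mult_left_mono) auto
    show "0 < (1 - E) ^ 4 * D" using p3 D2 by simp
    have "(1 - E) ^ 4 * D \<le> 1 * \<beta>" using p3 D1 D2 by (intro mult_mono) auto
    then show "(1 - E) ^ 4 * D \<le> \<beta>" by simp
    show "0 \<le> 12 * L * (1 + 2 * L * \<sigma> * R\<^sup>2)" using L \<sigma> by simp
  qed
  then have "12 * L * (2 * \<rho>\<^sup>2) / \<beta> * \<rho> \<le> M_const N p xs * R"
    unfolding M[symmetric] using \<rho> L \<beta> by (intro mult_mono) (auto intro: order_trans[rotated])
  moreover have "24 * L * \<rho>\<^sup>2 < 3 * L * \<sigma> * R\<^sup>2 / 2"
  proof -
    have "\<rho>\<^sup>2 < R\<^sup>2" using \<rho> by (intro power_strict_mono) auto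
    then have "16 * \<rho>\<^sup>2 < \<sigma> * R\<^sup>2" using \<sigma> by (intro mult_le_less_imp_less) auto
    then have "(3 * L / 2) * (16 * \<rho>\<^sup>2) < (3 * L / 2) * (\<sigma> * R\<^sup>2)" using L by (intro mult_strict_left_mono) auto
    then show ?thesis by (simp add: algebra_simps)
  qed
  moreover have "gamma_const N p xs 0 = M_const N p xs * R + 3 * L * \<sigma> * R\<^sup>2 / 2"
    by (simp add: gamma_const_def R_def L_def \<sigma>_def mult.assoc)
  moreover have "12 * (2 * \<rho>\<^sup>2 * L * (\<rho> / \<beta> + 1)) = 12 * L * (2 * \<rho>\<^sup>2) / \<beta> * \<rho> + 24 * L * \<rho>\<^sup>2"
    by (simp add: algebra_simps)
  ultimately show ?thesis by linarith
qed

section \<open>Fixed points depending holomorphically on a parameter\<close>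

text \<open>The third clause lets the holomorphic fixed point be read as a real function for real \<open>e\<close>.\<close>

definition holo_family :: "real \<Rightarrow> real \<Rightarrow> (real \<Rightarrow> complex \<Rightarrow> complex) \<Rightarrow> bool" where
  "holo_family L \<rho> w \<longleftrightarrow>
     continuous_on ({0..L} \<times> ball 0 \<rho>) (\<lambda>(t, e). w t e) \<and>
     (\<forall>t\<in>{0..L}. w t holomorphic_on ball 0 \<rho>) \<and>
     (\<forall>t\<in>{0..L}. \<forall>x. \<bar>x\<bar> < \<rho> \<longrightarrow> w t (of_real x) \<in> \<real>)"

lemma holo_familyD:
  assumes "holo_family L \<rho> w"
  shows "continuous_on ({0..L} \<times> ball 0 \<rho>) (\<lambda>p. w (fst p) (snd p))"
    and "t \<in> {0..L} \<Longrightarrow> w t holomorphic_on ball 0 \<rho>"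
    and "t \<in> {0..L} \<Longrightarrow> \<bar>x\<bar> < \<rho> \<Longrightarrow> w t (of_real x) \<in> \<real>"
  using assms by (auto simp: holo_family_def case_prod_unfold)

lemma holo_familyI:
  assumes "continuous_on ({0..L} \<times> ball 0 \<rho>) (\<lambda>p. w (fst p) (snd p))"
    and "\<And>t. t \<in> {0..L} \<Longrightarrow> w t holomorphic_on ball 0 \<rho>"
    and "\<And>t x. t \<in> {0..L} \<Longrightarrow> \<bar>x\<bar> < \<rho> \<Longrightarrow> w t (of_real x) \<in> \<real>"
  shows "holo_family L \<rho> w"
  using assms by (auto simp: holo_family_def case_prod_unfold)

lemma holo_family_mono:
  assumes "holo_family L \<rho> w" "\<rho>' \<le> \<rho>"
  shows "holo_family L \<rho>' w"
proof -
  have "ball (0::complex) \<rho>' \<subseteq> ball 0 \<rho>" using assms(2) by auto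
  then show ?thesis using holo_familyD[OF assms(1)] assms(2)
    by (intro holo_familyI) (auto intro: continuous_on_subset holomorphic_on_subset)
qed

lemma holo_family_slice:
  assumes "holo_family L \<rho> w" "e \<in> ball 0 \<rho>" "A \<subseteq> {0..L}"
  shows "continuous_on A (\<lambda>t. w t e)"
  by (rule continuous_on_compose2[OF holo_familyD(1)[OF assms(1)], of A "\<lambda>t. (t, e)", simplified])
    (use assms in \<open>auto intro!: continuous_intros\<close>)

lemma holo_family_const:
  assumes "continuous_on {0..L} f"
  shows "holo_family L \<rho> (\<lambda>t e. of_real (f t))"
proof (rule holo_familyI)
  show "continuous_on ({0..L} \<times> ball 0 \<rho>) (\<lambda>p. complex_of_real (f (fst p)))"
    by (intro continuous_intros continuous_on_compose2[OF assms]) auto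
qed auto

lemma holo_family_id: "holo_family L \<rho> (\<lambda>t e. e)"
  by (rule holo_familyI) (auto intro!: continuous_intros)

lemma holo_family_add:
  assumes "holo_family L \<rho> u" "holo_family L \<rho> w"
  shows "holo_family L \<rho> (\<lambda>t e. u t e + w t e)"
  using holo_familyD[OF assms(1)] holo_familyD[OF assms(2)]
  by (intro holo_familyI) (auto intro!: continuous_intros holomorphic_intros)

lemma holo_family_diff:
  assumes "holo_family L \<rho> u" "holo_family L \<rho> w"
  shows "holo_family L \<rho> (\<lambda>t e. u t e - w t e)"
  using holo_familyD[OF assms(1)] holo_familyD[OF assms(2)]
  by (intro holo_familyI) (auto intro!: continuous_intros holomorphic_intros)

lemma holo_family_mult:
  assumes "holo_family L \<rho> u" "holo_family L \<rho> w"
  shows "holo_family L \<rho> (\<lambda>t e. u t e * w t e)"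
  using holo_familyD[OF assms(1)] holo_familyD[OF assms(2)]
  by (intro holo_familyI) (auto intro!: continuous_intros holomorphic_intros)

lemma holo_family_compose:
  assumes "holo_family L \<rho> w" "g holomorphic_on S"
    and "\<And>t e. t \<in> {0..L} \<Longrightarrow> e \<in> ball 0 \<rho> \<Longrightarrow> w t e \<in> S"
    and "\<And>x. x \<in> S \<Longrightarrow> x \<in> \<real> \<Longrightarrow> g x \<in> \<real>"
  shows "holo_family L \<rho> (\<lambda>t e. g (w t e))"
proof (rule holo_familyI)
  show "continuous_on ({0..L} \<times> ball 0 \<rho>) (\<lambda>p. g (w (fst p) (snd p)))"
    by (rule continuous_on_compose2[OF holomorphic_on_imp_continuous_on[OF assms(2)] holo_familyD(1)[OF assms(1)]])
      (use assms(3) in auto)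
  show "(\<lambda>e. g (w t e)) holomorphic_on ball 0 \<rho>" if "t \<in> {0..L}" for t
  proof -
    have "w t ` ball 0 \<rho> \<subseteq> S" using assms(3)[OF that] by blast
    from holomorphic_on_compose_gen[OF holo_familyD(2)[OF assms(1) that] assms(2) this]
    show ?thesis by (simp add: o_def)
  qed
  show "g (w t (of_real x)) \<in> \<real>" if "t \<in> {0..L}" "\<bar>x\<bar> < \<rho>" for t x
    using that assms(3)[of t "of_real x"] assms(4) holo_familyD(3)[OF assms(1) that] by auto
qed

text \<open>Differentiation under the integral sign asks for a jointly continuous derivative. Near p
  the translates h \<mapsto> w s (x + h) converge uniformly on a fixed disc, and uniform limits of
  holomorphic functions carry their derivatives along.\<close>

lemma continuous_on_deriv_param:
  assumes w: "holo_family L \<rho> w"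
  shows "continuous_on (ball 0 \<rho> \<times> {0..L}) (\<lambda>(e, t). deriv (w t) e)"
  unfolding continuous_on_def
proof
  fix p assume p: "p \<in> ball (0::complex) \<rho> \<times> {0..L}"
  obtain e t where et: "p = (e, t)" by (cases p)
  with p have e: "e \<in> ball 0 \<rho>" and t: "t \<in> {0..L}" by auto
  let ?F = "at p within ball 0 \<rho> \<times> {0..L}"
  show "((\<lambda>(e, t). deriv (w t) e) \<longlongrightarrow> (case p of (e, t) \<Rightarrow> deriv (w t) e)) ?F"
  proof (cases "?F = bot")
    case False
    \<comment> \<open>Radius 2 d, because the base point moves by up to d and the shift h by another
      d.\<close>
    obtain d where d: "0 < d" "cball e (2 * d) \<subseteq> ball 0 \<rho>"
    proof -
      obtain d where "0 < d" "cball e d \<subseteq> ball 0 \<rho>"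
        using e open_contains_cball[of "ball (0::complex) \<rho>"] open_ball by blast
      then show ?thesis by (intro that[of "d / 2"]) auto
    qed
    let ?K = "{0..L} \<times> cball e (2 * d)"
    have "continuous_on ?K (\<lambda>p. w (fst p) (snd p))"
      by (rule continuous_on_subset[OF holo_familyD(1)[OF w]]) (use d in auto)
    then have uc: "uniformly_continuous_on ?K (\<lambda>p. w (fst p) (snd p))"
      by (intro compact_uniformly_continuous compact_Times) auto
    have near: "\<forall>\<^sub>F q in ?F. dist q p < c \<and> q \<in> ball 0 \<rho> \<times> {0..L}" if "0 < c" for c
      using that unfolding eventually_at by auto
    have inK: "snd q \<in> {0..L}" "fst q + h \<in> cball e (2 * d)"
      if "dist q p < d" "q \<in> ball 0 \<rho> \<times> {0..L}" "h \<in> ball 0 d" for q h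
    proof -
      have "dist (fst q) e < d" using that(1) dist_fst_le[of q p] by (simp add: et)
      then show "fst q + h \<in> cball e (2 * d)" 
        using that(3) norm_triangle_ineq[of "fst q - e" h] by (simp add: dist_norm norm_minus_commute algebra_simps)
      show "snd q \<in> {0..L}" using that(2) by auto
    qed
    have ul: "uniform_limit (ball 0 d) (\<lambda>q h. w (snd q) (fst q + h)) (\<lambda>h. w t (e + h)) ?F"
      unfolding uniform_limit_iff
    proof (intro allI impI)
      fix c :: real assume "0 < c"
      then obtain \<eta> where eta: "0 < \<eta>" "\<And>x y. x \<in> ?K \<Longrightarrow> y \<in> ?K \<Longrightarrow> dist y x < \<eta> \<Longrightarrow>
          dist (w (fst y) (snd y)) (w (fst x) (snd x)) < c"
        using uc unfolding uniformly_continuous_on_def by metis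
      have "\<forall>\<^sub>F q in ?F. dist q p < min d \<eta> \<and> q \<in> ball 0 \<rho> \<times> {0..L}"
        by (rule near) (use d eta in auto)
      then show "\<forall>\<^sub>F q in ?F. \<forall>h\<in>ball 0 d. dist (w (snd q) (fst q + h)) (w t (e + h)) < c"
      proof eventually_elim
        case (elim q)
        show ?case
        proof
          fix h :: complex assume h: "h \<in> ball 0 d"
          have "dist (snd q, fst q + h) (t, e + h) = sqrt ((dist (snd q) t)\<^sup>2 + (dist (fst q) e)\<^sup>2)"
            by (simp add: dist_Pair_Pair)
          also have "\<dots> = sqrt ((dist (fst q) e)\<^sup>2 + (dist (snd q) t)\<^sup>2)" by (simp only: add.commute)
          also have "\<dots> = dist q p" by (cases q) (simp add: et dist_Pair_Pair)
          finally have "dist (snd q, fst q + h) (t, e + h) = dist q p" .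
          moreover have "(snd q, fst q + h) \<in> ?K" "(t, e + h) \<in> ?K"
            using inK[of q h] inK[of p h] elim h p d by (auto simp: et)
          ultimately show "dist (w (snd q) (fst q + h)) (w t (e + h)) < c"
            using eta(2)[of "(t, e + h)" "(snd q, fst q + h)"] elim by simp
        qed
      qed
    qed
    have holo: "(\<lambda>h. w s (x + h)) holomorphic_on ball 0 d"
      if "s \<in> {0..L}" "\<And>h. h \<in> ball 0 d \<Longrightarrow> x + h \<in> ball 0 \<rho>" for s x
    proof -
      have "(\<lambda>h. x + h) holomorphic_on ball 0 d" by (intro holomorphic_intros)
      moreover have "(\<lambda>h. x + h) ` ball 0 d \<subseteq> ball 0 \<rho>" using that(2) by blast
      ultimately show ?thesis
        using holomorphic_on_compose_gen[OF _ holo_familyD(2)[OF w that(1)]] unfolding o_def by blast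
    qed
    have lim: "((\<lambda>q. (deriv ^^ 1) (\<lambda>h. w (snd q) (fst q + h)) 0) \<longlongrightarrow> (deriv ^^ 1) (\<lambda>h. w t (e + h)) 0) ?F"
    proof (rule higher_deriv_complex_uniform_limit[OF ul _ False])
      have "\<forall>\<^sub>F q in ?F. dist q p < d \<and> q \<in> ball 0 \<rho> \<times> {0..L}" by (rule near) (use d in auto)
      then show "\<forall>\<^sub>F q in ?F. (\<lambda>h. w (snd q) (fst q + h)) holomorphic_on ball 0 d"
      proof eventually_elim
        case (elim q)
        show ?case
        proof (rule holo)
          show "snd q \<in> {0..L}" using elim by auto
          show "fst q + h \<in> ball 0 \<rho>" if "h \<in> ball 0 d" for h
            using inK(2)[of q h] elim that d(2) by blast
        qed
      qed
    qed (use d in auto)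
    have dv: "deriv (\<lambda>h. w s (x + h)) 0 = deriv (w s) x" if "s \<in> {0..L}" "x \<in> ball 0 \<rho>" for s x
    proof -
      have "(w s has_field_derivative deriv (w s) x) (at (0 + x))"
        using holomorphic_derivI[OF holo_familyD(2)[OF w that(1)] _ that(2)] by simp
      then have "((\<lambda>h. w s (x + h)) has_field_derivative deriv (w s) x) (at 0)"
        unfolding DERIV_shift by (simp add: add.commute)
      then show ?thesis by (rule DERIV_imp_deriv)
    qed
    have ev: "\<forall>\<^sub>F q in ?F. (deriv ^^ 1) (\<lambda>h. w (snd q) (fst q + h)) 0 = (case q of (e, t) \<Rightarrow> deriv (w t) e)"
      using near[of 1, OF zero_less_one] by eventually_elim (auto simp: dv)
    have "(deriv ^^ 1) (\<lambda>h. w t (e + h)) 0 = (case p of (e, t) \<Rightarrow> deriv (w t) e)"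
      using dv[OF t e] by (simp add: et)
    with Lim_transform_eventually[OF lim ev] show ?thesis by (simp only:)
  qed simp
qed

text \<open>Rescaling moves the variable endpoint into the integrand, so that continuity in (t, e)
  follows from a parameter integral over the fixed interval [0, 1].\<close>

lemma integral_0_stretch:
  fixes g :: "real \<Rightarrow> complex"
  assumes "0 \<le> t"
  shows "integral {0..t} g = of_real t * integral {0..1} (\<lambda>s. g (t * s))"
proof (cases "t = 0")
  case False
  then have "0 < t" using assms by simp
  then have "(\<lambda>x. x / t) ` {0..t} = {0..1}"
    using image_divide_atLeastAtMost[of t 0 t] by simp
  with integral_stretch_real[OF False, of 0 t g] False assms show ?thesis by (simp add: scaleR_conv_of_real)
qed simp

lemma holo_family_integral:
  assumes w: "holo_family L \<rho> w"
  shows "holo_family L \<rho> (\<lambda>t e. integral {0..t} (\<lambda>s. w s e))"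
proof (rule holo_familyI)
  have "continuous_on (({0..L} \<times> ball 0 \<rho>) \<times> cbox 0 1) (\<lambda>(p, s). w (fst p * s) (snd p))"
    unfolding case_prod_unfold
  proof (rule continuous_on_compose2[OF holo_familyD(1)[OF w], of _ "\<lambda>x. (fst (fst x) * snd x, snd (fst x))", unfolded fst_conv snd_conv])
    show "(\<lambda>x. (fst (fst x) * snd x, snd (fst x))) ` (({0..L} \<times> ball 0 \<rho>) \<times> cbox 0 1) \<subseteq> {0..L} \<times> ball (0::complex) \<rho>"
      by (auto intro: order_trans[OF mult_left_le])
  qed (auto intro!: continuous_intros)
  then have "continuous_on ({0..L} \<times> ball 0 \<rho>) (\<lambda>p. integral (cbox 0 1) (\<lambda>s. w (fst p * s) (snd p)))"
    by (rule integral_continuous_on_param)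
  then have "continuous_on ({0..L} \<times> ball 0 \<rho>) (\<lambda>p. of_real (fst p) * integral (cbox 0 1) (\<lambda>s. w (fst p * s) (snd p)))"
    by (intro continuous_intros)
  then show "continuous_on ({0..L} \<times> ball 0 \<rho>) (\<lambda>p. integral {0..fst p} (\<lambda>s. w s (snd p)))"
  proof (rule continuous_on_eq)
    fix p assume "p \<in> {0..L} \<times> ball (0::complex) \<rho>"
    then have "0 \<le> fst p" by auto
    from integral_0_stretch[OF this, of "\<lambda>s. w s (snd p)"]
    show "of_real (fst p) * integral (cbox 0 1) (\<lambda>s. w (fst p * s) (snd p)) = integral {0..fst p} (\<lambda>s. w s (snd p))"
      unfolding cbox_interval by (rule sym)
  qed
  fix t assume t: "t \<in> {0..L}"
  then have sub: "{0..t} \<subseteq> {0..L}" by auto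
  have int: "(\<lambda>s. w s e) integrable_on {0..t}" if "e \<in> ball 0 \<rho>" for e
    by (intro integrable_continuous_real holo_family_slice[OF w that sub])
  have "(\<lambda>e. integral (cbox 0 t) (\<lambda>s. w s e)) holomorphic_on ball 0 \<rho>"
  proof (rule leibniz_rule_holomorphic)
    fix e :: complex and s assume e: "e \<in> ball 0 \<rho>" and "s \<in> cbox 0 t"
    then have "s \<in> {0..L}" using t by auto
    from holomorphic_derivI[OF holo_familyD(2)[OF w this] open_ball e]
    show "((\<lambda>e. w s e) has_field_derivative deriv (w s) e) (at e within ball 0 \<rho>)"
      by (rule has_field_derivative_at_within)
  next
    show "continuous_on (ball 0 \<rho> \<times> cbox 0 t) (\<lambda>(e, s). deriv (w s) e)"
      by (rule continuous_on_subset[OF continuous_on_deriv_param[OF w]]) (use t in auto)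
  qed (use int in auto)
  then show "(\<lambda>e. integral {0..t} (\<lambda>s. w s e)) holomorphic_on ball 0 \<rho>" by simp
  fix x assume x: "\<bar>x\<bar> < \<rho>"
  have "Im (integral {0..t} (\<lambda>s. w s (of_real x))) = integral {0..t} (\<lambda>s. Im (w s (of_real x)))"
    using integral_linear[OF int[of "of_real x"] bounded_linear_Im] x by (simp add: o_def)
  also have "\<dots> = integral {0..t} (\<lambda>s. 0)"
    by (rule integral_cong) (use holo_familyD(3)[OF w _ x] sub in \<open>auto simp: complex_is_Real_iff\<close>)
  finally show "integral {0..t} (\<lambda>s. w s (of_real x)) \<in> \<real>" by (simp add: complex_is_Real_iff)
qed

section \<open>The contraction principle in the holomorphic class\<close>

definition bounded_family :: "real \<Rightarrow> real \<Rightarrow> real \<Rightarrow> (real \<Rightarrow> complex \<Rightarrow> complex) \<Rightarrow> bool" where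
  "bounded_family L \<rho> \<delta> w \<longleftrightarrow>
     holo_family L \<rho> w \<and> (\<forall>t\<in>{0..L}. \<forall>e\<in>ball 0 \<rho>. cmod (w t e) \<le> \<delta>)"

text \<open>Banach iteration from the zero function, used for Kepler's equation and for the Neumann
  problem. The contraction hypothesis speaks of pointwise bounds c, which avoids suprema over the
  open disc. Uniform limits preserve continuity, holomorphy and reality.\<close>

lemma holo_family_fixed_point:
  fixes \<Phi> :: "(real \<Rightarrow> complex \<Rightarrow> complex) \<Rightarrow> real \<Rightarrow> complex \<Rightarrow> complex"
  assumes "0 \<le> \<delta>"
    and self: "\<And>w. bounded_family L \<rho> \<delta> w \<Longrightarrow> bounded_family L \<rho> \<delta> (\<Phi> w)"
    and contr: "\<And>u w c. bounded_family L \<rho> \<delta> u \<Longrightarrow> bounded_family L \<rho> \<delta> w \<Longrightarrow> 0 \<le> c \<Longrightarrow>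
      (\<And>t e. t \<in> {0..L} \<Longrightarrow> e \<in> ball 0 \<rho> \<Longrightarrow> cmod (u t e - w t e) \<le> c) \<Longrightarrow>
      (\<And>t e. t \<in> {0..L} \<Longrightarrow> e \<in> ball 0 \<rho> \<Longrightarrow> cmod (\<Phi> u t e - \<Phi> w t e) \<le> c / 2)"
  shows "\<exists>w. bounded_family L \<rho> \<delta> w \<and> (\<forall>t\<in>{0..L}. \<forall>e\<in>ball 0 \<rho>. \<Phi> w t e = w t e)"
proof -
  define ws where "ws n = (\<Phi> ^^ n) (\<lambda>_ _. 0)" for n
  have ws_Suc: "ws (Suc n) = \<Phi> (ws n)" for n by (simp add: ws_def)
  have adm: "bounded_family L \<rho> \<delta> (ws n)" for n
  proof (induction n)
    case 0
    have "holo_family L \<rho> (\<lambda>t e. of_real ((\<lambda>_. 0) t))" by (rule holo_family_const) auto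
    then show ?case using \<open>0 \<le> \<delta>\<close> by (simp add: bounded_family_def ws_def)
  qed (simp add: ws_Suc self)
  have step: "cmod (ws (Suc n) t e - ws n t e) \<le> \<delta> * (1/2) ^ n" if "t \<in> {0..L}" "e \<in> ball 0 \<rho>" for n t e
    using that
  proof (induction n arbitrary: t e)
    case 0
    then show ?case using adm[of 1] by (auto simp: bounded_family_def ws_def)
  next
    case (Suc n)
    have "cmod (\<Phi> (ws (Suc n)) t e - \<Phi> (ws n) t e) \<le> \<delta> * (1/2) ^ n / 2"
      by (rule contr[OF adm adm]) (use Suc \<open>0 \<le> \<delta>\<close> in auto)
    then show ?case by (simp add: ws_Suc)
  qed
  define w where "w t e = lim (\<lambda>n. ws n t e)" for t e
  have conv: "(\<lambda>n. ws n t e) \<longlonglongrightarrow> w t e" "cmod (ws n t e - w t e) \<le> 2 * \<delta> * (1/2) ^ n"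
    if te: "t \<in> {0..L}" "e \<in> ball 0 \<rho>" for t e n
    unfolding w_def using geometric_increments[of "\<lambda>n. ws n t e", OF step[OF te]] by auto
  have small: "(\<lambda>n. 2 * \<delta> * (1/2) ^ n) \<longlonglongrightarrow> 0"
    using tendsto_mult_right_zero[OF LIMSEQ_power_zero[of "1/2::real"], of "2 * \<delta>"] by simp
  have ul: "uniform_limit ({0..L} \<times> ball 0 \<rho>) (\<lambda>n p. ws n (fst p) (snd p)) (\<lambda>p. w (fst p) (snd p)) sequentially"
    unfolding uniform_limit_iff
  proof (intro allI impI)
    fix c :: real assume "0 < c"
    then have "\<forall>\<^sub>F n in sequentially. 2 * \<delta> * (1/2) ^ n < c" using order_tendstoD(2)[OF small] by auto
    then show "\<forall>\<^sub>F n in sequentially. \<forall>p\<in>{0..L} \<times> ball 0 \<rho>. dist (ws n (fst p) (snd p)) (w (fst p) (snd p)) < c"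
    proof eventually_elim
      case (elim n)
      show ?case
      proof
        fix p assume "p \<in> {0..L} \<times> ball (0::complex) \<rho>"
        then have "cmod (ws n (fst p) (snd p) - w (fst p) (snd p)) \<le> 2 * \<delta> * (1/2) ^ n"
          by (intro conv(2)) auto
        then show "dist (ws n (fst p) (snd p)) (w (fst p) (snd p)) < c" using elim by (simp add: dist_norm)
      qed
    qed
  qed
  have "bounded_family L \<rho> \<delta> w" unfolding bounded_family_def
  proof (intro conjI ballI holo_familyI)
    show "continuous_on ({0..L} \<times> ball 0 \<rho>) (\<lambda>p. w (fst p) (snd p))"
      by (rule uniform_limit_theorem[OF _ ul]) (use adm holo_familyD(1) in \<open>auto simp: bounded_family_def\<close>)
    fix t assume t: "t \<in> {0..L}"
    show "w t holomorphic_on ball 0 \<rho>"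
    proof (rule holomorphic_uniform_sequence[of "ball 0 \<rho>" "\<lambda>n. ws n t"])
      show "ws n t holomorphic_on ball 0 \<rho>" for n using adm holo_familyD(2)[OF _ t] by (auto simp: bounded_family_def)
      fix e :: complex assume e: "e \<in> ball 0 \<rho>"
      then obtain d where d: "0 < d" "cball e d \<subseteq> ball 0 \<rho>"
        using open_contains_cball[of "ball (0::complex) \<rho>"] open_ball by blast
      have "uniform_limit (cball e d) (\<lambda>n e. ws n t e) (\<lambda>e. w t e) sequentially"
        unfolding uniform_limit_iff
      proof (intro allI impI)
        fix c :: real assume "0 < c"
        from ul[unfolded uniform_limit_iff, rule_format, OF this]
        show "\<forall>\<^sub>F n in sequentially. \<forall>x\<in>cball e d. dist (ws n t x) (w t x) < c"
        proof eventually_elim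
          case (elim n)
          show ?case
          proof
            fix x assume "x \<in> cball e d"
            then show "dist (ws n t x) (w t x) < c" using bspec[OF elim, of "(t, x)"] t d(2) by auto
          qed
        qed
      qed
      then show "\<exists>d>0. cball e d \<subseteq> ball 0 \<rho> \<and> uniform_limit (cball e d) (\<lambda>n. ws n t) (w t) sequentially"
        using d by blast
    qed auto
    fix x :: real assume x: "\<bar>x\<bar> < \<rho>"
    show "w t (of_real x) \<in> \<real>"
    proof (rule Lim_in_closed_set[OF closed_complex_Reals])
      show "(\<lambda>n. ws n t (of_real x)) \<longlonglongrightarrow> w t (of_real x)" by (rule conv(1)[OF t]) (use x in auto)
      show "\<forall>\<^sub>F n in sequentially. ws n t (of_real x) \<in> \<real>"
        using adm holo_familyD(3)[OF _ t x] by (auto simp: bounded_family_def)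
    qed auto
  next
    fix t e assume te: "t \<in> {0..L}" "e \<in> ball (0::complex) \<rho>"
    show "cmod (w t e) \<le> \<delta>"
    proof (rule Lim_bounded)
      show "(\<lambda>n. cmod (ws n t e)) \<longlonglongrightarrow> cmod (w t e)" by (intro tendsto_intros conv te)
    qed (use adm te in \<open>auto simp: bounded_family_def\<close>)
  qed
  moreover have "\<Phi> w t e = w t e" if te: "t \<in> {0..L}" "e \<in> ball 0 \<rho>" for t e
  proof (rule LIMSEQ_unique)
    show "(\<lambda>n. ws (Suc n) t e) \<longlonglongrightarrow> w t e" by (rule LIMSEQ_Suc[OF conv(1)[OF te]])
    show "(\<lambda>n. ws (Suc n) t e) \<longlonglongrightarrow> \<Phi> w t e"
    proof (rule LIM_zero_cancel, rule Lim_null_comparison[OF _ tendsto_mult_right_zero[OF small, of "1/2"]])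
      have "cmod (\<Phi> (ws n) t e - \<Phi> w t e) \<le> 2 * \<delta> * (1/2) ^ n / 2" for n
        by (rule contr[OF adm \<open>bounded_family L \<rho> \<delta> w\<close> _ _ te]) (use conv(2) \<open>0 \<le> \<delta>\<close> in auto)
      then show "\<forall>\<^sub>F n in sequentially. cmod (ws (Suc n) t e - \<Phi> w t e) \<le> 1 / 2 * (2 * \<delta> * (1/2) ^ n)"
        by (simp add: ws_Suc)
    qed
  qed
  ultimately show ?thesis by blast
qed

text \<open>Differentiation along the real axis commutes with real parts, so the complex derivatives
  supply the whole tower D. As h is holomorphic around 0, the one-sided derivative there is no
  special case.\<close>

lemma smooth_real_part:
  assumes h: "h holomorphic_on ball 0 \<rho>" and "0 < es" "es \<le> \<rho>"
  defines "D \<equiv> \<lambda>k x. Re ((deriv ^^ k) h (of_real x))"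
  shows "\<forall>k. \<forall>x\<in>{0..<es}. (D k has_real_derivative D (Suc k) x) (at x within {0..<es})"
proof (intro allI ballI)
  fix k x assume "x \<in> {0..<es}"
  then have x: "complex_of_real x \<in> ball 0 \<rho>" using assms by auto
  have "((deriv ^^ k) h has_field_derivative deriv ((deriv ^^ k) h) (of_real x)) (at (of_real x))"
    by (rule holomorphic_derivI[OF holomorphic_higher_deriv[OF h open_ball] open_ball x])
  then have "((\<lambda>x. (deriv ^^ k) h (of_real x)) has_vector_derivative (deriv ^^ Suc k) h (of_real x)) (at x within {0..<es})"
    using has_vector_derivative_real_field by fastforce
  from bounded_linear.has_vector_derivative[OF bounded_linear_Re this]
  show "(D k has_real_derivative D (Suc k) x) (at x within {0..<es})"
    by (simp add: D_def has_real_derivative_iff_has_vector_derivative)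
qed

section \<open>Complexification of the force\<close>

lemma norm_cos_strip:
  assumes "\<bar>Im z\<bar> \<le> 1" shows "cmod (cos z) \<le> 3"
proof -
  have e: "cmod (exp (\<i> * z)) \<le> 3" "cmod (exp (- (\<i> * z))) \<le> 3"
  proof -
    have "exp (- Im z) \<le> exp 1" "exp (Im z) \<le> exp 1" using assms by auto
    then have "exp (- Im z) \<le> 3" "exp (Im z) \<le> 3" using exp_le by linarith+
    then show "cmod (exp (\<i> * z)) \<le> 3" "cmod (exp (- (\<i> * z))) \<le> 3"
      by (simp_all add: norm_exp_eq_Re)
  qed
  have "cmod (cos z) = cmod (exp (\<i> * z) + exp (- (\<i> * z))) / 2"
    by (simp add: cos_exp_eq norm_divide)
  also have "\<dots> \<le> (3 + 3) / 2" using norm_triangle_le[OF add_mono[OF e]] by simp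
  finally show ?thesis by simp
qed

lemma norm_sin_diff_strip:
  assumes "\<bar>Im a\<bar> \<le> 1" "\<bar>Im b\<bar> \<le> 1" shows "cmod (sin a - sin b) \<le> 3 * cmod (a - b)"
proof (rule field_differentiable_bound[where S="Im -` {-1..1}" and f'=cos])
  show "convex (Im -` {-1..1})"
    by (intro convex_linear_vimage bounded_linear.linear[OF bounded_linear_Im]) auto
  show "(sin has_field_derivative cos z) (at z within Im -` {- 1..1})" for z :: complex
    by (auto intro!: derivative_eq_intros)
qed (use assms norm_cos_strip in auto)

lemma norm_sin_strip:
  assumes "cmod w \<le> 1" shows "cmod (sin (of_real t + w)) \<le> 4"
proof -
  have "\<bar>Im w\<bar> \<le> 1" using abs_Im_le_cmod[of w] assms by simp
  then have "cmod (sin (of_real t + w) - sin (of_real t)) \<le> 3 * cmod w"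
    using norm_sin_diff_strip[of "of_real t + w" "of_real t"] by simp
  moreover have "cmod (sin (of_real t)) \<le> 1" by (simp add: sin_of_real)
  ultimately show ?thesis
    using norm_triangle_sub[of "sin (of_real t + w)" "sin (of_real t)"] assms by simp
qed

text \<open>The unknown is w = u - t, which stays bounded. For |w| \<le> 1 the sine is at most 4 in
  modulus and has Lipschitz constant 3, so with |e| < 1/8 the map e sin(t + w) has size at most 1/2
  and contracts by 3/8.\<close>

lemma complex_kepler:
  "\<exists>w. bounded_family L (1/8) 1 w \<and>
     (\<forall>t\<in>{0..L}. \<forall>e\<in>ball 0 (1/8). e * sin (of_real t + w t e) = w t e)"
proof (rule holo_family_fixed_point)
  fix w assume w: "bounded_family L (1/8) 1 w"
  then have wf: "holo_family L (1/8) w" and wb: "\<And>t e. t \<in> {0..L} \<Longrightarrow> e \<in> ball 0 (1/8) \<Longrightarrow> cmod (w t e) \<le> 1"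
    by (auto simp: bounded_family_def)
  have "holo_family L (1/8) (\<lambda>t e. of_real t + w t e)"
    by (intro holo_family_add holo_family_const wf continuous_intros)
  then have "holo_family L (1/8) (\<lambda>t e. sin (of_real t + w t e))"
    by (rule holo_family_compose[where S=UNIV])
      (auto intro!: holomorphic_intros elim!: Reals_cases simp: sin_of_real)
  then have "holo_family L (1/8) (\<lambda>t e. e * sin (of_real t + w t e))"
    by (intro holo_family_mult holo_family_id)
  moreover have "cmod (e * sin (of_real t + w t e)) \<le> 1" if "t \<in> {0..L}" "e \<in> ball 0 (1/8)" for t e
  proof -
    have "cmod e * cmod (sin (of_real t + w t e)) \<le> (1/8) * 4"
      using that wb norm_sin_strip by (intro mult_mono) auto
    then show ?thesis by (simp add: norm_mult)
  qed
  ultimately show "bounded_family L (1/8) 1 (\<lambda>t e. e * sin (of_real t + w t e))"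
    by (auto simp: bounded_family_def)
next
  fix u w c t and e :: complex
  assume u: "bounded_family L (1/8) 1 u" and w: "bounded_family L (1/8) 1 w" and "0 \<le> c"
    and d: "\<And>t e. t \<in> {0..L} \<Longrightarrow> e \<in> ball 0 (1/8) \<Longrightarrow> cmod (u t e - w t e) \<le> c"
    and te: "t \<in> {0..L}" "e \<in> ball 0 (1/8)"
  have i: "\<bar>Im (u t e)\<bar> \<le> 1" "\<bar>Im (w t e)\<bar> \<le> 1"
    using u w te abs_Im_le_cmod order_trans unfolding bounded_family_def by blast+
  have "cmod (e * sin (of_real t + u t e) - e * sin (of_real t + w t e))
      = cmod e * cmod (sin (of_real t + u t e) - sin (of_real t + w t e))"
    by (simp add: norm_mult[symmetric] algebra_simps)
  also have "\<dots> \<le> (1/8) * (3 * cmod (u t e - w t e))"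
    using te norm_sin_diff_strip[of "of_real t + u t e" "of_real t + w t e"] i by (intro mult_mono) auto
  also have "\<dots> \<le> c / 2" using d[OF te] \<open>0 \<le> c\<close> by simp
  finally show "cmod (e * sin (of_real t + u t e) - e * sin (of_real t + w t e)) \<le> c / 2" .
qed simp

lemma complex_r:
  obtains R where "holo_family L (1/8) R"
    "\<And>t e. t \<in> {0..L} \<Longrightarrow> e \<in> ball 0 (1/8) \<Longrightarrow> cmod (R t e - 1/2) \<le> 3/2 * cmod e"
    "\<And>t x. t \<in> {0..L} \<Longrightarrow> 0 \<le> x \<Longrightarrow> x < 1/8 \<Longrightarrow> R t (of_real x) = of_real (r t x)"
proof -
  obtain w where w: "bounded_family L (1/8) 1 w"
    "\<And>t e. t \<in> {0..L} \<Longrightarrow> e \<in> ball 0 (1/8) \<Longrightarrow> e * sin (of_real t + w t e) = w t e"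
    using complex_kepler[of L] by blast
  then have wf: "holo_family L (1/8) w" and wb: "\<And>t e. t \<in> {0..L} \<Longrightarrow> e \<in> ball 0 (1/8) \<Longrightarrow> cmod (w t e) \<le> 1"
    by (auto simp: bounded_family_def)
  define R where "R t e = of_real (1/2) * (of_real 1 - e * cos (of_real t + w t e))" for t e
  show ?thesis
  proof (rule that[of R])
    have "holo_family L (1/8) (\<lambda>t e. of_real t + w t e)"
      by (intro holo_family_add holo_family_const wf continuous_intros)
    then have "holo_family L (1/8) (\<lambda>t e. cos (of_real t + w t e))"
      by (rule holo_family_compose[where S=UNIV])
        (auto intro!: holomorphic_intros elim!: Reals_cases simp: cos_of_real)
    then show "holo_family L (1/8) R" unfolding R_def
      by (intro holo_family_mult holo_family_diff holo_family_const holo_family_id continuous_intros)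
  next
    fix t e assume te: "t \<in> {0..L}" "e \<in> ball (0::complex) (1/8)"
    have "\<bar>Im (of_real t + w t e)\<bar> \<le> 1" using abs_Im_le_cmod[of "w t e"] wb[OF te] by simp
    then have "cmod (cos (of_real t + w t e)) \<le> 3" by (rule norm_cos_strip)
    then have "cmod e * cmod (cos (of_real t + w t e)) \<le> cmod e * 3" by (intro mult_left_mono) auto
    moreover have "R t e - 1/2 = - (e * cos (of_real t + w t e)) / 2" by (simp add: R_def field_simps)
    ultimately show "cmod (R t e - 1/2) \<le> 3/2 * cmod e" by (simp add: norm_divide norm_mult)
  next
    fix t x :: real assume t: "t \<in> {0..L}" and x: "0 \<le> x" "x < 1/8"
    have xb: "complex_of_real x \<in> ball 0 (1/8)" using x by simp
    have "w t (of_real x) \<in> \<real>" by (rule holo_familyD(3)[OF wf t]) (use x in simp)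
    then obtain k where k: "w t (of_real x) = of_real k" by (auto elim: Reals_cases)
    have "of_real x * sin (of_real t + of_real k) = (of_real k :: complex)" using w(2)[OF t xb] k by simp
    then have "complex_of_real (x * sin (t + k)) = of_real k" by (simp add: sin_of_real[symmetric])
    then have "x * sin (t + k) = k" by (simp only: of_real_eq_iff)
    then have "kepler_u t x = t + k" using x by (intro kepler_u_eq) auto
    then show "R t (of_real x) = of_real (r t x)"
      by (simp add: R_def k r_def cos_of_real[symmetric])
  qed
qed

text \<open>The power 3/2 is split as q * csqrt q: the principal root is holomorphic for Re q > 0
  and agrees with the real root on positive q.\<close>

definition cforce :: "complex \<Rightarrow> complex \<Rightarrow> complex" where
  "cforce z \<rho> = - z * inverse ((z * z + \<rho> * \<rho>) * csqrt (z * z + \<rho> * \<rho>))"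

definition cforce_dz :: "complex \<Rightarrow> complex \<Rightarrow> complex" where
  "cforce_dz z \<rho> = - (\<rho> * \<rho> - 2 * (z * z)) * inverse ((z * z + \<rho> * \<rho>)\<^sup>2 * csqrt (z * z + \<rho> * \<rho>))"

text \<open>Re \<rho> \<ge> 3/8 contributes at least 9/64, and the two imaginary parts take away at
  most 1/64 each. Re z is unrestricted, so whole real orbits fit into the domain.\<close>

lemma Re_pos_domain:
  assumes "\<bar>Im z\<bar> \<le> 1/8" "cmod (\<rho> - 1/2) \<le> 1/8"
  shows "0 < Re (z * z + \<rho> * \<rho>)"
proof -
  have r: "\<bar>Re \<rho> - 1/2\<bar> \<le> 1/8" "\<bar>Im \<rho>\<bar> \<le> 1/8"
    using abs_Re_le_cmod[of "\<rho> - 1/2"] abs_Im_le_cmod[of "\<rho> - 1/2"] assms(2) by auto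
  have "(Im z)\<^sup>2 \<le> (1/8)\<^sup>2" "(Im \<rho>)\<^sup>2 \<le> (1/8)\<^sup>2"
    using assms(1) r(2) by (simp_all add: abs_le_square_iff[symmetric])
  then have "(Im z)\<^sup>2 \<le> 1/64" "(Im \<rho>)\<^sup>2 \<le> 1/64" by (simp_all add: power_divide)
  moreover have "3/8 \<le> Re \<rho>" using abs_le_D2[OF r(1)] by simp
  then have "(3/8)\<^sup>2 \<le> (Re \<rho>)\<^sup>2" by (intro power_mono) auto
  then have "9/64 \<le> (Re \<rho>)\<^sup>2" by (simp add: power_divide)
  moreover have "Re (z * z + \<rho> * \<rho>) = (Re z)\<^sup>2 - (Im z)\<^sup>2 + (Re \<rho>)\<^sup>2 - (Im \<rho>)\<^sup>2"
    by (simp add: power2_eq_square)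
  ultimately show ?thesis using zero_le_power2[of "Re z"] by linarith
qed

lemma Re_pos_facts:
  assumes "0 < Re q" shows "q \<noteq> 0" "q \<notin> \<real>\<^sub>\<le>\<^sub>0"
  using assms by (auto simp: complex_nonpos_Reals_iff)

lemma cforce_of_real:
  assumes "0 < \<rho>"
  shows "cforce (of_real y) (of_real \<rho>) = of_real (sit_force y \<rho>)"
    and "cforce_dz (of_real y) (of_real \<rho>) = of_real (sit_dz y \<rho>)"
proof -
  define q where "q = y\<^sup>2 + \<rho>\<^sup>2"
  have q: "0 < q" unfolding q_def using assms by (simp add: add_nonneg_pos)
  have c: "complex_of_real y * complex_of_real y + complex_of_real \<rho> * complex_of_real \<rho> = of_real q"
    by (simp add: q_def power2_eq_square)
  have s: "csqrt (of_real q) = of_real (sqrt q)" using q by simp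
  show "cforce (of_real y) (of_real \<rho>) = of_real (sit_force y \<rho>)"
    unfolding cforce_def c s sit_force_def q_def[symmetric] powr_3_2[OF less_imp_le[OF q]]
    by (simp add: field_simps)
  show "cforce_dz (of_real y) (of_real \<rho>) = of_real (sit_dz y \<rho>)"
    unfolding cforce_dz_def c s sit_dz_def q_def[symmetric] powr_5_2[OF less_imp_le[OF q]]
    by (simp add: field_simps power2_eq_square)
qed

lemma cforce_deriv:
  assumes "0 < Re (z * z + \<rho> * \<rho>)"
  shows "((\<lambda>z. cforce z \<rho>) has_field_derivative cforce_dz z \<rho>) (at z)"
proof -
  define q S where "q = z * z + \<rho> * \<rho>" and "S = csqrt q"
  have q: "q \<noteq> 0" "q \<notin> \<real>\<^sub>\<le>\<^sub>0" using Re_pos_facts[OF assms] by (auto simp: q_def)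
  have S: "S \<noteq> 0" "S * S = q" using q by (auto simp: S_def power2_eq_square[symmetric])
  have dq: "((\<lambda>z. z * z + \<rho> * \<rho>) has_field_derivative 2 * z) (at z)"
    by (auto intro!: derivative_eq_intros)
  have dS: "((\<lambda>z. csqrt (z * z + \<rho> * \<rho>)) has_field_derivative 2 * z / (2 * S)) (at z)"
    using has_field_derivative_csqrt'[OF dq] q unfolding q_def S_def by auto
  have dqS: "((\<lambda>z. (z * z + \<rho> * \<rho>) * csqrt (z * z + \<rho> * \<rho>)) has_field_derivative
      2 * z * S + 2 * z / (2 * S) * q) (at z)"
    using DERIV_mult[OF dq dS] by (simp add: q_def S_def)
  have "2 * z * S + 2 * z / (2 * S) * q = 3 * z * S" unfolding S(2)[symmetric] using S(1) by simp
  note dqS = dqS[unfolded this]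
  have "((\<lambda>z. - z / ((z * z + \<rho> * \<rho>) * csqrt (z * z + \<rho> * \<rho>))) has_field_derivative
      (- 1 * (q * S) - - z * (3 * z * S)) / ((q * S) * (q * S))) (at z)"
  proof -
    have nz: "(z * z + \<rho> * \<rho>) * csqrt (z * z + \<rho> * \<rho>) \<noteq> 0" using q S(1) by (simp add: q_def S_def)
    show ?thesis using DERIV_divide[OF DERIV_minus[OF DERIV_ident] dqS nz] unfolding q_def S_def .
  qed
  moreover have "(- 1 * (q * S) - - z * (3 * z * S)) / ((q * S) * (q * S)) = (3 * (z * z) - q) / (q\<^sup>2 * S)"
    using q S(1) by (simp add: field_simps power2_eq_square)
  moreover have "(3 * (z * z) - q) / (q\<^sup>2 * S) = cforce_dz z \<rho>"
    unfolding cforce_dz_def q_def[symmetric] S_def[symmetric] by (simp add: q_def divide_inverse)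
  moreover have "(\<lambda>z. cforce z \<rho>) = (\<lambda>z. - z / ((z * z + \<rho> * \<rho>) * csqrt (z * z + \<rho> * \<rho>)))"
    by (simp add: cforce_def divide_inverse fun_eq_iff)
  ultimately show ?thesis by simp
qed

text \<open>Compact, so that the force and its derivative are uniformly continuous; the size 1/8
  keeps the square root off its branch cut.\<close>

definition strip :: "real \<Rightarrow> (complex \<times> complex) set" where
  "strip X = cbox (Complex (- X) (- 1/8)) (Complex X (1/8)) \<times> cball (1/2) (1/8)"

lemma strip_pos: "p \<in> strip X \<Longrightarrow> 0 < Re (fst p * fst p + snd p * snd p)"
  by (rule Re_pos_domain) (auto simp: strip_def in_cbox_complex_iff dist_norm norm_minus_commute)

lemma uniformly_continuous_strip:
  "uniformly_continuous_on (strip X) (\<lambda>p. cforce (fst p) (snd p))"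
  "uniformly_continuous_on (strip X) (\<lambda>p. cforce_dz (fst p) (snd p))"
proof -
  let ?q = "\<lambda>p::complex \<times> complex. fst p * fst p + snd p * snd p"
  have cq: "continuous_on (strip X) ?q" by (intro continuous_intros)
  have "continuous_on (strip X) (\<lambda>p. csqrt (?q p))"
    by (rule continuous_on_compose2[OF continuous_on_csqrt cq]) (use strip_pos Re_pos_facts in blast)
  moreover have "?q p \<noteq> 0" "csqrt (?q p) \<noteq> 0" if "p \<in> strip X" for p
    using Re_pos_facts(1)[OF strip_pos[OF that]] by auto
  ultimately have "continuous_on (strip X) (\<lambda>p. cforce (fst p) (snd p))"
    "continuous_on (strip X) (\<lambda>p. cforce_dz (fst p) (snd p))"
    unfolding cforce_def cforce_dz_def by (auto intro!: continuous_intros)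
  moreover have "compact (strip X)" unfolding strip_def by (intro compact_Times) auto
  ultimately show "uniformly_continuous_on (strip X) (\<lambda>p. cforce (fst p) (snd p))"
    "uniformly_continuous_on (strip X) (\<lambda>p. cforce_dz (fst p) (snd p))"
    by (auto intro: compact_uniformly_continuous)
qed

text \<open>The force at radius \<rho> minus the first-order expansion in w of the force at radius
  1/2. It collects both errors: the nonlinearity in w, and the change of radius, which is all that
  remains at w = 0.\<close>

definition remainder :: "real \<Rightarrow> complex \<Rightarrow> complex \<Rightarrow> complex" where
  "remainder x w \<rho> = cforce (of_real x + w) \<rho> - of_real (sit_force x (1/2)) - of_real (sit_dz x (1/2)) * w"

lemma in_strip:
  assumes "\<bar>x\<bar> \<le> X" "cmod w \<le> \<delta>" "cmod (\<rho> - 1/2) \<le> \<delta>" "\<delta> \<le> 1/8"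
  shows "(of_real x + w, \<rho>) \<in> strip (X + 1)"
proof -
  have "\<bar>Re w\<bar> \<le> 1/8" "\<bar>Im w\<bar> \<le> 1/8" using abs_Re_le_cmod[of w] abs_Im_le_cmod[of w] assms by auto
  then show ?thesis using assms
    by (auto simp: strip_def in_cbox_complex_iff dist_norm norm_minus_commute abs_le_iff)
qed

text \<open>The derivative in w is \<open>cforce_dz\<close> at (x + w, \<rho>) minus its value at
  (x, 1/2), hence small near w = 0 and \<rho> = 1/2, uniformly for |x| \<le> X. The mean value
  inequality on a disc does the rest.\<close>

lemma remainder_lipschitz:
  assumes "0 < \<epsilon>"
  obtains \<delta> where "0 < \<delta>" "\<delta> \<le> 1/8"
    "\<And>x u w \<rho>. \<bar>x\<bar> \<le> X \<Longrightarrow> cmod u \<le> \<delta> \<Longrightarrow> cmod w \<le> \<delta> \<Longrightarrow> cmod (\<rho> - 1/2) \<le> \<delta> \<Longrightarrow>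
      cmod (remainder x u \<rho> - remainder x w \<rho>) \<le> \<epsilon> * cmod (u - w)"
proof -
  obtain d where d: "0 < d" "\<And>p q. p \<in> strip (X + 1) \<Longrightarrow> q \<in> strip (X + 1) \<Longrightarrow> dist q p < d \<Longrightarrow>
      dist (cforce_dz (fst q) (snd q)) (cforce_dz (fst p) (snd p)) < \<epsilon>"
    using uniformly_continuous_strip(2)[of "X + 1"] assms unfolding uniformly_continuous_on_def by metis
  define \<delta> where "\<delta> = min (1/8) (d / 4)"
  have \<delta>: "0 < \<delta>" "\<delta> \<le> 1/8" "2 * \<delta> < d" using d(1) by (auto simp: \<delta>_def)
  show ?thesis
  proof (rule that[OF \<delta>(1,2)])
    fix x :: real and u w \<rho> :: complex
    assume A: "\<bar>x\<bar> \<le> X" "cmod u \<le> \<delta>" "cmod w \<le> \<delta>" "cmod (\<rho> - 1/2) \<le> \<delta>"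
    show "cmod (remainder x u \<rho> - remainder x w \<rho>) \<le> \<epsilon> * cmod (u - w)"
    proof (rule field_differentiable_bound[where S="cball 0 \<delta>" and
          f'="\<lambda>w. cforce_dz (of_real x + w) \<rho> - of_real (sit_dz x (1/2))"])
      fix h assume h: "h \<in> cball (0::complex) \<delta>"
      have mem: "(of_real x + h, \<rho>) \<in> strip (X + 1)"
        by (rule in_strip[of _ _ _ \<delta>]) (use A h \<delta> in auto)
      have mem0: "(of_real x + 0, 1/2) \<in> strip (X + 1)"
        by (rule in_strip[of _ _ _ \<delta>]) (use A h \<delta> in \<open>simp_all\<close>)
      have "((\<lambda>z. cforce z \<rho>) has_field_derivative cforce_dz (of_real x + h) \<rho>) (at (of_real x + h))"
        by (rule cforce_deriv) (use strip_pos[OF mem] in simp)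
      then have "((\<lambda>h. cforce (of_real x + h) \<rho>) has_field_derivative cforce_dz (of_real x + h) \<rho> * 1) (at h within cball 0 \<delta>)"
        by (rule DERIV_chain2) (auto intro!: derivative_eq_intros)
      then show "((\<lambda>w. remainder x w \<rho>) has_field_derivative cforce_dz (of_real x + h) \<rho> - of_real (sit_dz x (1/2))) (at h within cball 0 \<delta>)"
        unfolding remainder_def by (auto intro!: derivative_eq_intros)
      have "dist (of_real x + h, \<rho>) (of_real x + 0, 1/2) \<le> cmod h + cmod (\<rho> - 1/2)"
        unfolding dist_Pair_Pair by (rule order_trans[OF sqrt_sum_squares_le_sum]) (auto simp: dist_norm)
      then have "dist (of_real x + h, \<rho>) (of_real x + 0, 1/2) < d" using h A \<delta> by simp
      from d(2)[OF mem0 mem this]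
      show "cmod (cforce_dz (of_real x + h) \<rho> - of_real (sit_dz x (1/2))) \<le> \<epsilon>"
        using cforce_of_real(2)[of "1/2" x] by (simp add: dist_norm)
    qed (use A in auto)
  qed
qed

section \<open>The Neumann problem for the linearised equation\<close>

locale green =
  fixes f1 f2 v1 v2 a :: "real \<Rightarrow> real" and L B :: real
  assumes ode: "ode2 (\<lambda>t y. - a t * y) f1 v1" "ode2 (\<lambda>t y. - a t * y) f2 v2"
    and init: "f1 0 = 1" "v1 0 = 0" "f2 0 = 0" "v2 0 = 1"
    and L: "0 < L" and nondeg: "v1 L \<noteq> 0"
    and bound: "\<And>t. t \<in> {0..L} \<Longrightarrow> \<bar>f1 t\<bar> \<le> B" "\<And>t. t \<in> {0..L} \<Longrightarrow> \<bar>f2 t\<bar> \<le> B"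
      "\<And>t. t \<in> {0..L} \<Longrightarrow> \<bar>v1 t\<bar> \<le> B" "\<And>t. t \<in> {0..L} \<Longrightarrow> \<bar>v2 t\<bar> \<le> B"
begin

text \<open>\<open>bvp g\<close> is the solution of \<open>y'' + a y = g\<close> with \<open>y' = 0\<close> at \<open>0\<close> and at \<open>L\<close>, by variation of
  parameters; \<open>bvp_norm\<close> bounds its sup norm.\<close>

definition bvp_const :: "(real \<Rightarrow> 'a::euclidean_space) \<Rightarrow> 'a" where
  "bvp_const g = (1 / v1 L) *\<^sub>R (v1 L *\<^sub>R integral {0..L} (\<lambda>s. f2 s *\<^sub>R g s) - v2 L *\<^sub>R integral {0..L} (\<lambda>s. f1 s *\<^sub>R g s))"

definition bvp :: "(real \<Rightarrow> 'a::euclidean_space) \<Rightarrow> real \<Rightarrow> 'a" where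
  "bvp g t = f1 t *\<^sub>R (bvp_const g - integral {0..t} (\<lambda>s. f2 s *\<^sub>R g s)) + f2 t *\<^sub>R integral {0..t} (\<lambda>s. f1 s *\<^sub>R g s)"

definition bvp_deriv :: "(real \<Rightarrow> 'a::euclidean_space) \<Rightarrow> real \<Rightarrow> 'a" where
  "bvp_deriv g t = v1 t *\<^sub>R (bvp_const g - integral {0..t} (\<lambda>s. f2 s *\<^sub>R g s)) + v2 t *\<^sub>R integral {0..t} (\<lambda>s. f1 s *\<^sub>R g s)"

definition bvp_norm :: real where "bvp_norm = 2 * B\<^sup>2 * L * (B / \<bar>v1 L\<bar> + 1)"

lemma cont_f: "continuous_on A f1" "continuous_on A f2"
  using ode2_continuous(1)[OF ode(1)] ode2_continuous(1)[OF ode(2)] by auto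

lemma wronskian: "f1 t * v2 t - v1 t * f2 t = 1"
  using wronskian_const[OF ode, of t] by (simp add: init)

lemma bvp_deriv_0: "bvp_deriv g 0 = 0"
  by (simp add: bvp_deriv_def init)

lemma bvp_deriv_L: "bvp_deriv g L = 0"
  using nondeg by (simp add: bvp_deriv_def bvp_const_def algebra_simps)

lemma bvp_has_derivative:
  fixes g :: "real \<Rightarrow> real"
  assumes g: "continuous_on {0..L} g" and t: "t \<in> {0..L}"
  shows "(bvp g has_real_derivative bvp_deriv g t) (at t within {0..L})"
    and "(bvp_deriv g has_real_derivative - a t * bvp g t + g t) (at t within {0..L})"
proof -
  define I1 I2 where "I1 = (\<lambda>t. integral {0..t} (\<lambda>s. f1 s *\<^sub>R g s))" and "I2 = (\<lambda>t. integral {0..t} (\<lambda>s. f2 s *\<^sub>R g s))"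
  have [derivative_intros]: "(I1 has_real_derivative f1 t * g t) (at t within {0..L})"
    "(I2 has_real_derivative f2 t * g t) (at t within {0..L})"
    unfolding I1_def I2_def has_real_derivative_iff_has_vector_derivative
    using integral_has_vector_derivative[OF _ t, of "\<lambda>s. f1 s *\<^sub>R g s"]
      integral_has_vector_derivative[OF _ t, of "\<lambda>s. f2 s *\<^sub>R g s"] g cont_f
    by (auto intro!: continuous_intros)
  have [derivative_intros]: "(f1 has_real_derivative v1 t) (at t within {0..L})" "(f2 has_real_derivative v2 t) (at t within {0..L})"
    "(v1 has_real_derivative - a t * f1 t) (at t within {0..L})" "(v2 has_real_derivative - a t * f2 t) (at t within {0..L})"
    using ode by (auto simp: ode2_def intro: has_field_derivative_at_within)
  have b: "bvp g = (\<lambda>t. f1 t * (bvp_const g - I2 t) + f2 t * I1 t)"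
    and d: "bvp_deriv g = (\<lambda>t. v1 t * (bvp_const g - I2 t) + v2 t * I1 t)"
    by (simp_all add: bvp_def bvp_deriv_def I1_def I2_def fun_eq_iff)
  show "(bvp g has_real_derivative bvp_deriv g t) (at t within {0..L})"
    unfolding b d by (auto intro!: derivative_eq_intros simp: algebra_simps)
  have "(bvp_deriv g has_real_derivative - a t * bvp g t + (f1 t * v2 t - v1 t * f2 t) * g t) (at t within {0..L})"
    unfolding b d by (auto intro!: derivative_eq_intros simp: algebra_simps)
  then show "(bvp_deriv g has_real_derivative - a t * bvp g t + g t) (at t within {0..L})"
    by (simp add: wronskian)
qed

lemma integral_bound_f:
  fixes g :: "real \<Rightarrow> 'a::euclidean_space"
  assumes g: "continuous_on {0..L} g" and c: "\<And>t. t \<in> {0..L} \<Longrightarrow> norm (g t) \<le> c" and t: "t \<in> {0..L}"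
    and f: "continuous_on {0..L} f" "\<And>t. t \<in> {0..L} \<Longrightarrow> \<bar>f t\<bar> \<le> B"
  shows "norm (integral {0..t} (\<lambda>s. f s *\<^sub>R g s)) \<le> B * c * L"
proof -
  have B: "0 \<le> B" "0 \<le> c" using f(2)[of 0] c[of 0] L by (auto intro: order_trans[rotated])
  have "norm (integral {0..t} (\<lambda>s. f s *\<^sub>R g s)) \<le> B * c * (t - 0)"
  proof (rule integral_bound)
    show "continuous_on {0..t} (\<lambda>s. f s *\<^sub>R g s)"
      using continuous_on_subset[OF g, of "{0..t}"] continuous_on_subset[OF f(1), of "{0..t}"] t
      by (auto intro!: continuous_intros)
    show "norm (f s *\<^sub>R g s) \<le> B * c" if "s \<in> {0..t}" for s
      unfolding norm_scaleR by (intro mult_mono c f(2) B) (use t that in auto)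
  qed (use t in auto)
  also have "\<dots> \<le> B * c * L" using t B by (intro mult_left_mono) auto
  finally show ?thesis .
qed

text \<open>Variation of parameters contributes two products of size B^2 c L. The constant that
  enforces the condition at L contributes two more, amplified by B/|v1 L|; this is the shape of
  \<open>bvp_norm\<close>.\<close>

lemma bvp_bound:
  fixes g :: "real \<Rightarrow> 'a::euclidean_space"
  assumes g: "continuous_on {0..L} g" and c: "\<And>t. t \<in> {0..L} \<Longrightarrow> norm (g t) \<le> c" and t: "t \<in> {0..L}"
  shows "norm (bvp g t) \<le> bvp_norm * c"
proof -
  have B: "0 \<le> B" using bound(1)[of 0] L by (auto intro: order_trans[rotated])
  have LL: "L \<in> {0..L}" using L by simp
  note I1 = integral_bound_f[OF g c _ cont_f(1) bound(1)]
  note I2 = integral_bound_f[OF g c _ cont_f(2) bound(2)]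
  have A: "norm (bvp_const g) \<le> 2 * B\<^sup>2 * c * L / \<bar>v1 L\<bar>"
  proof -
    have "norm (v1 L *\<^sub>R integral {0..L} (\<lambda>s. f2 s *\<^sub>R g s)) \<le> B * (B * c * L)"
      unfolding norm_scaleR by (intro mult_mono I2 bound(3) B LL) auto
    moreover have "norm (v2 L *\<^sub>R integral {0..L} (\<lambda>s. f1 s *\<^sub>R g s)) \<le> B * (B * c * L)"
      unfolding norm_scaleR by (intro mult_mono I1 bound(4) B LL) auto
    ultimately have "norm (v1 L *\<^sub>R integral {0..L} (\<lambda>s. f2 s *\<^sub>R g s) - v2 L *\<^sub>R integral {0..L} (\<lambda>s. f1 s *\<^sub>R g s))
        \<le> B * (B * c * L) + B * (B * c * L)" by (rule norm_triangle_le_diff[OF add_mono])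
    also have "\<dots> = 2 * B\<^sup>2 * c * L" by (simp add: power2_eq_square)
    finally show ?thesis unfolding bvp_const_def using nondeg by (simp add: divide_right_mono)
  qed
  have "norm (bvp g t) = norm (f1 t *\<^sub>R bvp_const g + (f2 t *\<^sub>R integral {0..t} (\<lambda>s. f1 s *\<^sub>R g s)
      - f1 t *\<^sub>R integral {0..t} (\<lambda>s. f2 s *\<^sub>R g s)))"
    by (simp add: bvp_def algebra_simps)
  also have "\<dots> \<le> B * (2 * B\<^sup>2 * c * L / \<bar>v1 L\<bar>) + (B * (B * c * L) + B * (B * c * L))"
  proof (intro norm_triangle_le[OF add_mono] norm_triangle_le_diff[OF add_mono])
    show "norm (f1 t *\<^sub>R bvp_const g) \<le> B * (2 * B\<^sup>2 * c * L / \<bar>v1 L\<bar>)"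
      unfolding norm_scaleR by (intro mult_mono A bound(1) B t) auto
    show "norm (f2 t *\<^sub>R integral {0..t} (\<lambda>s. f1 s *\<^sub>R g s)) \<le> B * (B * c * L)"
      unfolding norm_scaleR by (intro mult_mono I1 bound(2) B t) auto
    show "norm (f1 t *\<^sub>R integral {0..t} (\<lambda>s. f2 s *\<^sub>R g s)) \<le> B * (B * c * L)"
      unfolding norm_scaleR by (intro mult_mono I2 bound(1) B t) auto
  qed
  also have "\<dots> = bvp_norm * c" by (simp add: bvp_norm_def power2_eq_square algebra_simps)
  finally show ?thesis .
qed

lemma bvp_diff:
  fixes g h :: "real \<Rightarrow> 'a::euclidean_space"
  assumes "continuous_on {0..L} g" "continuous_on {0..L} h" and t: "t \<in> {0..L}"
  shows "bvp (\<lambda>s. g s - h s) t = bvp g t - bvp h t"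
proof -
  have I: "integral {0..t} (\<lambda>s. f s *\<^sub>R (g s - h s)) = integral {0..t} (\<lambda>s. f s *\<^sub>R g s) - integral {0..t} (\<lambda>s. f s *\<^sub>R h s)"
    if "t \<in> {0..L}" "f \<in> {f1, f2}" for t f
  proof -
    have "continuous_on {0..t} (\<lambda>s. f s *\<^sub>R g s)" "continuous_on {0..t} (\<lambda>s. f s *\<^sub>R h s)"
      using that cont_f assms(1,2) by (auto intro!: continuous_intros intro: continuous_on_subset)
    then show ?thesis unfolding scaleR_diff_right
      by (intro integral_diff integrable_continuous_real)
  qed
  have LL: "L \<in> {0..L}" using L by simp
  note i = I[OF t, of f1, OF insertI1] I[OF t, of f2, OF insertI2[OF singletonI]]
    I[OF LL, of f1, OF insertI1] I[OF LL, of f2, OF insertI2[OF singletonI]]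
  show ?thesis unfolding bvp_def bvp_const_def i
    by (simp add: algebra_simps)
qed

text \<open>The kernel is real, so the operator commutes with real parts; this brings the complex
  fixed point back to a real Neumann problem.\<close>

lemma Re_bvp:
  assumes "continuous_on {0..L} g" and t: "t \<in> {0..L}"
  shows "Re (bvp g t) = bvp (\<lambda>s. Re (g s)) t"
proof -
  have I: "Re (integral {0..t} (\<lambda>s. f s *\<^sub>R g s)) = integral {0..t} (\<lambda>s. f s *\<^sub>R Re (g s))"
    if "t \<in> {0..L}" "f \<in> {f1, f2}" for t f
  proof -
    have "continuous_on {0..t} (\<lambda>s. f s *\<^sub>R g s)"
      using that cont_f assms(1) by (auto intro!: continuous_intros intro: continuous_on_subset)
    from integral_linear[OF integrable_continuous_real[OF this] bounded_linear_Re] show ?thesis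
      by (simp add: o_def)
  qed
  have "L \<in> {0..L}" using L by simp
  then show ?thesis unfolding bvp_def bvp_const_def using I t by simp
qed

lemma holo_family_bvp:
  assumes w: "holo_family L \<rho> w"
  shows "holo_family L \<rho> (\<lambda>t e. bvp (\<lambda>s. w s e) t)"
proof -
  have F: "holo_family L \<rho> (\<lambda>t e. of_real (f t))" if "f \<in> {f1, f2}" for f
    using that cont_f by (intro holo_family_const) auto
  have I: "holo_family L \<rho> (\<lambda>t e. integral {0..t} (\<lambda>s. of_real (f s) * w s e))" if "f \<in> {f1, f2}" for f
    by (intro holo_family_integral holo_family_mult F that w)
  have IL: "holo_family L \<rho> (\<lambda>t e. integral {0..L} (\<lambda>s. of_real (f s) * w s e))" if "f \<in> {f1, f2}" for f
  proof (rule holo_familyI)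
    have LL: "L \<in> {0..L}" using L by simp
    show "continuous_on ({0..L} \<times> ball 0 \<rho>) (\<lambda>p. integral {0..L} (\<lambda>s. of_real (f s) * w s (snd p)))"
      by (rule continuous_on_compose2[OF holo_familyD(1)[OF I[OF that]], of _ "\<lambda>p. (L, snd p)", unfolded fst_conv snd_conv])
        (use L in \<open>auto intro!: continuous_intros\<close>)
    show "(\<lambda>e. integral {0..L} (\<lambda>s. of_real (f s) * w s e)) holomorphic_on ball 0 \<rho>"
      by (rule holo_familyD(2)[OF I[OF that] LL])
    show "integral {0..L} (\<lambda>s. of_real (f s) * w s (of_real x)) \<in> \<real>" if "\<bar>x\<bar> < \<rho>" for x
      by (rule holo_familyD(3)[OF I LL that]) fact
  qed
  have C: "holo_family L \<rho> (\<lambda>t e. of_real c)" for c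
    using holo_family_const[of L "\<lambda>_. c"] by simp
  have "holo_family L \<rho> (\<lambda>t e. of_real (f1 t) * (of_real (1 / v1 L) *
      (of_real (v1 L) * integral {0..L} (\<lambda>s. of_real (f2 s) * w s e) - of_real (v2 L) * integral {0..L} (\<lambda>s. of_real (f1 s) * w s e))
      - integral {0..t} (\<lambda>s. of_real (f2 s) * w s e)) + of_real (f2 t) * integral {0..t} (\<lambda>s. of_real (f1 s) * w s e))"
    by (intro holo_family_add holo_family_mult holo_family_diff F I IL C) auto
  then show ?thesis unfolding bvp_def bvp_const_def scaleR_conv_of_real .
qed

end

section \<open>Continuation in the eccentricity\<close>

text \<open>The energy v^2/2 - (z^2 + 1/4)^(-1/2) is conserved and the orbit starts at rest, so the
  potential never exceeds its initial value. This is what makes \<xi>_p the constant term of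
  G.\<close>

lemma circ_energy: "\<bar>sitnikov_z \<xi> 0 t\<bar> \<le> \<bar>\<xi>\<bar>"
proof -
  let ?z = "sitnikov_z \<xi> 0" and ?v = "deriv (sitnikov_z \<xi> 0)"
  define E where "E = (\<lambda>t. (?v t)\<^sup>2 / 2 - ((?z t)\<^sup>2 + (1/2)\<^sup>2) powr (-1/2))"
  have pos: "0 < (?z t)\<^sup>2 + (1/2)\<^sup>2" for t by (simp add: add_nonneg_pos)
  have "(E has_real_derivative 0) (at t)" for t
  proof -
    have [derivative_intros]: "(?z has_real_derivative ?v t) (at t)"
      "(?v has_real_derivative - ?z t / ((?z t)\<^sup>2 + (1/2)\<^sup>2) powr (3/2)) (at t)"
      using circ_ode(1)[of \<xi>] by (auto simp: ode2_def sit_force_def)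
    have "(E has_real_derivative 2 * ?v t * (- ?z t / ((?z t)\<^sup>2 + (1/2)\<^sup>2) powr (3/2)) / 2 -
        (-1/2 * ((?z t)\<^sup>2 + (1/2)\<^sup>2) powr (-1/2 - 1) * (2 * ?z t * ?v t))) (at t)"
      unfolding E_def using pos[of t] by (auto intro!: derivative_eq_intros)
    moreover have "((?z t)\<^sup>2 + (1/2)\<^sup>2) powr (-1/2 - 1) = 1 / ((?z t)\<^sup>2 + (1/2)\<^sup>2) powr (3/2)"
      using powr_minus_divide[of "(?z t)\<^sup>2 + (1/2)\<^sup>2" "3/2"] by simp
    ultimately show ?thesis by simp
  qed
  then have "E t = E 0" using DERIV_isconst_all by blast
  moreover have "E 0 = - ((\<xi>\<^sup>2 + (1/2)\<^sup>2) powr (-1/2))" unfolding E_def circ_0 by simp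
  ultimately have "(\<xi>\<^sup>2 + (1/2)\<^sup>2) powr (-1/2) \<le> ((?z t)\<^sup>2 + (1/2)\<^sup>2) powr (-1/2)"
    using zero_le_power2[of "?v t"] unfolding E_def by linarith
  then have "(?z t)\<^sup>2 + (1/2)\<^sup>2 \<le> \<xi>\<^sup>2 + (1/2)\<^sup>2"
    using powr_less_mono2_neg[of "-1/2" "\<xi>\<^sup>2 + (1/2)\<^sup>2" "(?z t)\<^sup>2 + (1/2)\<^sup>2"] by (force simp: add_nonneg_pos not_less[symmetric])
  then show ?thesis by (simp add: abs_le_square_iff)
qed

lemma holo_family_uminus:
  assumes "holo_family L \<rho> w" shows "holo_family L \<rho> (\<lambda>t e. - w t e)"
  using holo_familyD[OF assms] by (intro holo_familyI) (auto intro!: continuous_intros holomorphic_intros)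

lemma holo_family_cforce:
  assumes u: "holo_family L \<rho> u" and R: "holo_family L \<rho> R"
    and pos: "\<And>t e. t \<in> {0..L} \<Longrightarrow> e \<in> ball 0 \<rho> \<Longrightarrow> 0 < Re (u t e * u t e + R t e * R t e)"
  shows "holo_family L \<rho> (\<lambda>t e. cforce (u t e) (R t e))"
proof -
  have "holo_family L \<rho> (\<lambda>t e. u t e * u t e + R t e * R t e)"
    by (intro holo_family_add holo_family_mult u R)
  then have "holo_family L \<rho> (\<lambda>t e. (\<lambda>q. inverse (q * csqrt q)) (u t e * u t e + R t e * R t e))"
  proof (rule holo_family_compose[where S="{q. 0 < Re q}"])
    show "(\<lambda>q. inverse (q * csqrt q)) holomorphic_on {q. 0 < Re q}"
      using Re_pos_facts by (intro holomorphic_intros) auto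
    show "inverse (x * csqrt x) \<in> \<real>" if "x \<in> {q. 0 < Re q}" "x \<in> \<real>" for x
      using that by (auto elim!: Reals_cases)
  qed (use pos in auto)
  then show ?thesis unfolding cforce_def
    by (intro holo_family_mult holo_family_uminus u)
qed

lemma remainder_0: "remainder x 0 \<rho> = cforce (of_real x) \<rho> - cforce (of_real x) (1/2)"
  using cforce_of_real(1)[of "1/2" x] by (simp add: remainder_def)

text \<open>The contraction yields the branch; the rate comes from a second look at its equation for
  real e. With m the maximum of |w| one gets m \<le> \<kappa> (12 e/(1 - e)^3 + \<epsilon> m), and
  12 \<kappa> < \<gamma> leaves room both for \<epsilon> and for the cubic factor.\<close>

lemma continuation:
  fixes N :: nat and \<xi> xs \<gamma> :: real
  defines "L \<equiv> real N * pi" and "\<beta> \<equiv> deriv (phi1 \<xi> 0) (real N * pi)"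
  assumes N: "1 \<le> N" and \<xi>: "\<xi> \<in> {0..xs}"
    and fin: "deriv (sitnikov_z \<xi> 0) L = 0" and nondeg: "\<beta> \<noteq> 0"
    and \<gamma>: "12 * (2 * (r0 N xs)\<^sup>2 * L * (r0 N xs / \<bar>\<beta>\<bar> + 1)) < \<gamma>"
  shows "\<exists>es H. 0 < es \<and> es < 1 \<and> smooth_on {0..<es} H \<and> H 0 = \<xi> \<and>
    (\<forall>e\<in>{0..<es}. deriv (sitnikov_z (H e) e) L = 0 \<and>
       (\<forall>t\<in>{0..L}. \<bar>sitnikov_z (H e) e t - sitnikov_z \<xi> 0 t\<bar> \<le> \<gamma> * e))"
proof -
  have L0: "0 < L" unfolding L_def using N by simp
  interpret green "phi1 \<xi> 0" "phi2 \<xi> 0" "deriv (phi1 \<xi> 0)" "deriv (phi2 \<xi> 0)" "a_coeff \<xi> 0" L "r0 N xs"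
  proof
    show "deriv (phi1 \<xi> 0) L \<noteq> 0" using nondeg by (simp add: L_def \<beta>_def)
    fix t assume "t \<in> {0..L}"
    then have t: "t \<in> {0..real N * pi}" by (simp add: L_def)
    show "\<bar>phi1 \<xi> 0 t\<bar> \<le> r0 N xs" "\<bar>phi2 \<xi> 0 t\<bar> \<le> r0 N xs"
      "\<bar>deriv (phi1 \<xi> 0) t\<bar> \<le> r0 N xs" "\<bar>deriv (phi2 \<xi> 0) t\<bar> \<le> r0 N xs"
      by (rule phi_le_r0[OF _ t \<xi>], simp)+
  qed (use phi1_props phi2_props L0 in auto)
  define \<kappa> where "\<kappa> = bvp_norm"
  have \<kappa>\<gamma>: "12 * \<kappa> < \<gamma>" using \<gamma> unfolding \<kappa>_def bvp_norm_def unfolding \<beta>_def L_def .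
  have "1 \<le> r0 N xs" using phi_le_r0[of "phi1 \<xi> 0" \<xi> 0 N xs] \<xi> by (simp add: phi1_props)
  then have \<kappa>: "0 < \<kappa>" unfolding \<kappa>_def bvp_norm_def using L0 nondeg
    by (intro mult_pos_pos add_nonneg_pos) auto
  \<comment> \<open>1 - \<theta> measures the available room, to be shared between the remainder and
    the factor (1 - x)^(-3).\<close>
  define \<theta> where "\<theta> = 12 * \<kappa> / \<gamma>"
  have \<theta>: "0 < \<theta>" "\<theta> < 1" using \<kappa> \<kappa>\<gamma> by (auto simp: \<theta>_def)
  have \<gamma>\<theta>: "\<gamma> * \<theta> = 12 * \<kappa>" using \<kappa> \<kappa>\<gamma> by (simp add: \<theta>_def)
  \<comment> \<open>Then \<kappa> \<epsilon> = (1 - \<theta>)/2 < 1/2, which is the contraction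
    factor and also the share of m absorbed in the final estimate.\<close>
  define \<epsilon> where "\<epsilon> = (1 - \<theta>) / (2 * \<kappa>)"
  have \<epsilon>: "0 < \<epsilon>" "\<kappa> * \<epsilon> = (1 - \<theta>) / 2" using \<kappa> \<theta> by (auto simp: \<epsilon>_def)
  define z0 where "z0 = sitnikov_z \<xi> 0"
  define X where "X = \<bar>\<xi>\<bar>"
  have X: "\<bar>z0 t\<bar> \<le> X" for t using circ_energy by (simp add: X_def z0_def)
  have cz0: "continuous_on A z0" for A unfolding z0_def by (rule ode2_continuous(1)[OF circ_ode(1)])
  obtain \<delta> where \<delta>: "0 < \<delta>" "\<delta> \<le> 1/8"
    and lip: "\<And>x u w \<rho>. \<bar>x\<bar> \<le> X \<Longrightarrow> cmod u \<le> \<delta> \<Longrightarrow> cmod w \<le> \<delta> \<Longrightarrow> cmod (\<rho> - 1/2) \<le> \<delta> \<Longrightarrow>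
      cmod (remainder x u \<rho> - remainder x w \<rho>) \<le> \<epsilon> * cmod (u - w)"
    using remainder_lipschitz[OF \<epsilon>(1)] by blast
  \<comment> \<open>If the change of radius alters the force by less than \<delta>/(2 \<kappa>), the
    map sends 0 to size at most \<delta>/2; the Lipschitz part adds at most another
    \<delta>/2.\<close>
  have "0 < \<delta> / (2 * \<kappa>)" using \<delta> \<kappa> by simp
  then obtain d where d: "0 < d" "\<And>p q. p \<in> strip (X + 1) \<Longrightarrow> q \<in> strip (X + 1) \<Longrightarrow> dist q p < d \<Longrightarrow>
      dist (cforce (fst q) (snd q)) (cforce (fst p) (snd p)) < \<delta> / (2 * \<kappa>)"
    using uniformly_continuous_strip(1)[of "X + 1"] unfolding uniformly_continuous_on_def by metis
  obtain R where R: "holo_family L (1/8) R"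
    "\<And>t e. t \<in> {0..L} \<Longrightarrow> e \<in> ball 0 (1/8) \<Longrightarrow> cmod (R t e - 1/2) \<le> 3/2 * cmod e"
    "\<And>t x. t \<in> {0..L} \<Longrightarrow> 0 \<le> x \<Longrightarrow> x < 1/8 \<Longrightarrow> R t (of_real x) = of_real (r t x)"
    using complex_r[of L] by blast
  \<comment> \<open>Since |R - 1/2| \<le> 3/2 |e|, halving \<delta> and d keeps the complex radius
    within both tolerances.\<close>
  define \<rho> where "\<rho> = min (1/16) (min (\<delta> / 2) (d / 2))"
  have \<rho>: "0 < \<rho>" "\<rho> \<le> 1/16" "\<rho> \<le> \<delta> / 2" "\<rho> \<le> d / 2" using \<delta> d by (auto simp: \<rho>_def)
  have R\<rho>: "holo_family L \<rho> R" by (rule holo_family_mono[OF R(1)]) (use \<rho> in auto)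
  have Rb: "cmod (R t e - 1/2) \<le> \<delta>" "cmod (R t e - 1/2) < d" if "t \<in> {0..L}" "e \<in> ball 0 \<rho>" for t e
  proof -
    have e: "cmod e < \<rho>" using that(2) by simp
    then have "cmod (R t e - 1/2) \<le> 3/2 * cmod e" using R(2)[OF that(1), of e] \<rho> by simp
    then show "cmod (R t e - 1/2) \<le> \<delta>" "cmod (R t e - 1/2) < d" using e \<rho> d(1) \<delta>(1) by auto
  qed
  define G where "G w s e = remainder (z0 s) (w s e) (R s e)" for w :: "real \<Rightarrow> complex \<Rightarrow> complex" and s e
  have holoG: "holo_family L \<rho> (G w)" if w: "bounded_family L \<rho> \<delta> w" for w
  proof -
    have wf: "holo_family L \<rho> w" and wb: "\<And>t e. t \<in> {0..L} \<Longrightarrow> e \<in> ball 0 \<rho> \<Longrightarrow> cmod (w t e) \<le> \<delta>"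
      using w by (auto simp: bounded_family_def)
    have u: "holo_family L \<rho> (\<lambda>t e. of_real (z0 t) + w t e)"
      by (intro holo_family_add holo_family_const wf cz0)
    have "holo_family L \<rho> (\<lambda>t e. cforce (of_real (z0 t) + w t e) (R t e))"
    proof (rule holo_family_cforce[OF u R\<rho>])
      fix t e assume te: "t \<in> {0..L}" "e \<in> ball (0::complex) \<rho>"
      show "0 < Re ((of_real (z0 t) + w t e) * (of_real (z0 t) + w t e) + R t e * R t e)"
        using strip_pos[OF in_strip[OF X wb[OF te] Rb(1)[OF te] \<delta>(2)]] by simp
    qed
    moreover have "continuous_on {0..L} (\<lambda>s. sit_force (z0 s) (1/2))"
    proof -
      have "continuous_on UNIV (\<lambda>z. sit_force z (1/2))"
        by (rule DERIV_continuous_on[OF sit_force_dz]) simp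
      from continuous_on_compose2[OF this cz0] show ?thesis by simp
    qed
    moreover have "continuous_on {0..L} (\<lambda>s. sit_dz (z0 s) (1/2))"
      using continuous_on_minus[OF a_coeff_0_continuous[of _ \<xi>]] by (simp add: a_coeff_eq z0_def)
    ultimately show ?thesis unfolding G_def remainder_def
      by (intro holo_family_diff holo_family_mult holo_family_const wf)
  qed
  have contG: "continuous_on {0..L} (\<lambda>s. G w s e)" if "bounded_family L \<rho> \<delta> w" "e \<in> ball 0 \<rho>" for w e
    by (rule holo_family_slice[OF holoG[OF that(1)] that(2)]) simp
  have lipG: "cmod (G u s e - G w s e) \<le> \<epsilon> * cmod (u s e - w s e)"
    if "bounded_family L \<rho> \<delta> u" "bounded_family L \<rho> \<delta> w" "s \<in> {0..L}" "e \<in> ball 0 \<rho>" for u w s e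
    unfolding G_def by (rule lip[OF X]) (use that Rb in \<open>auto simp: bounded_family_def\<close>)
  have zero: "bounded_family L \<rho> \<delta> (\<lambda>_ _. 0)"
    using holo_family_const[of L "\<lambda>_. 0" \<rho>] \<delta> by (simp add: bounded_family_def)
  \<comment> \<open>A fixed point satisfies w'' + a w = G w for real e, with w' = 0 at both ends;
    the subtracted terms of \<open>remainder\<close> then cancel, and z0 + w solves the perturbed
    equation exactly.\<close>
  have "\<exists>w. bounded_family L \<rho> \<delta> w \<and> (\<forall>t\<in>{0..L}. \<forall>e\<in>ball 0 \<rho>. bvp (\<lambda>s. G w s e) t = w t e)"
  proof (rule holo_family_fixed_point)
    fix w assume w: "bounded_family L \<rho> \<delta> w"
    have "cmod (bvp (\<lambda>s. G w s e) t) \<le> \<delta>" if te: "t \<in> {0..L}" "e \<in> ball 0 \<rho>" for t e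
    proof -
      have "cmod (bvp (\<lambda>s. G w s e) t) \<le> \<kappa> * (\<delta> / (2 * \<kappa>) + \<epsilon> * \<delta>)"
        unfolding \<kappa>_def
      proof (rule bvp_bound[OF contG[OF w te(2)] _ te(1)], unfold \<kappa>_def[symmetric])
        fix s assume s: "s \<in> {0..L}"
        have m: "(of_real (z0 s) + 0, R s e) \<in> strip (X + 1)" "(of_real (z0 s) + 0, 1/2) \<in> strip (X + 1)"
          using \<delta> by (intro in_strip[OF X, of _ \<delta>] Rb(1)[OF s te(2)]; simp)+
        have "cmod (G (\<lambda>_ _. 0) s e) < \<delta> / (2 * \<kappa>)"
          using d(2)[OF m(2,1)] Rb(2)[OF s te(2)]
          by (simp add: G_def remainder_0 dist_Pair_Pair dist_norm)
        moreover have "cmod (G w s e - G (\<lambda>_ _. 0) s e) \<le> \<epsilon> * \<delta>"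
        proof -
          have "cmod (w s e - 0) \<le> \<delta>" using w s te(2) by (auto simp: bounded_family_def)
          from order_trans[OF lipG[OF w zero s te(2)] mult_left_mono[OF this less_imp_le[OF \<epsilon>(1)]]]
          show ?thesis .
        qed
        ultimately show "cmod (G w s e) \<le> \<delta> / (2 * \<kappa>) + \<epsilon> * \<delta>"
          using norm_triangle_sub[of "G w s e" "G (\<lambda>_ _. 0) s e"] by linarith
      qed
      also have "\<dots> = \<delta> / 2 + (\<kappa> * \<epsilon>) * \<delta>" using \<kappa> by (simp add: algebra_simps)
      also have "\<dots> \<le> \<delta> / 2 + 1/2 * \<delta>" unfolding \<epsilon>(2) using \<theta> \<delta> by (intro add_left_mono mult_right_mono) auto
      finally show ?thesis by simp
    qed
    then show "bounded_family L \<rho> \<delta> (\<lambda>t e. bvp (\<lambda>s. G w s e) t)"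
      using holo_family_bvp[OF holoG[OF w]] by (auto simp: bounded_family_def)
  next
    fix u w c t and e :: complex
    assume u: "bounded_family L \<rho> \<delta> u" and w: "bounded_family L \<rho> \<delta> w" and "0 \<le> c"
      and diff: "\<And>t e. t \<in> {0..L} \<Longrightarrow> e \<in> ball 0 \<rho> \<Longrightarrow> cmod (u t e - w t e) \<le> c"
      and te: "t \<in> {0..L}" "e \<in> ball 0 \<rho>"
    have "cmod (bvp (\<lambda>s. G u s e - G w s e) t) \<le> \<kappa> * (\<epsilon> * c)" unfolding \<kappa>_def
    proof (rule bvp_bound[OF _ _ te(1)])
      show "continuous_on {0..L} (\<lambda>s. G u s e - G w s e)"
        by (intro continuous_intros contG u w te)
      fix s assume s: "s \<in> {0..L}"
      show "cmod (G u s e - G w s e) \<le> \<epsilon> * c"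
        by (rule order_trans[OF lipG[OF u w s te(2)] mult_left_mono[OF diff[OF s te(2)] less_imp_le[OF \<epsilon>(1)]]])
    qed
    also have "\<dots> = ((1 - \<theta>) / 2) * c" by (simp add: \<epsilon>(2)[symmetric])
    also have "\<dots> \<le> (1 / 2) * c" using \<theta> \<open>0 \<le> c\<close> by (intro mult_right_mono) auto
    finally show "cmod (bvp (\<lambda>s. G u s e) t - bvp (\<lambda>s. G w s e) t) \<le> c / 2"
      by (simp add: bvp_diff[OF contG[OF u te(2)] contG[OF w te(2)] te(1)])
  qed (use \<delta> in auto)
  then obtain w where w: "bounded_family L \<rho> \<delta> w"
    and fp: "\<And>t e. t \<in> {0..L} \<Longrightarrow> e \<in> ball 0 \<rho> \<Longrightarrow> bvp (\<lambda>s. G w s e) t = w t e" by blast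
  have wf: "holo_family L \<rho> w" using w by (simp add: bounded_family_def)
  \<comment> \<open>x \<le> (1 - \<theta>)/6 gives (1 - x)^3 \<ge> 1 - 3 x \<ge> (1 + \<theta>)/2,
    as used at the end.\<close>
  define es where "es = min \<rho> ((1 - \<theta>) / 6)"
  have es: "0 < es" "es \<le> \<rho>" "es < 1" using \<rho> \<theta> by (auto simp: es_def)
  have es4: "es \<le> (1 - \<theta>) / 6" unfolding es_def by (rule min.cobounded2)
  define h where "h e = of_real \<xi> + w 0 e" for e
  define H where "H x = Re (h (of_real x))" for x
  have "0 \<in> {0..L}" using L0 by simp
  then have "h holomorphic_on ball 0 \<rho>"
    using holo_familyD(2)[OF wf] unfolding h_def[abs_def] by (intro holomorphic_intros) auto
  from smooth_real_part[OF this es(1,2)] have smooth: "smooth_on {0..<es} H"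
    unfolding smooth_on_def H_def by (intro exI[of _ "\<lambda>k x. Re ((deriv ^^ k) h (of_real x))"]) auto
  have main: "deriv (sitnikov_z (H x) x) L = 0 \<and> (\<forall>t\<in>{0..L}. \<bar>sitnikov_z (H x) x t - z0 t\<bar> \<le> \<gamma> * x)"
    and H0: "x = 0 \<Longrightarrow> H x = \<xi>"
    if x: "x \<in> {0..<es}" for x
  proof -
    have x1: "0 \<le> x" "x < 1" "x < 1/8" "\<bar>x\<bar> < \<rho>" using x es \<rho> by auto
    have xb: "complex_of_real x \<in> ball 0 \<rho>" using x1 by simp
    define \<omega> where "\<omega> t = Re (w t (of_real x))" for t
    have w\<omega>: "w t (of_real x) = of_real (\<omega> t)" if "t \<in> {0..L}" for t
      using holo_familyD(3)[OF wf that x1(4)] by (simp add: \<omega>_def)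
    define g where "g = (\<lambda>s. Re (G w s (of_real x)))"
    have rp: "0 < r s x" for s by (rule r_pos) (use x1 in auto)
    have Gg: "G w s (of_real x) = of_real (sit_force (z0 s + \<omega> s) (r s x) - sit_force (z0 s) (1/2) - sit_dz (z0 s) (1/2) * \<omega> s)"
      if s: "s \<in> {0..L}" for s
      unfolding G_def remainder_def w\<omega>[OF s] R(3)[OF s x1(1,3)]
      using cforce_of_real(1)[OF rp, of "z0 s + \<omega> s" s] by simp
    have g_eq: "g s = sit_force (z0 s + \<omega> s) (r s x) - sit_force (z0 s) (1/2) - sit_dz (z0 s) (1/2) * \<omega> s"
      if s: "s \<in> {0..L}" for s unfolding g_def Gg[OF s] by simp
    have cg: "continuous_on {0..L} g" unfolding g_def by (intro continuous_intros contG w xb)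
    have \<omega>: "\<omega> t = bvp g t" if t: "t \<in> {0..L}" for t
      using Re_bvp[OF contG[OF w xb] t] fp[OF t xb] by (simp add: \<omega>_def g_def)
    define y v where "y = (\<lambda>t. z0 t + bvp g t)" and "v = (\<lambda>t. deriv z0 t + bvp_deriv g t)"
    have Hx: "H x = y 0" using \<omega>[of 0] L0 circ_0(1)[of \<xi>] by (simp add: H_def h_def y_def \<omega>_def z0_def)
    \<comment> \<open>y is controlled on [0, L] only; uniqueness on each [0, T] identifies it with
      the global solution, so that v L = 0 becomes the second boundary condition.\<close>
    have eq: "y T = sitnikov_z (H x) x T \<and> v T = deriv (sitnikov_z (H x) x) T" if T: "T \<in> {0..L}" for T
    proof (rule ode2_unique_within[where F="\<lambda>t y. sit_force y (r t x)" and T=T])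
      show "0 \<le> T" using T by simp
      show "\<bar>sit_force y (r t x) - sit_force z (r t x)\<bar> \<le> 2 / ((1 - x) / 2) ^ 3 * \<bar>y - z\<bar>" for t y z
        by (rule sit_ode_lipschitz) (use x1 in auto)
      show "y 0 = sitnikov_z (H x) x 0" "v 0 = deriv (sitnikov_z (H x) x) 0"
        using sitnikov_z_props(2,3)[OF x1(1,2)] circ_0(2)[of \<xi>] by (auto simp: Hx v_def bvp_deriv_0 z0_def)
      fix t assume "t \<in> {0..T}"
      then have t: "t \<in> {0..L}" and sub: "{0..T} \<subseteq> {0..L}" using T by auto
      show "(sitnikov_z (H x) x has_real_derivative deriv (sitnikov_z (H x) x) t) (at t within {0..T})"
        "(deriv (sitnikov_z (H x) x) has_real_derivative sit_force (sitnikov_z (H x) x t) (r t x)) (at t within {0..T})"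
        using sitnikov_z_props(1)[OF x1(1,2)] by (auto simp: ode2_def intro: has_field_derivative_at_within)
      have Z: "(z0 has_real_derivative deriv z0 t) (at t within {0..L})"
        "(deriv z0 has_real_derivative sit_force (z0 t) (1/2)) (at t within {0..L})"
        using circ_ode(1)[of \<xi>] by (auto simp: ode2_def z0_def intro: has_field_derivative_at_within)
      have "(y has_real_derivative v t) (at t within {0..L})"
        unfolding y_def v_def by (intro DERIV_add Z bvp_has_derivative cg t)
      then show "(y has_real_derivative v t) (at t within {0..T})"
        by (rule has_field_derivative_subset[OF _ sub])
      have "(v has_real_derivative sit_force (z0 t) (1/2) + (- a_coeff \<xi> 0 t * bvp g t + g t)) (at t within {0..L})"
        unfolding v_def by (intro DERIV_add Z bvp_has_derivative cg t)
      moreover have "sit_force (z0 t) (1/2) + (- a_coeff \<xi> 0 t * bvp g t + g t) = sit_force (y t) (r t x)"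
        unfolding g_eq[OF t] \<omega>[OF t] by (simp add: a_coeff_eq y_def z0_def)
      ultimately show "(v has_real_derivative sit_force (y t) (r t x)) (at t within {0..T})"
        using has_field_derivative_subset[OF _ sub] by metis
    qed
    have LL: "L \<in> {0..L}" using L0 by simp
    have "continuous_on {0..L} (\<lambda>t. \<bar>\<omega> t\<bar>)"
      unfolding \<omega>_def by (intro continuous_intros holo_family_slice[OF wf xb]) simp
    \<comment> \<open>The estimate is taken at a maximum point of |\<omega>|, so that the same m
      occurs on both sides.\<close>
    then obtain tm where tm: "tm \<in> {0..L}" "\<And>t. t \<in> {0..L} \<Longrightarrow> \<bar>\<omega> t\<bar> \<le> \<bar>\<omega> tm\<bar>"
      using continuous_attains_sup[OF compact_Icc, of 0 L "\<lambda>t. \<bar>\<omega> t\<bar>"] L0 by auto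
    define m where "m = \<bar>\<omega> tm\<bar>"
    define c0 where "c0 = 12 * x / (1 - x) ^ 3"
    have "\<bar>bvp g tm\<bar> \<le> \<kappa> * (c0 + \<epsilon> * m)"
      unfolding \<kappa>_def real_norm_def[symmetric]
    proof (rule bvp_bound[OF cg _ tm(1)])
      fix s assume s: "s \<in> {0..L}"
      have "\<bar>sit_force (z0 s) (r s x) - sit_force (z0 s) (1/2)\<bar> \<le> 3 / ((1 - x) / 2) ^ 3 * \<bar>r s x - 1/2\<bar>"
        by (rule sit_force_lipschitz_r) (use x1 r_lower[OF x1(1)] in auto)
      also have "\<dots> \<le> 3 / ((1 - x) / 2) ^ 3 * (x / 2)"
        using x1 r_deviation[OF x1(1)] by (intro mult_left_mono) auto
      also have "\<dots> = c0" by (simp add: c0_def power_divide)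
      finally have "cmod (G (\<lambda>_ _. 0) s (of_real x)) \<le> c0"
        using cforce_of_real(1)[OF rp, of "z0 s" s] cforce_of_real(1)[of "1/2" "z0 s"]
        by (simp add: G_def remainder_0 R(3)[OF s x1(1,3)] flip: of_real_diff)
      moreover have "cmod (G w s (of_real x) - G (\<lambda>_ _. 0) s (of_real x)) \<le> \<epsilon> * cmod (w s (of_real x) - 0)"
        by (rule lipG[OF w zero s xb])
      moreover have "\<epsilon> * cmod (w s (of_real x) - 0) \<le> \<epsilon> * m"
        using tm(2)[OF s] \<epsilon>(1) by (simp add: w\<omega>[OF s] m_def)
      ultimately have "cmod (G w s (of_real x)) \<le> c0 + \<epsilon> * m"
        using norm_triangle_sub[of "G w s (of_real x)" "G (\<lambda>_ _. 0) s (of_real x)"] by linarith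
      then show "norm (g s) \<le> c0 + \<epsilon> * m"
        using abs_Re_le_cmod[of "G w s (of_real x)"] by (simp add: g_def)
    qed
    then have "m \<le> \<kappa> * c0 + (\<kappa> * \<epsilon>) * m" using \<omega>[OF tm(1)] by (simp add: m_def algebra_simps)
    then have "(1 + \<theta>) / 2 * m \<le> \<kappa> * c0" unfolding \<epsilon>(2) by (simp add: field_simps)
    also have "\<dots> \<le> (1 + \<theta>) / 2 * (\<gamma> * x)"
    proof -
      have p: "0 < (1 - x) ^ 3" using x1 by simp
      have "1 - 3 * x \<le> (1 - x) ^ 3" using Bernoulli_inequality[of "- x" 3] x1 by simp
      then have "(1 + \<theta>) / 2 \<le> (1 - x) ^ 3" using x es4 by simp
      then have "(1 + \<theta>) * ((1 + \<theta>) / 2) \<le> (1 + \<theta>) * (1 - x) ^ 3" using \<theta> by (intro mult_left_mono) auto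
      \<comment> \<open>This is (1 - \<theta>)^2 \<ge> 0. One factor (1 + \<theta>)/2 pays for the
        remainder, the other for (1 - x)^3, and their product is at least \<theta>.\<close>
      moreover have "2 * \<theta> \<le> (1 + \<theta>) * ((1 + \<theta>) / 2)"
        using zero_le_power2[of "1 - \<theta>"] by (simp add: power2_eq_square algebra_simps)
      ultimately have "2 * \<theta> \<le> (1 + \<theta>) * (1 - x) ^ 3" by simp
      then have "\<gamma> * x * (2 * \<theta>) \<le> \<gamma> * x * ((1 + \<theta>) * (1 - x) ^ 3)"
        using \<kappa> \<kappa>\<gamma> x1 by (intro mult_left_mono) auto
      moreover have "\<gamma> * x * (2 * \<theta>) = 2 * x * (\<gamma> * \<theta>)" by simp
      then have "\<gamma> * x * (2 * \<theta>) = 24 * \<kappa> * x" unfolding \<gamma>\<theta> by simp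
      moreover have "\<gamma> * x * ((1 + \<theta>) * (1 - x) ^ 3) = (1 + \<theta>) * (\<gamma> * x) * (1 - x) ^ 3"
        by (simp only: mult_ac)
      ultimately have "24 * \<kappa> * x \<le> (1 + \<theta>) * (\<gamma> * x) * (1 - x) ^ 3" by linarith
      then show ?thesis using p by (simp add: c0_def field_simps)
    qed
    finally have m: "m \<le> \<gamma> * x" using \<theta> by simp
    have bound: "\<bar>sitnikov_z (H x) x t - z0 t\<bar> \<le> \<gamma> * x" if t: "t \<in> {0..L}" for t
    proof -
      have "sitnikov_z (H x) x t - z0 t = \<omega> t"
        using eq[OF t, THEN conjunct1, symmetric] \<omega>[OF t] by (simp add: y_def)
      then show ?thesis using order_trans[OF tm(2)[OF t] m[unfolded m_def]] by simp
    qed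
    moreover have "deriv (sitnikov_z (H x) x) L = 0"
      using eq[OF LL] fin by (simp add: v_def bvp_deriv_L z0_def)
    ultimately show "deriv (sitnikov_z (H x) x) L = 0 \<and> (\<forall>t\<in>{0..L}. \<bar>sitnikov_z (H x) x t - z0 t\<bar> \<le> \<gamma> * x)"
      by blast
    show "H x = \<xi>" if "x = 0"
      using bound[of 0] L0 sitnikov_z_props(2)[OF x1(1,2), of "H x"] circ_0(1)[of \<xi>] that by (simp add: z0_def)
  qed
  show ?thesis
    using es smooth H0[of 0] main by (intro exI[of _ es] exI[of _ H]) (auto simp: z0_def)
qed

text \<open>The estimates live on the half period [0, N\<pi>]; reduction modulo the period and
  reflection of its second half carry them to the line.\<close>

lemma even_periodic_bound:
  assumes "even_periodic N z" "1 \<le> N" "\<And>t. t \<in> {0..real N * pi} \<Longrightarrow> \<bar>z t\<bar> \<le> c"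
  shows "\<bar>z t\<bar> \<le> c"
proof -
  define Q P where "Q = real N * pi" and "P = 2 * Q"
  have P: "0 < P" unfolding P_def using assms(2) by (simp add: Q_def)
  have ev: "z (- t) = z t" and per: "z (t + P) = z t" for t
    using assms(1) by (auto simp: even_periodic_def P_def Q_def mult.assoc)
  have pern: "z (t + real n * P) = z t" for t n
  proof (induction n)
    case (Suc n)
    then show ?case using per[of "t + real n * P"] by (simp add: algebra_simps)
  qed simp
  have pos: "\<bar>z t\<bar> \<le> c" if "0 \<le> t" for t
  proof -
    define n where "n = nat \<lfloor>t / P\<rfloor>"
    have "real n \<le> t / P" "t / P < real n + 1" using that P by (auto simp: n_def of_nat_nat)
    then have s: "0 \<le> t - real n * P" "t - real n * P < P" using P by (auto simp: field_simps)
    have z: "z t = z (t - real n * P)" using pern[of "t - real n * P" n] by simp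
    show ?thesis
    proof (cases "t - real n * P \<le> Q")
      case True
      then show ?thesis unfolding z using s by (intro assms(3)) (auto simp: Q_def)
    next
      case False
      have "z (t - real n * P) = z (P - (t - real n * P))"
        using per[of "- (t - real n * P)"] ev[of "t - real n * P"] by (simp add: algebra_simps)
      moreover have "P - (t - real n * P) \<le> Q" using False P_def by linarith
      then have "P - (t - real n * P) \<in> {0..real N * pi}" using s(2) by (simp add: Q_def)
      ultimately show ?thesis unfolding z using assms(3) by simp
    qed
  qed
  show ?thesis using pos[of t] pos[of "- t"] ev[of t] by (cases "0 \<le> t") auto
qed

theorem theorem1:
  fixes N p :: nat and xs :: real
  assumes "1 \<le> N"
    and "p \<in> {1..nat \<lfloor>2 * sqrt 2 * real N\<rfloor>}"
    and "0 < xs"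
    and "\<And>e z t. 0 \<le> e \<Longrightarrow> e < 1 \<Longrightarrow> sitnikov_solution e z \<Longrightarrow> even_periodic N z
           \<Longrightarrow> \<bar>z t\<bar> < xs"
  shows "\<exists>(es :: real) (G :: real \<Rightarrow> real) (H :: real \<Rightarrow> real).
           0 < es \<and> es < 1 \<and>
           (\<forall>e\<in>{0..es}. G e = xi N p + gamma_const N p xs es * e \<and> 0 < G e) \<and>
           smooth_on {0..<es} H \<and> H 0 = xi N p \<and>
           (\<forall>e\<in>{0..<es}.
              let Z = sitnikov_z (H e) e in
                sitnikov_solution e Z \<and> even_periodic N Z \<and>
                deriv Z 0 = 0 \<and> deriv Z (real N * pi) = 0 \<and>
                (\<forall>t. \<bar>Z t\<bar> \<le> G e))"
proof -
  note X = xi_props[OF assms(1,2)]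
  have sol: "sitnikov_solution e (sitnikov_z \<xi> e)" if "0 \<le> e" "e < 1" for \<xi> e
    using sitnikov_z_props(1)[OF that] by (auto simp: sitnikov_solution_iff)
  \<comment> \<open>The a priori bound, applied to \<phi>_p itself, places \<xi>_p in the range over
    which \<open>r0\<close> is a supremum.\<close>
  have "\<bar>sitnikov_z (xi N p) 0 0\<bar> < xs" by (rule assms(4)[OF _ _ sol X(3)]) auto
  then have xs: "xi N p \<in> {0..xs}" using X(1) by (simp add: circ_0)
  \<comment> \<open>The rate at es = 0, because es is not known yet; \<open>gamma_const_mono\<close>
    returns to the actual es.\<close>
  define \<gamma> where "\<gamma> = gamma_const N p xs 0"
  have "12 * (2 * (r0 N xs)\<^sup>2 * (real N * pi) * (r0 N xs / \<bar>dphi1_end N p\<bar> + 1)) < \<gamma>"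
    unfolding \<gamma>_def by (rule gamma_const_lower[OF assms(1,3) X(4)])
  then obtain es H where es: "0 < es" "es < 1" "smooth_on {0..<es} H" "H 0 = xi N p"
    and H: "\<And>e. e \<in> {0..<es} \<Longrightarrow> deriv (sitnikov_z (H e) e) (real N * pi) = 0"
      "\<And>e t. e \<in> {0..<es} \<Longrightarrow> t \<in> {0..real N * pi} \<Longrightarrow>
        \<bar>sitnikov_z (H e) e t - sitnikov_z (xi N p) 0 t\<bar> \<le> \<gamma> * e"
    using continuation[OF assms(1) xs X(2)] X(4) unfolding dphi1_end_def by blast
  have "0 < real N * pi" using assms(1) by simp
  \<comment> \<open>At one positive e the estimate itself shows that \<gamma> is nonnegative, which
    gives G > 0.\<close>
  then have "\<bar>sitnikov_z (H (es / 2)) (es / 2) 0 - sitnikov_z (xi N p) 0 0\<bar> \<le> \<gamma> * (es / 2)"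
    using es by (intro H(2)) auto
  then have "0 \<le> \<gamma> * (es / 2)" using abs_ge_zero order_trans by blast
  then have \<gamma>: "0 \<le> \<gamma>" using es(1) by (simp add: zero_le_mult_iff)
  have \<gamma>es: "\<gamma> \<le> gamma_const N p xs es" unfolding \<gamma>_def by (rule gamma_const_mono) (use assms es in auto)
  define G where "G e = xi N p + gamma_const N p xs es * e" for e
  have "let Z = sitnikov_z (H e) e in sitnikov_solution e Z \<and> even_periodic N Z \<and>
      deriv Z 0 = 0 \<and> deriv Z (real N * pi) = 0 \<and> (\<forall>t. \<bar>Z t\<bar> \<le> G e)" if e: "e \<in> {0..<es}" for e
  proof -
    have e01: "0 \<le> e" "e < 1" using e es by auto
    have ep: "even_periodic N (sitnikov_z (H e) e)"
      by (rule sit_even_periodic[OF e01 sitnikov_z_props(1)[OF e01] sitnikov_z_props(3)[OF e01] H(1)[OF e]])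
    have "\<bar>sitnikov_z (H e) e t\<bar> \<le> G e" for t
    proof (rule even_periodic_bound[OF ep assms(1)])
      fix t assume "t \<in> {0..real N * pi}"
      from H(2)[OF e this] circ_energy[of "xi N p" t] X(1)
      have "\<bar>sitnikov_z (H e) e t\<bar> \<le> xi N p + \<gamma> * e" by simp
      also have "\<dots> \<le> G e" unfolding G_def using \<gamma>es e01 by (intro add_left_mono mult_right_mono) auto
      finally show "\<bar>sitnikov_z (H e) e t\<bar> \<le> G e" .
    qed
    then show ?thesis using sol[OF e01] ep sitnikov_z_props(3)[OF e01] H(1)[OF e] by (simp add: Let_def)
  qed
  note A = this
  have B: "G e = xi N p + gamma_const N p xs es * e \<and> 0 < G e" if "e \<in> {0..es}" for e
    using X(1) \<gamma> \<gamma>es that by (auto simp: G_def intro!: add_pos_nonneg mult_nonneg_nonneg)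
  show ?thesis
    by (rule exI[of _ es], rule exI[of _ G], rule exI[of _ H]) (use A B es in blast)
qed

end
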